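(* Let $1<p<\infty$ and let $\mathcal H$ be any one of the following Haar systems: $\mathcal H_{b,\varphi}$ or $\mathcal H_{b,\varphi}^d$ (in $\mathbb R^2$, with $b>0$, $\varphi\in(0,\pi)$), $\mathcal H_{a,b}^{\vartriangle}$ (in $\mathbb R^2$, with $a,b\in\mathbb R$, $b\neq 0$), or $\mathcal H_{new}^n$ (in $\mathbb R^n$). If $T_\sigma$ is any martingale transform associated to $\mathcal H$, then $$\|T_\sigma\|_{p}\leqslant p^*-1 ,$$ and this estimate is sharp, i.e. for each such $\mathcal H$ the number $p^*-1$ is the supremum of $\|T_\sigma\|_p$ over all martingale transforms $T_\sigma$ associated to $\mathcal H$.
   Context: For $1<p<\infty$ put $p^*=\max\{p,q\}$, where $1/p+1/q=1$. $\|\cdot\|_p$ denotes the operator norm on the complex space $L^p(\mathbb R^n)$ ($n=2$ for the planar systems). $S^1=\{z\in\mathbb C:|z|=1\}$. Martingale transform: given an orthonormal system $\mathcal H$ of real bounded compactly supported functions and an arbitrary family $\sigma=(\sigma_h)_{h\in\mathcal H}$ with $\sigma_h\in S^1$, the associated martingale transform is $T_\sigma f=\sum_{h\in\mathcal H}\sigma_h\langle f,h\rangle h$, defined first on test functions (continuous, compactly supported, complex-valued, with integral zero; these are dense in $L^p$) and extended to $L^p$. Squares. For an interval $I$ with left half $I_-$ and right half $I_+$ let $h_I=|I|^{-1/2}(\chi_{I_+}-\chi_{I_-})$. A dyadic interval is $[m2^k,(m+1)2^k)$ with $m,k\in\mathbb Z$; a dyadic square is $Q=I\times J$ with $I,J$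 dyadic of equal length. Put $h_Q^1(s,t)=|I|^{-1/2}\chi_I(s)h_J(t)$, $h_Q^2(s,t)=|J|^{-1/2}h_I(s)\chi_J(t)$, $h_Q^3(s,t)=h_I(s)h_J(t)$, and $h_{Q_0}=h_Q^1$, $h_{Q_\pm}=\frac1{\sqrt2}(h_Q^2\pm h_Q^3)$; $\quad h^d_{Q_0}=h_Q^3$, $h^d_{Q_\pm}=\frac1{\sqrt2}(h_Q^1\pm h_Q^2)$. Parallelograms. For $b>0$, $\varphi\in(0,\pi)$ let $A(s,t)=(s+tb\cos\varphi,\;tb\sin\varphi)$, which maps the unit square to the parallelogram with lower side $[0,1)\times\{0\}$, sides of lengths $1$ and $b$, and angle $\varphi$ at the bottom left corner. Then $\mathcal H_{b,\varphi}=\{|\det A|^{-1/2}\,h_{Q_*}\circ A^{-1}: Q \text{ a dyadic square},\ *\in\{0,+,-\}\}$ and $\mathcal H^d_{b,\varphi}=\{|\det A|^{-1/2}\,h^d_{Q_*}\circ A^{-1}: Q \text{ a dyadic square},\ *\in\{0,+,-\}\}$. Triangles. Let $D_0$ be the triangle with vertices $(0,0),(1,0),(0,1)$. On $D_0$ define (a.e.): $h_0=\sqrt2$ on $[0,\frac12]^2$ and $-\sqrt2$ on the rest of $D_0$; $h_+=2$ on $D_0\cap\{y>\frac12\}$, $-2$ on $D_0\cap\{x>\frac12\}$, and $0$ elsewhere; $h_-=2$ on $\{x,y>0,\ x+y<\frac12\}$, $-2$ on $[0,\frac12]^2\cap\{x+y>\frac12\}$, and $0$ elsewhere. The standard triangular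 lattice consists, for each $k\in\mathbb Z$, of the triangles obtained by cutting every dyadic square of side $2^k$ along the diagonal joining its top left to its bottom right corner; every such triangle is $D=c+\epsilon 2^kD_0$ with $\epsilon\in\{1,-1\}$, $c\in\mathbb R^2$, and its three Haar functions are $h_{D_*}(x)=2^{-k}h_*\big(\epsilon 2^{-k}(x-c)\big)$, $*\in\{0,+,-\}$. For $a,b\in\mathbb R$, $b\ne0$, let $U(x,y)=(x+ay,by)$, so that $U(D_0)$ has vertices $(0,0),(1,0),(a,b)$. Then $\mathcal H_{a,b}^{\vartriangle}=\{|b|^{-1/2}h_{D_*}\circ U^{-1}\}$, where $D$ runs over the standard triangular lattice and $*\in\{0,+,-\}$. Dimension $n$. For each dyadic cube $Q\subset\mathbb R^n$ (a product of $n$ dyadic intervals of equal length) fix an ordering $Q_1,\dots,Q_{2^n}$ of its $2^n$ dyadic subcubes of half the side length. To $Q$ assign the $2^n-1$ functions, indexed by $0\le j\le n-1$ and $0\le i\le 2^j-1$, obtained by $L^2$-normalizing $\sum_{l=1}^{2^{n-j-1}}\chi_{Q_{i2^{n-j}+l}}-\sum_{l=2^{n-j-1}+1}^{2^{n-j}}\chi_{Q_{i2^{n-j}+l}}$. The system $\mathcal H_{new}^n$ consists of all these functions for all dyadic cubes $Q$. *)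

theory Defs
  imports "HOL-Analysis.Analysis"
begin

section \<open>Complex Lebesgue spaces on a Euclidean space\<close>

text \<open>Functions are not identified modulo null sets; operators on $L^p$ are therefore
  maps on functions whose properties are required almost everywhere.\<close>

definition Lp_space :: "real \<Rightarrow> ('a::euclidean_space \<Rightarrow> complex) set" where
  "Lp_space p = {f \<in> borel_measurable lborel. integrable lborel (\<lambda>x. norm (f x) powr p)}"

definition Lp_norm :: "real \<Rightarrow> ('a::euclidean_space \<Rightarrow> 'b::real_normed_vector) \<Rightarrow> real" where
  "Lp_norm p f = (\<integral>x. norm (f x) powr p \<partial>lborel) powr (1 / p)"

definition bounded_Lp_operator ::
  "real \<Rightarrow> (('a::euclidean_space \<Rightarrow> complex) \<Rightarrow> 'a \<Rightarrow> complex) \<Rightarrow> bool" where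
  "bounded_Lp_operator p T \<longleftrightarrow>
     (\<forall>f\<in>Lp_space p. T f \<in> Lp_space p) \<and>
     (\<forall>f\<in>Lp_space p. \<forall>g\<in>Lp_space p. AE x in lborel. T (\<lambda>y. f y + g y) x = T f x + T g x) \<and>
     (\<forall>c. \<forall>f\<in>Lp_space p. AE x in lborel. T (\<lambda>y. c * f y) x = c * T f x) \<and>
     (\<exists>C. \<forall>f\<in>Lp_space p. Lp_norm p (T f) \<le> C * Lp_norm p f)"

definition Lp_opnorm ::
  "real \<Rightarrow> (('a::euclidean_space \<Rightarrow> complex) \<Rightarrow> 'a \<Rightarrow> complex) \<Rightarrow> real" where
  "Lp_opnorm p T = (SUP f \<in> {f \<in> Lp_space p. Lp_norm p f \<le> 1}. Lp_norm p (T f))"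


section \<open>Martingale transforms\<close>

definition test_functions :: "('a::euclidean_space \<Rightarrow> complex) set" where
  "test_functions = {f. continuous_on UNIV f \<and> compact (closure {x. f x \<noteq> 0}) \<and>
                        (\<integral>x. f x \<partial>lborel) = 0}"

text \<open>$g = \sum_{h \in H} \sigma_h \langle f, h\rangle h$, the sum being the unconditional
  limit in $L^2$ of its finite partial sums.\<close>

definition has_transform_sum ::
  "('a::euclidean_space \<Rightarrow> real) set \<Rightarrow> (('a \<Rightarrow> real) \<Rightarrow> complex) \<Rightarrow>
   ('a \<Rightarrow> complex) \<Rightarrow> ('a \<Rightarrow> complex) \<Rightarrow> bool" where
  "has_transform_sum H \<sigma> f g \<longleftrightarrow> g \<in> Lp_space 2 \<and>
     ((\<lambda>F. Lp_norm 2 (\<lambda>x. (\<Sum>h\<in>F. \<sigma> h * (\<integral>y. f y * of_real (h y) \<partial>lborel) * of_real (h x)) - g x))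
        \<longlongrightarrow> 0) (finite_subsets_at_top H)"

text \<open>\<open>T\<close> is (a version of) the continuous extension to $L^p$ of the transform given on
  test functions by the series.\<close>

definition martingale_transform ::
  "real \<Rightarrow> ('a::euclidean_space \<Rightarrow> real) set \<Rightarrow> (('a \<Rightarrow> real) \<Rightarrow> complex) \<Rightarrow>
   (('a \<Rightarrow> complex) \<Rightarrow> 'a \<Rightarrow> complex) \<Rightarrow> bool" where
  "martingale_transform p H \<sigma> T \<longleftrightarrow>
     bounded_Lp_operator p T \<and> (\<forall>f\<in>test_functions. has_transform_sum H \<sigma> f (T f))"

text \<open>The first clause asserts that the transforms exist as bounded operators on $L^p$. Together
  with the second one it makes the real supremum in the third one a supremum of a nonempty
  bounded set.\<close>

definition sharp_transform_bound ::
  "real \<Rightarrow> ('a::euclidean_space \<Rightarrow> real) set \<Rightarrow> real \<Rightarrow> bool" where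
  "sharp_transform_bound p H C \<longleftrightarrow>
     (\<forall>\<sigma>. (\<forall>h\<in>H. norm (\<sigma> h) = 1) \<longrightarrow> (\<exists>T. martingale_transform p H \<sigma> T)) \<and>
     (\<forall>\<sigma> T. (\<forall>h\<in>H. norm (\<sigma> h) = 1) \<and> martingale_transform p H \<sigma> T \<longrightarrow> Lp_opnorm p T \<le> C) \<and>
     Sup {Lp_opnorm p T | \<sigma> T. (\<forall>h\<in>H. norm (\<sigma> h) = 1) \<and> martingale_transform p H \<sigma> T} = C"


section \<open>Haar functions on dyadic squares and parallelograms\<close>

definition dyadic_interval :: "int \<Rightarrow> int \<Rightarrow> real set" where
  "dyadic_interval k m = {of_int m * 2 powi k ..< (of_int m + 1) * 2 powi k}"

definition haar_interval :: "int \<Rightarrow> int \<Rightarrow> real \<Rightarrow> real" where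
  "haar_interval k m x = (2 powi k) powr (- 1 / 2) *
     (indicator (dyadic_interval (k - 1) (2 * m + 1)) x - indicator (dyadic_interval (k - 1) (2 * m)) x)"

text \<open>In the following three definitions the dyadic square is
  \<open>dyadic_interval k m \<times> dyadic_interval k n\<close>.\<close>

definition haar_square1 :: "int \<Rightarrow> int \<Rightarrow> int \<Rightarrow> real \<times> real \<Rightarrow> real" where
  "haar_square1 k m n = (\<lambda>(s, t).
     (2 powi k) powr (- 1 / 2) * indicator (dyadic_interval k m) s * haar_interval k n t)"

definition haar_square2 :: "int \<Rightarrow> int \<Rightarrow> int \<Rightarrow> real \<times> real \<Rightarrow> real" where
  "haar_square2 k m n = (\<lambda>(s, t).
     (2 powi k) powr (- 1 / 2) * haar_interval k m s * indicator (dyadic_interval k n) t)"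

definition haar_square3 :: "int \<Rightarrow> int \<Rightarrow> int \<Rightarrow> real \<times> real \<Rightarrow> real" where
  "haar_square3 k m n = (\<lambda>(s, t). haar_interval k m s * haar_interval k n t)"

definition square_system :: "(real \<times> real \<Rightarrow> real) set" where
  "square_system = (\<Union>k m n.
     {haar_square1 k m n,
      \<lambda>z. 1 / sqrt 2 * (haar_square2 k m n z + haar_square3 k m n z),
      \<lambda>z. 1 / sqrt 2 * (haar_square2 k m n z - haar_square3 k m n z)})"

definition square_system_d :: "(real \<times> real \<Rightarrow> real) set" where
  "square_system_d = (\<Union>k m n.
     {haar_square3 k m n,
      \<lambda>z. 1 / sqrt 2 * (haar_square1 k m n z + haar_square2 k m n z),
      \<lambda>z. 1 / sqrt 2 * (haar_square1 k m n z - haar_square2 k m n z)})"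

definition parallelogram_map :: "real \<Rightarrow> real \<Rightarrow> real \<times> real \<Rightarrow> real \<times> real" where
  "parallelogram_map b \<phi> = (\<lambda>(s, t). (s + t * b * cos \<phi>, t * b * sin \<phi>))"

text \<open>The determinant of \<open>parallelogram_map b \<phi>\<close> is \<open>b * sin \<phi>\<close>.\<close>

definition parallelogram_system :: "real \<Rightarrow> real \<Rightarrow> (real \<times> real \<Rightarrow> real) set" where
  "parallelogram_system b \<phi> =
     (\<lambda>h z. \<bar>b * sin \<phi>\<bar> powr (- 1 / 2) * h (inv (parallelogram_map b \<phi>) z)) ` square_system"

definition parallelogram_system_d :: "real \<Rightarrow> real \<Rightarrow> (real \<times> real \<Rightarrow> real) set" where
  "parallelogram_system_d b \<phi> =
     (\<lambda>h z. \<bar>b * sin \<phi>\<bar> powr (- 1 / 2) * h (inv (parallelogram_map b \<phi>) z)) ` square_system_d"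


section \<open>Haar functions on triangles\<close>

definition std_triangle :: "(real \<times> real) set" where
  "std_triangle = convex hull {(0, 0), (1, 0), (0, 1)}"

definition haar_triangle_0 :: "real \<times> real \<Rightarrow> real" where
  "haar_triangle_0 z =
     (if z \<in> {0..1/2} \<times> {0..1/2} then sqrt 2 else if z \<in> std_triangle then - sqrt 2 else 0)"

definition haar_triangle_plus :: "real \<times> real \<Rightarrow> real" where
  "haar_triangle_plus = (\<lambda>(x, y).
     if (x, y) \<in> std_triangle \<and> y > 1/2 then 2
     else if (x, y) \<in> std_triangle \<and> x > 1/2 then - 2 else 0)"

definition haar_triangle_minus :: "real \<times> real \<Rightarrow> real" where
  "haar_triangle_minus = (\<lambda>(x, y).
     if x > 0 \<and> y > 0 \<and> x + y < 1/2 then 2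
     else if (x, y) \<in> {0..1/2} \<times> {0..1/2} \<and> x + y > 1/2 then - 2 else 0)"

text \<open>The two triangles obtained by cutting the closed dyadic square with lower left corner
  $(m 2^k, n 2^k)$ and side $2^k$ along the diagonal from top left to bottom right.\<close>

definition triangular_lattice :: "int \<Rightarrow> (real \<times> real) set set" where
  "triangular_lattice k = (\<Union>m n :: int.
     let l = of_int m * 2 powi k; r = (of_int m + 1) * 2 powi k;
         d = of_int n * 2 powi k; u = (of_int n + 1) * 2 powi k
     in {convex hull {(l, d), (r, d), (l, u)}, convex hull {(r, u), (l, u), (r, d)}})"

definition std_triangle_system :: "(real \<times> real \<Rightarrow> real) set" where
  "std_triangle_system =
     {\<lambda>z. 2 powi (- k) * h ((\<epsilon> * 2 powi (- k)) *\<^sub>R (z - c)) | h k \<epsilon> c.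
        h \<in> {haar_triangle_0, haar_triangle_plus, haar_triangle_minus} \<and> \<epsilon> \<in> {1, - 1} \<and>
        (\<lambda>z. c + (\<epsilon> * 2 powi k) *\<^sub>R z) ` std_triangle \<in> triangular_lattice k}"

definition triangle_map :: "real \<Rightarrow> real \<Rightarrow> real \<times> real \<Rightarrow> real \<times> real" where
  "triangle_map a b = (\<lambda>(x, y). (x + a * y, b * y))"

definition triangle_system :: "real \<Rightarrow> real \<Rightarrow> (real \<times> real \<Rightarrow> real) set" where
  "triangle_system a b =
     (\<lambda>h z. \<bar>b\<bar> powr (- 1 / 2) * h (inv (triangle_map a b) z)) ` std_triangle_system"


section \<open>Haar functions on cubes\<close>

definition dyadic_cube :: "int \<Rightarrow> ('n::finite \<Rightarrow> int) \<Rightarrow> (real ^ 'n) set" where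
  "dyadic_cube k m = {x. \<forall>i. x $ i \<in> dyadic_interval k (m i)}"

definition subcubes :: "int \<Rightarrow> ('n::finite \<Rightarrow> int) \<Rightarrow> (real ^ 'n) set set" where
  "subcubes k m = {R. R \<in> range (dyadic_cube (k - 1)) \<and> R \<subseteq> dyadic_cube k m}"

text \<open>\<open>q k m 1, \<dots>, q k m (2 ^ CARD('n))\<close> is the chosen enumeration of the subcubes of
  \<open>dyadic_cube k m\<close>.\<close>

definition subcube_ordering :: "(int \<Rightarrow> ('n::finite \<Rightarrow> int) \<Rightarrow> nat \<Rightarrow> (real ^ 'n) set) \<Rightarrow> bool" where
  "subcube_ordering q \<longleftrightarrow> (\<forall>k m. bij_betw (q k m) {1..2 ^ CARD('n)} (subcubes k m))"

definition cube_difference :: "(nat \<Rightarrow> (real ^ 'n::finite) set) \<Rightarrow> nat \<Rightarrow> nat \<Rightarrow> real ^ 'n \<Rightarrow> real" where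
  "cube_difference Q j i x =
     (\<Sum>l = 1..2 ^ (CARD('n) - j - 1). indicator (Q (i * 2 ^ (CARD('n) - j) + l)) x) -
     (\<Sum>l = 2 ^ (CARD('n) - j - 1) + 1..2 ^ (CARD('n) - j). indicator (Q (i * 2 ^ (CARD('n) - j) + l)) x)"

definition new_haar_system ::
  "(int \<Rightarrow> ('n::finite \<Rightarrow> int) \<Rightarrow> nat \<Rightarrow> (real ^ 'n) set) \<Rightarrow> (real ^ 'n \<Rightarrow> real) set" where
  "new_haar_system q =
     {\<lambda>x. cube_difference (q k m) j i x / Lp_norm 2 (cube_difference (q k m) j i) | k m j i.
        j \<le> CARD('n) - 1 \<and> i \<le> 2 ^ j - 1}"

end

(* Idea. Every system arises from a chain of partitions in which each atom is halved at each step,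
   so a finite Haar sum and its transform form a pair of dyadic martingales (f, g) with
   |dg| = |df|. Burkholder's function U majorizes |y|^p - (p* - 1)^p |x|^p and is concave along all
   directions (h, k) with |h| = |k|; hence the integral of U(f, g) does not increase when Haar terms
   are added from coarse to fine, and it starts at 0. This gives the bound for finite sums, and the
   transform on L^p is the operator whose graph is the closure of the pairs of finite sums.

   For the sharpness, a constant C admissible for all finite sums with signs +1, -1 makes the
   best expected value B(x, y) of |g|^p - C^p |f|^p over all such martingales started at (x, y)
   finite. B is homogeneous, even, and concave in both diagonal directions, and comparing its
   values near (0, 1) and (1, 0) to first order forces C >= p* - 1. *)
theory Submission
  imports Defs
begin


section \<open>Burkholder's function\<close>

text \<open>\<open>burkholder p r s\<close> equals
  \<open>(r + s) powr (p - 1) * (s - (p - 1) * r)\<close>. It is evaluated at moduli, so unimodular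
  complex coefficients cost no more than signs. Three obstacles shape the rest. The geometry offers
  cells with \<open>2 ^ d\<close> children rather than two: the \<open>d\<close> halvings come from
  grouping consecutive children in a chosen enumeration, so that each concrete system reduces to a
  choice of enumeration and, in the plane, a linear map. Next, a transform is prescribed on test
  functions by an unconditional L^2 sum but acts on L^p; the two are matched by approximating a test
  function by one sequence of finite Haar sums that converges for every exponent, and by the fact
  that for exponent 2 the constant is 1. Finally, the upper bound must hold for every bounded
  operator that agrees with the series on test functions, whatever its a priori norm, and this is
  where the density of mean-zero test functions enters.\<close>

definition burkholder :: "real \<Rightarrow> real \<Rightarrow> real \<Rightarrow> real" where
  "burkholder p r s = (r + s) powr p - p * r * (r + s) powr (p - 1)"

section \<open>Concavity along pairs of directions of equal length\<close>

text \<open>Both radii are assumed to solve \<open>u * u'' + u'^2 = c\<close> with the same constant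
  \<open>c\<close>. Because of this the second derivative of \<open>r\<close> drops out, and what
  remains is \<open>- p * (p - 2)\<close> times a quantity that is nonnegative for
  \<open>p > 1\<close> as soon as \<open>s'^2 \<le> c\<close>.\<close>

lemma burkholder_second_derivative:
  fixes r s r' s' :: "real \<Rightarrow> real"
  assumes pos: "r t > 0" "s t > 0"
    and r: "(r has_real_derivative r' t) (at t)" and s: "(s has_real_derivative s' t) (at t)"
    and r': "(r' has_real_derivative (c - (r' t)\<^sup>2) / r t) (at t)"
    and s': "(s' has_real_derivative (c - (s' t)\<^sup>2) / s t) (at t)"
  shows "((\<lambda>t. burkholder p (r t) (s t)) has_real_derivative
            p * (r t + s t) powr (p - 1) * s' t
            - p * (p - 1) * r t * (r t + s t) powr (p - 2) * (r' t + s' t)) (at t)"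
    and "((\<lambda>t. p * (r t + s t) powr (p - 1) * s' t
            - p * (p - 1) * r t * (r t + s t) powr (p - 2) * (r' t + s' t)) has_real_derivative
            - p * (p - 2) * ((p - 1) * r t * (r t + s t) powr (p - 3) * (r' t + s' t)\<^sup>2
              + (r t + s t) powr (p - 1) * ((c - (s' t)\<^sup>2) / s t))) (at t)"
proof -
  define w where "w = r t + s t"
  have w: "w > 0" using pos by (simp add: w_def)
  have e1: "w powr (p - 1) = w^2 * w powr (p - 3)" "w powr (p - 2) = w * w powr (p - 3)"
           "w powr p = w^3 * w powr (p - 3)"
    using w by (simp_all add: powr_diff powr_add powr_numeral power2_eq_square power3_eq_cube field_simps)
  have ar: "p - 1 - 1 = p - 2" "p - 2 - 1 = p - 3" by auto
  have d1: "((\<lambda>t. (r t + s t) powr a) has_real_derivative a * w powr (a - 1) * (r' t + s' t)) (at t)" for a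
    using w by (auto intro!: derivative_eq_intros r s simp: w_def)
  show "((\<lambda>t. burkholder p (r t) (s t)) has_real_derivative
            p * (r t + s t) powr (p - 1) * s' t
            - p * (p - 1) * r t * (r t + s t) powr (p - 2) * (r' t + s' t)) (at t)"
    unfolding burkholder_def
    by (rule derivative_eq_intros d1 r s refl)+
       (simp add: w_def[symmetric] ar algebra_simps)
  show "((\<lambda>t. p * (r t + s t) powr (p - 1) * s' t
            - p * (p - 1) * r t * (r t + s t) powr (p - 2) * (r' t + s' t)) has_real_derivative
            - p * (p - 2) * ((p - 1) * r t * (r t + s t) powr (p - 3) * (r' t + s' t)\<^sup>2
              + (r t + s t) powr (p - 1) * ((c - (s' t)\<^sup>2) / s t))) (at t)"
  proof -
    define P1 P2 where "P1 = (\<lambda>t. (r t + s t) powr (p - 1))" and "P2 = (\<lambda>t. (r t + s t) powr (p - 2))"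
    have dP: "(P1 has_real_derivative (p - 1) * w powr (p - 2) * (r' t + s' t)) (at t)"
        "(P2 has_real_derivative (p - 2) * w powr (p - 3) * (r' t + s' t)) (at t)"
      using d1[of "p - 1"] d1[of "p - 2"] by (simp_all add: P1_def P2_def ar)
    define W where "W = w powr (p - 3)"
    define A B where "A = r' t" and "B = s' t"
    define x y where "x = r t" and "y = s t"
    define R S where "R = (c - A\<^sup>2) / x" and "S = (c - B\<^sup>2) / y"
    have k: "x * R = c - A^2" "y * S = c - B^2"
      using pos by (simp_all add: R_def S_def x_def y_def)
    have wxy: "w = x + y" by (simp add: w_def x_def y_def)
    \<comment> \<open>The two sides differ by \<open>p * (p - 1) * w * W\<close> times the
      difference of the two equations in \<open>k\<close>, so the common constant \<open>c\<close>
      cancels.\<close>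
    have key: "p * w^2 * W * S + p * ((p-1) * (w * W) * (A+B)) * B
       - (p*(p-1)*x*(w*W) * (R+S) + (p*(p-1)*A*(w*W) + p*(p-1)*x*((p-2)*W*(A+B))) * (A+B))
       = - p * (p-2) * ((p-1)*x*W*(A+B)^2 + w^2*W*S)"
    proof -
      have "p * w^2 * W * S + p * ((p-1) * (w * W) * (A+B)) * B
       - (p*(p-1)*x*(w*W) * (R+S) + (p*(p-1)*A*(w*W) + p*(p-1)*x*((p-2)*W*(A+B))) * (A+B))
       + p * (p-2) * ((p-1)*x*W*(A+B)^2 + w^2*W*S)
        = p*(p-1)*w*W* ((y*S - (c - B^2)) - (x * R - (c - A^2)))"
        unfolding wxy by (simp add: algebra_simps power2_eq_square)
      then show ?thesis using k by simp
    qed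
    have "((\<lambda>t. p * P1 t * s' t - p * (p - 1) * r t * P2 t * (r' t + s' t)) has_real_derivative
            - p * (p - 2) * ((p - 1) * r t * (r t + s t) powr (p - 3) * (r' t + s' t)\<^sup>2
              + (r t + s t) powr (p - 1) * ((c - (s' t)\<^sup>2) / s t))) (at t)"
      apply (rule derivative_eq_intros dP r s r' s' refl)+
      using key
      unfolding P1_def P2_def
      unfolding w_def[symmetric]
      unfolding ar e1 A_def[symmetric] B_def[symmetric] x_def[symmetric] y_def[symmetric]
      unfolding R_def[symmetric] S_def[symmetric] W_def[symmetric]
      by (simp add: algebra_simps power2_eq_square)
    then show ?thesis by (simp add: P1_def P2_def)
  qed
qed

text \<open>The square of the modulus is a quadratic polynomial in \<open>t\<close> with leading
  coefficient \<open>|h|^2\<close>; differentiating it twice gives the equation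
  \<open>u * u'' + u'^2 = |h|^2\<close>. The last bound is the Cauchy-Schwarz inequality.\<close>

lemma cmod_line_derivative:
  fixes x h :: complex
  assumes nz: "x + of_real t * h \<noteq> 0"
  defines "r \<equiv> \<lambda>t. cmod (x + of_real t * h)"
    and "r' \<equiv> \<lambda>t. (Re (x * cnj h) + t * (cmod h)\<^sup>2) / cmod (x + of_real t * h)"
  shows "(r has_real_derivative r' t) (at t)"
    and "(r' has_real_derivative ((cmod h)\<^sup>2 - (r' t)\<^sup>2) / r t) (at t)"
    and "(r' t)\<^sup>2 \<le> (cmod h)\<^sup>2"
proof -
  have sq: "r u = sqrt ((Re x + u * Re h)\<^sup>2 + (Im x + u * Im h)\<^sup>2)" for u
    by (simp add: r_def cmod_def)
  have pos: "r t > 0" using nz by (simp add: r_def)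
  have num: "Re (x * cnj h) + t * (cmod h)\<^sup>2 = (Re x + t * Re h) * Re h + (Im x + t * Im h) * Im h" for t
    unfolding cmod_power2 by (simp add: algebra_simps power2_eq_square)
  have pos': "(Re x + t * Re h)\<^sup>2 + (Im x + t * Im h)\<^sup>2 > 0"
    using pos unfolding sq by simp
  have "((\<lambda>u. (Re x + u * Re h)\<^sup>2 + (Im x + u * Im h)\<^sup>2) has_real_derivative
      2 * (Re (x * cnj h) + t * (cmod h)\<^sup>2)) (at t)"
    unfolding num by (auto intro!: derivative_eq_intros simp: algebra_simps)
  note dd = DERIV_chain2[OF DERIV_real_sqrt[OF pos'] this]
  have req: "r = (\<lambda>u. sqrt ((Re x + u * Re h)\<^sup>2 + (Im x + u * Im h)\<^sup>2))"
    using sq by (rule ext)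
  have de: "inverse (sqrt ((Re x + t * Re h)\<^sup>2 + (Im x + t * Im h)\<^sup>2)) / 2
      * (2 * (Re (x * cnj h) + t * (cmod h)\<^sup>2)) = r' t"
  proof -
    have "inverse (r t) / 2 * (2 * (Re (x * cnj h) + t * (cmod h)\<^sup>2)) = r' t"
      unfolding r'_def r_def by (simp only: divide_inverse) (simp only: inverse_eq_divide times_divide_eq_left times_divide_eq_right mult_1_left mult.commute nonzero_mult_div_cancel_left)
    then show ?thesis by (subst (asm) sq)
  qed
  show d: "(r has_real_derivative r' t) (at t)"
    unfolding req using dd unfolding de .
  have "((\<lambda>t. (Re (x * cnj h) + t * (cmod h)\<^sup>2) / r t) has_real_derivative
      ((cmod h)\<^sup>2 * r t - (Re (x * cnj h) + t * (cmod h)\<^sup>2) * r' t) / (r t * r t)) (at t)"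
    by (rule derivative_eq_intros d refl)+ (use pos in auto)
  then have "(r' has_real_derivative ((cmod h)\<^sup>2 * r t - (Re (x * cnj h) + t * (cmod h)\<^sup>2) * r' t) / (r t * r t)) (at t)"
    unfolding r'_def r_def .
  moreover have "((cmod h)\<^sup>2 * r t - (Re (x * cnj h) + t * (cmod h)\<^sup>2) * r' t) / (r t * r t)
      = ((cmod h)\<^sup>2 - (r' t)\<^sup>2) / r t"
  proof -
    have "Re (x * cnj h) + t * (cmod h)\<^sup>2 = r' t * r t" using pos by (simp add: r'_def r_def)
    then show ?thesis using pos by (simp add: field_simps power2_eq_square)
  qed
  ultimately show "(r' has_real_derivative ((cmod h)\<^sup>2 - (r' t)\<^sup>2) / r t) (at t)" by simp
  have "Re (x * cnj h) + t * (cmod h)\<^sup>2 = Re ((x + of_real t * h) * cnj h)"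
    unfolding num by (simp add: algebra_simps)
  then have "\<bar>Re (x * cnj h) + t * (cmod h)\<^sup>2\<bar> \<le> r t * cmod h"
    using abs_Re_le_cmod[of "(x + of_real t * h) * cnj h"] by (simp add: r_def norm_mult)
  then have "\<bar>r' t\<bar> \<le> cmod h" using pos by (simp add: r'_def r_def field_simps)
  then show "(r' t)\<^sup>2 \<le> (cmod h)\<^sup>2" using abs_le_square_iff[of "r' t" "cmod h"] by simp
qed

text \<open>The factor \<open>e\<close> carries a sign: \<open>e * (p - 2) \<ge> 0\<close> lets one
  argument give concavity for \<open>p \<ge> 2\<close> and convexity for \<open>p \<le> 2\<close>.
  The function is restricted to a line, where the sign of its second derivative is known, and
  compared at the parameters \<open>1\<close>, \<open>0\<close> and \<open>-1\<close>.\<close>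

lemma burkholder_zigzag_nonvanishing:
  fixes x y h k :: complex
  assumes p: "1 < p" and e: "e * (p - 2) \<ge> 0" and hk: "cmod h = cmod k"
    and nz: "\<And>t::real. x + of_real t * h \<noteq> 0" "\<And>t::real. y + of_real t * k \<noteq> 0"
  shows "e * (burkholder p (cmod (x + h)) (cmod (y + k)) + burkholder p (cmod (x - h)) (cmod (y - k)))
          \<le> e * (2 * burkholder p (cmod x) (cmod y))"
proof -
  define r r' where "r = (\<lambda>t::real. cmod (x + of_real t * h))"
    and "r' = (\<lambda>t. (Re (x * cnj h) + t * (cmod h)\<^sup>2) / cmod (x + of_real t * h))"
  define s s' where "s = (\<lambda>t::real. cmod (y + of_real t * k))"
    and "s' = (\<lambda>t. (Re (y * cnj k) + t * (cmod k)\<^sup>2) / cmod (y + of_real t * k))"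
  have pos: "r t > 0" "s t > 0" for t using nz by (simp_all add: r_def s_def)
  have dr: "(r has_real_derivative r' t) (at t)"
      "(r' has_real_derivative ((cmod h)\<^sup>2 - (r' t)\<^sup>2) / r t) (at t)" for t
    using cmod_line_derivative[OF nz(1)] unfolding r_def r'_def by blast+
  have ds: "(s has_real_derivative s' t) (at t)"
      "(s' has_real_derivative ((cmod h)\<^sup>2 - (s' t)\<^sup>2) / s t) (at t)"
      "(s' t)\<^sup>2 \<le> (cmod h)\<^sup>2" for t
    using cmod_line_derivative[OF nz(2)] unfolding s_def s'_def hk by blast+
  define f where "f = (\<lambda>t. - e * burkholder p (r t) (s t))"
  define f1 where "f1 = (\<lambda>t. - e * (p * (r t + s t) powr (p - 1) * s' t
            - p * (p - 1) * r t * (r t + s t) powr (p - 2) * (r' t + s' t)))"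
  define f2 where "f2 = (\<lambda>t. - e * (- p * (p - 2) * ((p - 1) * r t * (r t + s t) powr (p - 3) * (r' t + s' t)\<^sup>2
              + (r t + s t) powr (p - 1) * (((cmod h)\<^sup>2 - (s' t)\<^sup>2) / s t))))"
  have conv: "convex_on UNIV f"
  proof (rule f''_ge0_imp_convex[where f' = f1 and f'' = f2])
    fix t :: real
    show "(f has_real_derivative f1 t) (at t)" "(f1 has_real_derivative f2 t) (at t)"
      unfolding f_def f1_def f2_def
      by (rule DERIV_cmult burkholder_second_derivative pos dr ds)+
    have "f2 t = p * (e * (p - 2)) * ((p - 1) * r t * (r t + s t) powr (p - 3) * (r' t + s' t)\<^sup>2
              + (r t + s t) powr (p - 1) * (((cmod h)\<^sup>2 - (s' t)\<^sup>2) / s t))"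
      by (simp add: f2_def)
    also have "\<dots> \<ge> 0"
    proof (rule mult_nonneg_nonneg)
      show "0 \<le> p * (e * (p - 2))" using p by (intro mult_nonneg_nonneg[OF _ e]) auto
    qed (use p pos[of t] ds(3)[of t] in \<open>auto intro!: mult_nonneg_nonneg add_nonneg_nonneg\<close>)
    finally show "f2 t \<ge> 0" .
  qed auto
  have "f ((1 - 1/2) *\<^sub>R 1 + (1/2) *\<^sub>R (-1)) \<le> (1 - 1/2) * f 1 + (1/2) * f (-1)"
    by (rule convex_onD[OF conv]) auto
  then show ?thesis by (simp add: f_def r_def s_def algebra_simps)
qed

lemma continuous_burkholder:
  assumes p: "1 < p"
    and "continuous_on A f" "continuous_on A g" "\<And>t. t \<in> A \<Longrightarrow> f t \<ge> 0" "\<And>t. t \<in> A \<Longrightarrow> g t \<ge> 0"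
  shows "continuous_on A (\<lambda>t. burkholder p (f t) (g t))"
  unfolding burkholder_def using assms
  by (intro continuous_intros continuous_on_powr') (auto simp: add_nonneg_eq_0_iff)

text \<open>After division by \<open>h\<close> the line is parallel to the real axis, at height
  \<open>Im (x / h) + 1 / (n + 1)\<close>. At most one value of \<open>n\<close> gives height
  0.\<close>

lemma avoid_line:
  fixes x h :: complex
  assumes "h \<noteq> 0"
  shows "eventually (\<lambda>n. \<forall>t::real. x + \<i> * h / of_nat (Suc n) + of_real t * h \<noteq> 0) sequentially"
proof -
  define a where "a = Im (x / h)"
  have "eventually (\<lambda>n. a + 1 / real (Suc n) \<noteq> 0) sequentially"
  proof (cases "a < 0")
    case True
    have "(\<lambda>n. 1 / real (Suc n)) \<longlonglongrightarrow> 0" using LIMSEQ_inverse_real_of_nat by (simp add: inverse_eq_divide)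
    then have "eventually (\<lambda>n. 1 / real (Suc n) < - a) sequentially"
      by (rule order_tendstoD) (use True in auto)
    then show ?thesis by eventually_elim auto
  next
    case False
    then show ?thesis by (intro always_eventually allI) (smt (verit) divide_pos_pos of_nat_0_less_iff zero_less_Suc)
  qed
  then show ?thesis
  proof eventually_elim
    case (elim n)
    show ?case
    proof (intro allI notI)
      fix t :: real
      assume "x + \<i> * h / of_nat (Suc n) + of_real t * h = 0"
      then have "(x + \<i> * h / of_nat (Suc n) + of_real t * h) / h = 0" by simp
      then have "x / h + \<i> / of_nat (Suc n) + of_real t = 0"
        using assms by (simp add: add_divide_distrib)
      then have "Im (x / h + \<i> / of_nat (Suc n) + of_real t) = 0" by simp
      then have "a + 1 / real (Suc n) = 0"
        unfolding a_def by (simp add: Im_divide_of_nat del: of_nat_Suc)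
      then show False using elim by simp
    qed
  qed
qed

text \<open>The lines may pass through the origin, where the modulus is not smooth; perturbing the base
  point inside the complex plane avoids this.\<close>

lemma burkholder_zigzag:
  fixes x y h k :: complex
  assumes p: "1 < p" and e: "e * (p - 2) \<ge> 0" and hk: "cmod h = cmod k"
  shows "e * (burkholder p (cmod (x + h)) (cmod (y + k)) + burkholder p (cmod (x - h)) (cmod (y - k)))
          \<le> e * (2 * burkholder p (cmod x) (cmod y))"
proof (cases "h = 0")
  case True
  then show ?thesis using hk by simp
next
  case False
  then have k: "k \<noteq> 0" using hk by auto
  define X where "X = (\<lambda>n. x + \<i> * h / of_nat (Suc n))"
  define Y where "Y = (\<lambda>n. y + \<i> * k / of_nat (Suc n))"
  have lim0: "(\<lambda>n. c / of_nat (Suc n)) \<longlonglongrightarrow> (0::complex)" for c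
    using tendsto_mult[OF tendsto_const LIMSEQ_Suc[OF lim_inverse_n], of c]
    by (simp add: field_simps)
  have lim: "X \<longlonglongrightarrow> x" "Y \<longlonglongrightarrow> y"
    unfolding X_def Y_def using tendsto_add[OF tendsto_const lim0] by fastforce+
  have cont: "continuous_on UNIV (\<lambda>z. burkholder p (cmod (fst z)) (cmod (snd z)))"
    by (rule continuous_burkholder[OF p]) (auto intro!: continuous_intros)
  have L: "(\<lambda>n. burkholder p (cmod (X n + a)) (cmod (Y n + b))) \<longlonglongrightarrow> burkholder p (cmod (x + a)) (cmod (y + b))" for a b
  proof -
    have "(\<lambda>n. (X n + a, Y n + b)) \<longlonglongrightarrow> (x + a, y + b)"
      by (intro tendsto_intros lim)
    from continuous_on_tendsto_compose[OF cont this] show ?thesis by simp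
  qed
  have ev: "eventually (\<lambda>n. e * (burkholder p (cmod (X n + h)) (cmod (Y n + k)) + burkholder p (cmod (X n - h)) (cmod (Y n - k)))
          \<le> e * (2 * burkholder p (cmod (X n)) (cmod (Y n)))) sequentially"
    using avoid_line[OF False, of x] avoid_line[OF k, of y]
  proof eventually_elim
    case (elim n)
    then show ?case by (intro burkholder_zigzag_nonvanishing[OF p e hk]) (auto simp: X_def Y_def)
  qed
  have l1: "(\<lambda>n. e * (burkholder p (cmod (X n + h)) (cmod (Y n + k)) + burkholder p (cmod (X n - h)) (cmod (Y n - k))))
     \<longlonglongrightarrow> e * (burkholder p (cmod (x + h)) (cmod (y + k)) + burkholder p (cmod (x - h)) (cmod (y - k)))"
    using L[of h k] L[of "-h" "-k"] by (intro tendsto_intros) auto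
  have l2: "(\<lambda>n. e * (2 * burkholder p (cmod (X n)) (cmod (Y n)))) \<longlonglongrightarrow> e * (2 * burkholder p (cmod x) (cmod y))"
    using L[of 0 0] by (intro tendsto_intros) auto
  show ?thesis
    by (rule tendsto_le[OF trivial_limit_sequentially l2 l1 ev])
qed

section \<open>Majorization of the difference of powers\<close>

text \<open>\<open>\<alpha>\<close> is the factor that makes
  \<open>\<alpha> * burkholder p 1 t\<close> touch \<open>t powr p - (p - 1) powr p\<close> at
  \<open>t = p - 1\<close> to first order. Here the two derivatives, both divided by
  \<open>p\<close>, are compared on either side of the point of contact.\<close>

lemma burkholder_majorant_slope:
  fixes p t :: real
  assumes p: "1 < p" and e: "e * (p - 2) \<ge> 0" and t: "t > 0"
  defines "\<alpha> \<equiv> p powr (2 - p) * (p - 1) powr (p - 1)"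
  shows "t \<ge> p - 1 \<Longrightarrow> \<bar>p - 2\<bar> = e * (p - 2) \<Longrightarrow> \<bar>e\<bar> = 1 \<Longrightarrow>
           e * (\<alpha> * (1 + t) powr (p - 2) * (t - (p - 2))) \<ge> e * t powr (p - 1)"
    and "t \<le> p - 1 \<Longrightarrow> \<bar>p - 2\<bar> = e * (p - 2) \<Longrightarrow> \<bar>e\<bar> = 1 \<Longrightarrow>
           e * (\<alpha> * (1 + t) powr (p - 2) * (t - (p - 2))) \<le> e * t powr (p - 1)"
proof -
  \<comment> \<open>The logarithm of the quotient of the two slopes, up to the constant
    \<open>ln \<alpha>\<close>. Its derivative has the sign of \<open>p - 2\<close>, and at the
    point of contact it equals \<open>- ln \<alpha>\<close>.\<close>
  define E where "E = (\<lambda>t. (p - 2) * ln (1 + t) + ln (t - (p - 2)) - (p - 1) * ln t)"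
  have dE: "(E has_real_derivative (p - 1) * (p - 2) / ((1 + u) * (u - (p - 2)) * u)) (at u)"
    if "u > 0" "u > p - 2" for u
  proof -
    have "(E has_real_derivative (p - 2) / (1 + u) + 1 / (u - (p - 2)) - (p - 1) / u) (at u)"
      unfolding E_def using that by (auto intro!: derivative_eq_intros simp: divide_inverse)
    moreover have "(p - 2) / (1 + u) + 1 / (u - (p - 2)) - (p - 1) / u = (p - 1) * (p - 2) / ((1 + u) * (u - (p - 2)) * u)"
    proof -
      define v where "v = u - (p - 2)"
      have v: "v > 0" "u = v + p - 2" using that by (auto simp: v_def)
      have nz: "1 + u \<noteq> 0" "v \<noteq> 0" "u \<noteq> 0" using that v by auto
      have "(p - 2) / (1 + u) + 1 / v - (p - 1) / u = ((p-2) * v * u + (1+u)*u - (p-1)*(1+u) * v) / ((1 + u) * v * u)"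
        using nz by (simp add: add_frac_eq diff_frac_eq) (simp add: algebra_simps)
      also have "(p-2) * v * u + (1+u)*u - (p-1)*(1+u) * v = (p-1)*(p-2)"
        unfolding v_def by (simp add: algebra_simps)
      finally show ?thesis by (simp add: v_def)
    qed
    ultimately show ?thesis by simp
  qed
  have mono: "e * E a \<le> e * E b" if "a \<le> b" "a > 0" "a > p - 2" for a b
  proof (rule DERIV_nonneg_imp_nondecreasing[OF that(1)])
    fix x assume x: "a \<le> x" "x \<le> b"
    show "\<exists>y. ((\<lambda>t. e * E t) has_real_derivative y) (at x) \<and> y \<ge> 0"
    proof (intro exI conjI)
      show "((\<lambda>t. e * E t) has_real_derivative e * ((p - 1) * (p - 2) / ((1 + x) * (x - (p - 2)) * x))) (at x)"
        using x that by (intro DERIV_cmult dE) auto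
      have "0 \<le> (p - 1) * (e * (p - 2)) / ((1 + x) * (x - (p - 2)) * x)"
        using x that p by (intro divide_nonneg_nonneg mult_nonneg_nonneg e) auto
      then show "0 \<le> e * ((p - 1) * (p - 2) / ((1 + x) * (x - (p - 2)) * x))" by (simp add: ac_simps)
    qed
  qed
  have E0: "E (p - 1) = - ln \<alpha>"
    using p by (simp add: E_def \<alpha>_def ln_mult ln_powr algebra_simps)
  have \<alpha>: "\<alpha> > 0" using p by (simp add: \<alpha>_def)
  have ex: "\<alpha> * (1 + u) powr (p - 2) * (u - (p - 2)) = exp (ln \<alpha> + E u) * u powr (p - 1)"
    if "u > 0" "u > p - 2" for u
    using that \<alpha> by (simp add: E_def exp_add exp_diff powr_def exp_minus field_simps)
  show "e * (\<alpha> * (1 + t) powr (p - 2) * (t - (p - 2))) \<ge> e * t powr (p - 1)"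
    if "t \<ge> p - 1" "\<bar>p - 2\<bar> = e * (p - 2)" "\<bar>e\<bar> = 1"
  proof -
    have "e * (- ln \<alpha>) \<le> e * E t" using mono[of "p - 1" t] that p E0 by auto
    then have "e * t powr (p-1) \<le> e * (exp (ln \<alpha> + E t) * t powr (p - 1))"
      using that(3) t by (cases "e = 1") (auto simp: abs_if split: if_splits)
    then show ?thesis using ex[of t] t that p by auto
  qed
  show "e * (\<alpha> * (1 + t) powr (p - 2) * (t - (p - 2))) \<le> e * t powr (p - 1)"
    if "t \<le> p - 1" "\<bar>p - 2\<bar> = e * (p - 2)" "\<bar>e\<bar> = 1"
  proof (cases "t > p - 2")
    case True
    have "e * (- ln \<alpha>) \<ge> e * E t" using mono[of t "p - 1"] that p E0 True t by auto
    then have "e * t powr (p-1) \<ge> e * (exp (ln \<alpha> + E t) * t powr (p - 1))"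
      using that(3) t by (cases "e = 1") (auto simp: abs_if split: if_splits)
    then show ?thesis using ex[of t] t True by auto
  next
    case False
    then have "e = 1" using that(2,3) t by (auto simp: abs_if split: if_splits)
    moreover have "\<alpha> * (1 + t) powr (p - 2) * (t - (p - 2)) \<le> 0"
      using False \<alpha> by (intro mult_nonneg_nonpos) auto
    ultimately show ?thesis by (auto intro: order_trans)
  qed
qed

text \<open>The difference \<open>D\<close> vanishes at \<open>p - 1\<close>. By the comparison of
  slopes it does not increase before this point and does not decrease after it.\<close>

lemma burkholder_majorant_1:
  fixes p t :: real
  assumes p: "1 < p" and e: "\<bar>p - 2\<bar> = e * (p - 2)" "\<bar>e\<bar> = 1" and t: "t \<ge> 0"
  defines "\<alpha> \<equiv> p powr (2 - p) * (p - 1) powr (p - 1)"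
  shows "e * (t powr p - (p - 1) powr p) \<le> e * (\<alpha> * burkholder p 1 t)"
proof -
  define D where "D = (\<lambda>t. e * (\<alpha> * burkholder p 1 t - (t powr p - (p - 1) powr p)))"
  define D' where "D' = (\<lambda>t. p * (e * (\<alpha> * (1 + t) powr (p - 2) * (t - (p - 2))) - e * t powr (p - 1)))"
  have e': "e * (p - 2) \<ge> 0" using e(1) by simp
  have dD: "(D has_real_derivative D' u) (at u)" if "u > 0" for u
  proof -
    have "(1 + u) powr (p - 1) = (1 + u) * (1 + u) powr (p - 2)"
      using that by (simp add: powr_diff powr_numeral power2_eq_square)
    moreover have "p - 1 - 1 = p - 2" by simp
    ultimately show ?thesis
      unfolding D_def D'_def burkholder_def using that
      by (auto intro!: derivative_eq_intros simp: algebra_simps)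
  qed
  have cD: "continuous_on {0..} D"
    unfolding D_def using p by (intro continuous_intros continuous_burkholder continuous_on_powr') auto
  have D0: "D (p - 1) = 0"
  proof -
    have "(p - 1) powr p = (p - 1) * (p - 1) powr (p - 1)" using p by (simp add: powr_diff)
    moreover have "burkholder p 1 (p - 1) = 0" using p by (simp add: burkholder_def powr_diff)
    ultimately show ?thesis using p by (simp add: D_def \<alpha>_def)
  qed
  have "D t \<ge> 0"
  proof (cases "t \<ge> p - 1")
    case True
    have "D (p - 1) \<le> D t"
    proof (rule DERIV_nonneg_imp_nondecreasing[OF True])
      fix x assume x: "p - 1 \<le> x" "x \<le> t"
      then have "x > 0" using p by auto
      moreover have "D' x \<ge> 0"
        using burkholder_majorant_slope(1)[OF p e' \<open>x > 0\<close> x(1) e] p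
        by (simp add: D'_def \<alpha>_def)
      ultimately show "\<exists>y. (D has_real_derivative y) (at x) \<and> y \<ge> 0"
        using dD by blast
    qed
    then show ?thesis using D0 by simp
  next
    case False
    have "D (p - 1) \<le> D t"
    proof (rule DERIV_nonpos_imp_decreasing_open[of t "p - 1" D])
      fix x assume x: "t < x" "x < p - 1"
      then have "x > 0" using t by auto
      moreover have "D' x \<le> 0"
        using burkholder_majorant_slope(2)[OF p e' \<open>x > 0\<close> _ e] x p
        by (auto simp: D'_def \<alpha>_def mult_le_0_iff)
      ultimately show "\<exists>y. (D has_real_derivative y) (at x) \<and> y \<le> 0"
        using dD by blast
    qed (use False t in \<open>auto intro: continuous_on_subset[OF cD]\<close>)
    then show ?thesis using D0 by simp
  qed
  then show ?thesis by (simp add: D_def algebra_simps)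
qed

text \<open>Both sides are homogeneous of degree \<open>p\<close>, which reduces
  \<open>r > 0\<close> to \<open>r = 1\<close>; the boundary \<open>r = 0\<close> follows by
  continuity along \<open>1 / (n + 1)\<close>.\<close>

lemma burkholder_majorant:
  fixes p r s :: real
  assumes p: "1 < p" and e: "\<bar>p - 2\<bar> = e * (p - 2)" "\<bar>e\<bar> = 1" and r: "r \<ge> 0" and s: "s \<ge> 0"
  defines "\<alpha> \<equiv> p powr (2 - p) * (p - 1) powr (p - 1)"
  shows "e * (s powr p - (p - 1) powr p * r powr p) \<le> e * (\<alpha> * burkholder p r s)"
proof -
  have pos: "e * (s powr p - (p - 1) powr p * r powr p) \<le> e * (\<alpha> * burkholder p r s)" if r: "r > 0" for r
  proof -
    define t where "t = s / r"
    have t: "t \<ge> 0" "s = r * t" using r s by (auto simp: t_def)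
    have *: "r + r * t = r * (1 + t)" by (simp add: algebra_simps)
    have h: "burkholder p r s = r powr p * burkholder p 1 t"
    proof -
      have "r powr p = r * r powr (p - 1)" using r by (simp add: powr_diff)
      moreover have "(r * (1 + t)) powr a = r powr a * (1 + t) powr a" for a
        using r t(1) by (simp add: powr_mult)
      ultimately show ?thesis unfolding burkholder_def t(2) * by (simp add: right_diff_distrib)
    qed
    have "e * (t powr p - (p - 1) powr p) * r powr p \<le> e * (\<alpha> * burkholder p 1 t) * r powr p"
      using burkholder_majorant_1[OF p e t(1)] unfolding \<alpha>_def by (intro mult_right_mono) auto
    then show ?thesis using h r t by (simp add: powr_mult algebra_simps)
  qed
  show ?thesis
  proof (cases "r > 0")
    case False
    then have r0: "r = 0" using r by simp
    have lim: "(\<lambda>n. 1 / real (Suc n)) \<longlonglongrightarrow> 0"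
      using LIMSEQ_inverse_real_of_nat by (simp add: inverse_eq_divide)
    have cb: "continuous_on {0..} (\<lambda>r. e * (\<alpha> * burkholder p r s) - e * (s powr p - (p - 1) powr p * r powr p))"
      using p s by (intro continuous_intros continuous_burkholder continuous_on_powr') auto
    have "(\<lambda>n. e * (\<alpha> * burkholder p (1 / real (Suc n)) s) - e * (s powr p - (p - 1) powr p * (1 / real (Suc n)) powr p))
       \<longlonglongrightarrow> e * (\<alpha> * burkholder p 0 s) - e * (s powr p - (p - 1) powr p * 0 powr p)"
      by (rule continuous_on_tendsto_compose[OF cb lim]) auto
    then have "0 \<le> e * (\<alpha> * burkholder p 0 s) - e * (s powr p - (p - 1) powr p * 0 powr p)"
      by (rule LIMSEQ_le_const) (use pos in \<open>auto intro!: exI[of _ 0]\<close>)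
    then show ?thesis by (simp add: r0)
  qed (rule pos)
qed

lemma conjugate_exponent_constant:
  fixes p q :: real
  assumes p: "1 < p" and q: "1 / p + 1 / q = 1"
  shows "max p q - 1 = (if p \<ge> 2 then p - 1 else 1 / (p - 1))"
proof -
  have "q \<noteq> 0" using p q by (auto)
  then have "q + p = p * q" using p q by (simp add: field_simps)
  then have "q = p / (p - 1)" using p by (simp add: field_simps)
  moreover have "p / (p - 1) - 1 = 1 / (p - 1)" using p by (simp add: field_simps)
  moreover have "p \<ge> 2 \<longleftrightarrow> p - 1 \<ge> 1 / (p - 1)"
  proof -
    have "p - 1 \<ge> 1 / (p - 1) \<longleftrightarrow> (p - 1) * (p - 1) \<ge> 1 * 1" using p by (simp add: field_simps)
    also have "\<dots> \<longleftrightarrow> p - 1 \<ge> 1"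
      using p by (metis abs_of_pos diff_gt_0_iff_gt abs_1 abs_le_square_iff power2_eq_square)
    finally show ?thesis by auto
  qed
  ultimately show ?thesis by (auto simp: max_def)
qed

text \<open>For \<open>p \<ge> 2\<close> the function is taken as it stands. For
  \<open>p < 2\<close> it is convex in the relevant directions, so its negative is used, with the
  arguments exchanged because the constant is now \<open>1 / (p - 1)\<close>.\<close>

proposition burkholder_function_exists:
  fixes p q :: real
  assumes p: "1 < p" and q: "1 / p + 1 / q = 1"
  obtains U :: "complex \<Rightarrow> complex \<Rightarrow> real" where
    "U 0 0 = 0"
    "\<And>x y h k. cmod h = cmod k \<Longrightarrow> U (x + h) (y + k) + U (x - h) (y - k) \<le> 2 * U x y"
    "\<And>x y. cmod y powr p - (max p q - 1) powr p * cmod x powr p \<le> U x y"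
proof -
  define \<alpha> where "\<alpha> = p powr (2 - p) * (p - 1) powr (p - 1)"
  have \<alpha>: "\<alpha> > 0" using p by (simp add: \<alpha>_def)
  note C = conjugate_exponent_constant[OF p q]
  show ?thesis
  proof (cases "p \<ge> 2")
    case True
    show ?thesis
    proof (rule that[of "\<lambda>x y. \<alpha> * burkholder p (cmod x) (cmod y)"])
      fix x y h k :: complex
      assume "cmod h = cmod k"
      from burkholder_zigzag[OF p _ this, of 1 x y] True
      have "burkholder p (cmod (x + h)) (cmod (y + k)) + burkholder p (cmod (x - h)) (cmod (y - k))
          \<le> 2 * burkholder p (cmod x) (cmod y)" by simp
      from mult_left_mono[OF this, of \<alpha>] \<alpha>
      show "\<alpha> * burkholder p (cmod (x + h)) (cmod (y + k)) + \<alpha> * burkholder p (cmod (x - h)) (cmod (y - k))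
          \<le> 2 * (\<alpha> * burkholder p (cmod x) (cmod y))" by (simp add: algebra_simps)
    next
      fix x y :: complex
      show "cmod y powr p - (max p q - 1) powr p * cmod x powr p \<le> \<alpha> * burkholder p (cmod x) (cmod y)"
        using burkholder_majorant[OF p, of 1 "cmod x" "cmod y"] True C by (simp add: \<alpha>_def)
    qed (use p in \<open>auto simp: burkholder_def\<close>)
  next
    case False
    \<comment> \<open>Dividing the exchanged inequality by \<open>(p - 1) powr p\<close> gives
      \<open>|y|^p\<close> the coefficient 1 and \<open>|x|^p\<close> the coefficient
      \<open>- (1 / (p - 1)) powr p\<close>.\<close>
    define \<beta> where "\<beta> = \<alpha> * (1 / (p - 1)) powr p"
    have \<beta>: "\<beta> > 0" using \<alpha> p by (simp add: \<beta>_def)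
    show ?thesis
    proof (rule that[of "\<lambda>x y. - \<beta> * burkholder p (cmod y) (cmod x)"])
      fix x y h k :: complex
      assume "cmod h = cmod k"
      from burkholder_zigzag[OF p _ this[symmetric], of "-1" y x] False
      have "- burkholder p (cmod (y + k)) (cmod (x + h)) - burkholder p (cmod (y - k)) (cmod (x - h))
          \<le> - (2 * burkholder p (cmod y) (cmod x))" by simp
      from mult_left_mono[OF this, of \<beta>] \<beta>
      show "- \<beta> * burkholder p (cmod (y + k)) (cmod (x + h)) + - \<beta> * burkholder p (cmod (y - k)) (cmod (x - h))
          \<le> 2 * (- \<beta> * burkholder p (cmod y) (cmod x))" by (simp add: algebra_simps)
    next
      fix x y :: complex
      have "- (cmod x powr p - (p - 1) powr p * cmod y powr p) \<le> - (\<alpha> * burkholder p (cmod y) (cmod x))"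
        using burkholder_majorant[OF p, of "-1" "cmod y" "cmod x"] False by (simp add: \<alpha>_def)
      from mult_left_mono[OF this, of "(1 / (p - 1)) powr p"]
      have "(1 / (p - 1)) powr p * ((p - 1) powr p * cmod y powr p) - (1 / (p - 1)) powr p * cmod x powr p
        \<le> - \<beta> * burkholder p (cmod y) (cmod x)"
        by (simp add: \<beta>_def algebra_simps)
      moreover have "(1 / (p - 1)) powr p * ((p - 1) powr p * cmod y powr p) = cmod y powr p"
        using p by (simp add: powr_divide)
      ultimately show "cmod y powr p - (max p q - 1) powr p * cmod x powr p \<le> - \<beta> * burkholder p (cmod y) (cmod x)"
        using False C by simp
    qed (use p in \<open>auto simp: burkholder_def\<close>)
  qed
qed


section \<open>The spaces \<open>L\<^sup>p\<close>\<close>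

lemma Lp_space_measurable: "f \<in> Lp_space p \<Longrightarrow> f \<in> borel_measurable borel"
  by (simp add: Lp_space_def)

lemma Lp_space_integrable: "f \<in> Lp_space p \<Longrightarrow> integrable lborel (\<lambda>x. norm (f x) powr p)"
  by (simp add: Lp_space_def)

lemma Lp_norm_nonneg: "Lp_norm p f \<ge> 0"
  by (simp add: Lp_norm_def)

lemma Lp_norm_powr:
  assumes "p > 0"
  shows "Lp_norm p f powr p = (\<integral>x. norm (f x) powr p \<partial>lborel)"
proof -
  have "(\<integral>x. norm (f x) powr p \<partial>lborel) \<ge> 0" by (rule integral_nonneg_AE) auto
  then show ?thesis using assms by (simp add: Lp_norm_def powr_powr)
qed

lemma Lp_norm_le_iff:
  assumes "p > 0" "c \<ge> 0"
  shows "Lp_norm p f \<le> c \<longleftrightarrow> (\<integral>x. norm (f x) powr p \<partial>lborel) \<le> c powr p"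
  unfolding Lp_norm_powr[OF assms(1), symmetric]
  using assms Lp_norm_nonneg[of p f] powr_mono2[of p] powr_less_mono2[of p]
  by (meson leD leI less_imp_le)

lemma Lp_norm_cong_AE:
  assumes "AE x in lborel. f x = g x" "f \<in> borel_measurable borel" "g \<in> borel_measurable borel"
  shows "Lp_norm p f = Lp_norm p g"
proof -
  have "(\<integral>x. norm (f x) powr p \<partial>lborel) = (\<integral>x. norm (g x) powr p \<partial>lborel)"
    by (rule integral_cong_AE) (use assms in auto)
  then show ?thesis by (simp add: Lp_norm_def)
qed

lemma Lp_space_cong_AE:
  assumes "AE x in lborel. f x = g x" "f \<in> Lp_space p" "g \<in> borel_measurable borel"
  shows "g \<in> Lp_space p"
proof -
  have [measurable]: "f \<in> borel_measurable borel" "g \<in> borel_measurable borel"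
    using assms by (auto dest: Lp_space_measurable)
  have "integrable lborel (\<lambda>x. norm (f x) powr p) \<longleftrightarrow> integrable lborel (\<lambda>x. norm (g x) powr p)"
    by (rule integrable_cong_AE) (use assms(1) in auto)
  then show ?thesis using assms by (simp add: Lp_space_def)
qed

lemma nn_integral_Lp:
  assumes "f \<in> Lp_space p" "p > 0"
  shows "(\<integral>\<^sup>+x. ennreal (norm (f x) powr p) \<partial>lborel) = ennreal (Lp_norm p f powr p)"
  using nn_integral_eq_integral[OF Lp_space_integrable[OF assms(1)]] assms by (simp add: Lp_norm_powr)

lemma Lp_nn_integral_bound:
  assumes p: "p > 0" and f: "f \<in> borel_measurable borel"
    and c: "c \<ge> 0" "(\<integral>\<^sup>+x. ennreal (norm (f x) powr p) \<partial>lborel) \<le> ennreal (c powr p)"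
  shows "f \<in> Lp_space p" "Lp_norm p f \<le> c"
proof -
  have [measurable]: "f \<in> borel_measurable borel" by fact
  have "integrable lborel (\<lambda>x. norm (f x) powr p)"
    by (rule integrableI_bounded) (use le_less_trans[OF c(2)] in \<open>auto\<close>)
  then show L: "f \<in> Lp_space p" using f by (simp add: Lp_space_def)
  show "Lp_norm p f \<le> c"
    using c nn_integral_Lp[OF L p] p unfolding Lp_norm_le_iff[OF p c(1)] by (simp add: Lp_norm_powr)
qed

lemma Lp_space_dominated:
  assumes "g \<in> Lp_space p" "p > 0" "f \<in> borel_measurable borel" "\<And>x. norm (f x) \<le> c * norm (g x)" "c \<ge> 0"
  shows "f \<in> Lp_space p"
proof -
  have [measurable]: "f \<in> borel_measurable borel" by fact
  have "integrable lborel (\<lambda>x. norm (f x) powr p)"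
  proof (rule Bochner_Integration.integrable_bound)
    show "integrable lborel (\<lambda>x. c powr p * norm (g x) powr p)"
      using Lp_space_integrable[OF assms(1)] by simp
    show "AE x in lborel. norm (norm (f x) powr p) \<le> norm (c powr p * norm (g x) powr p)"
      using assms by (auto simp flip: powr_mult intro!: powr_mono2)
  qed measurable
  then show ?thesis using assms by (simp add: Lp_space_def)
qed

lemma Lp_space_add:
  assumes "p > 0" "f \<in> Lp_space p" "g \<in> Lp_space p"
  shows "(\<lambda>x. f x + g x) \<in> Lp_space p"
proof -
  have [measurable]: "f \<in> borel_measurable borel" "g \<in> borel_measurable borel"
    using assms by (auto dest: Lp_space_measurable)
  have "integrable lborel (\<lambda>x. norm (f x + g x) powr p)"
  proof (rule Bochner_Integration.integrable_bound)
    show "integrable lborel (\<lambda>x. 2 powr p * (norm (f x) powr p + norm (g x) powr p))"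
      using assms by (intro integrable_mult_right Bochner_Integration.integrable_add Lp_space_integrable)
    have *: "norm (f x + g x) powr p \<le> 2 powr p * (norm (f x) powr p + norm (g x) powr p)" for x
    proof -
      have "norm (f x + g x) \<le> 2 * max (norm (f x)) (norm (g x))"
        using norm_triangle_ineq[of "f x" "g x"] by auto
      then have "norm (f x + g x) powr p \<le> (2 * max (norm (f x)) (norm (g x))) powr p"
        using assms by (intro powr_mono2) auto
      also have "\<dots> \<le> 2 powr p * (norm (f x) powr p + norm (g x) powr p)"
        by (auto simp: powr_mult max_def)
      finally show ?thesis .
    qed
    then show "AE x in lborel. norm (norm (f x + g x) powr p)
        \<le> norm (2 powr p * (norm (f x) powr p + norm (g x) powr p))"
      by auto
  qed measurable
  then show ?thesis by (simp add: Lp_space_def)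
qed

lemma Lp_space_cmult:
  assumes "p > 0" "f \<in> Lp_space p"
  shows "(\<lambda>x. c * f x) \<in> Lp_space p"
proof (rule Lp_space_dominated[OF assms(2,1)])
  show "(\<lambda>x. c * f x) \<in> borel_measurable borel"
    by (intro borel_measurable_times borel_measurable_const Lp_space_measurable[OF assms(2)])
  show "norm (c * f x) \<le> norm c * norm (f x)" for x by (rule norm_mult_ineq)
qed (rule norm_ge_zero)

lemma Lp_space_diff:
  assumes "p > 0" "f \<in> Lp_space p" "g \<in> Lp_space p"
  shows "(\<lambda>x. f x - g x) \<in> Lp_space p"
  using Lp_space_add[OF assms(1,2) Lp_space_cmult[OF assms(1,3), of "-1"]] by simp

lemma Lp_space_0: "(\<lambda>x. 0) \<in> Lp_space p"
  by (simp add: Lp_space_def)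

lemma Lp_space_sum:
  assumes "p > 0" "\<And>i. i \<in> I \<Longrightarrow> f i \<in> Lp_space p"
  shows "(\<lambda>x. \<Sum>i\<in>I. f i x) \<in> Lp_space p"
  using assms(2) by (induction I rule: infinite_finite_induct) (auto intro: Lp_space_0 Lp_space_add[OF assms(1)])

lemma Lp_norm_cmult:
  assumes "p > 0"
  shows "Lp_norm p (\<lambda>x. c * f x :: complex) = cmod c * Lp_norm p f"
  using assms by (simp add: Lp_norm_def norm_mult powr_mult powr_powr)

lemma Lp_norm_minus_commute: "Lp_norm p (\<lambda>x. f x - g x) = Lp_norm p (\<lambda>x. g x - f x)"
  by (simp add: Lp_norm_def norm_minus_commute)

lemma Lp_norm_0 [simp]: "Lp_norm p (\<lambda>x. 0) = 0"
  by (simp add: Lp_norm_def)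

lemma Lp_norm_eq_0_iff:
  assumes "p > 0" "f \<in> Lp_space p"
  shows "Lp_norm p f = 0 \<longleftrightarrow> (AE x in lborel. f x = 0)"
proof -
  have "Lp_norm p f = 0 \<longleftrightarrow> (\<integral>x. norm (f x) powr p \<partial>lborel) = 0"
    using assms by (auto simp: Lp_norm_def)
  also have "\<dots> \<longleftrightarrow> (AE x in lborel. norm (f x) powr p = 0)"
    by (rule integral_nonneg_eq_0_iff_AE) (use assms Lp_space_integrable in auto)
  finally show ?thesis by simp
qed

section \<open>Minkowski's inequality\<close>

text \<open>Convexity of the power at \<open>u / a\<close> and \<open>v / b\<close> with weights
  \<open>a / (a + b)\<close> and \<open>b / (a + b)\<close>. Integrated with \<open>a\<close> and
  \<open>b\<close> equal to the norms of two functions, the right side becomes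
  \<open>(a + b) powr p\<close>, which is Minkowski's inequality.\<close>

lemma powr_add_le_weighted:
  fixes p a b u v :: real
  assumes p: "p \<ge> 1" and ab: "a > 0" "b > 0" and uv: "u \<ge> 0" "v \<ge> 0"
  shows "(u + v) powr p \<le> (a + b) powr (p - 1) * (a powr (1 - p) * u powr p + b powr (1 - p) * v powr p)"
proof -
  have triv: "v powr p \<le> (a + b) powr (p - 1) * (b powr (1 - p) * v powr p)" if "a > 0" "b > 0" for a b v :: real
  proof -
    have "b powr (p - 1) * b powr (1 - p) = 1" using that by (simp flip: powr_add)
    moreover have "b powr (p - 1) \<le> (a + b) powr (p - 1)" using p that by (intro powr_mono2) auto
    ultimately have "1 \<le> (a + b) powr (p - 1) * b powr (1 - p)"
      by (metis mult_right_mono powr_ge_zero)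
    from mult_right_mono[OF this, of "v powr p"] show ?thesis by (simp add: mult.assoc)
  qed
  consider "u = 0" | "v = 0" | "u > 0" "v > 0" using uv by linarith
  then show ?thesis
  proof cases
    case 1 then show ?thesis using triv[OF ab] p by simp
  next
    case 2 then show ?thesis using triv[OF ab(2,1), of u] p by (simp add: add.commute)
  next
    case 3
    define t where "t = b / (a + b)"
    have t: "t \<ge> 0" "t \<le> 1" "1 - t = a / (a + b)" using ab by (auto simp: t_def field_simps)
    have "((1 - t) *\<^sub>R (u / a) + t *\<^sub>R (v / b)) powr p \<le> (1 - t) * (u / a) powr p + t * (v / b) powr p"
      by (rule convex_onD[OF powr_convex[OF p]]) (use t 3 ab in auto)
    moreover have "(1 - t) *\<^sub>R (u / a) + t *\<^sub>R (v / b) = (u + v) / (a + b)"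
      unfolding t(3) unfolding t_def using ab by (simp add: add_divide_distrib)
    ultimately have "(u + v) powr p / (a + b) powr p \<le> a / (a + b) * (u / a) powr p + b / (a + b) * (v / b) powr p"
      unfolding t(3) unfolding t_def using ab 3 powr_divide[of "u + v" "a + b" p] by simp
    also have "a / (a + b) * (u / a) powr p = a powr (1 - p) * u powr p / (a + b)"
      using ab 3 by (simp add: powr_divide powr_diff)
    also have "b / (a + b) * (v / b) powr p = b powr (1 - p) * v powr p / (a + b)"
      using ab 3 by (simp add: powr_divide powr_diff)
    finally have "(u + v) powr p / (a + b) powr p \<le> (a powr (1 - p) * u powr p + b powr (1 - p) * v powr p) / (a + b)"
      by (simp add: add_divide_distrib)
    then have "(u + v) powr p \<le> (a powr (1 - p) * u powr p + b powr (1 - p) * v powr p) / (a + b) * (a + b) powr p"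
      using ab by (subst (asm) pos_divide_le_eq) auto
    then show ?thesis
      using ab by (simp add: powr_diff mult.commute)
  qed
qed

lemma Lp_norm_triangle:
  assumes p: "p \<ge> 1" and f: "f \<in> Lp_space p" and g: "g \<in> Lp_space p"
  shows "Lp_norm p (\<lambda>x. f x + g x) \<le> Lp_norm p f + Lp_norm p g"
proof -
  have [measurable]: "f \<in> borel_measurable borel" "g \<in> borel_measurable borel"
    using f g by (auto dest: Lp_space_measurable)
  have p0: "p > 0" using p by simp
  define a b where "a = Lp_norm p f" and "b = Lp_norm p g"
  have nn: "a \<ge> 0" "b \<ge> 0" by (auto simp: a_def b_def Lp_norm_nonneg)
  consider "a = 0" | "b = 0" | "a > 0" "b > 0" using nn by linarith
  then show ?thesis
  proof cases
    case 1
    then have "AE x in lborel. f x = 0" using Lp_norm_eq_0_iff[OF p0 f] by (simp add: a_def)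
    then have "Lp_norm p (\<lambda>x. f x + g x) = Lp_norm p g" by (intro Lp_norm_cong_AE) auto
    then show ?thesis using nn by (simp add: a_def)
  next
    case 2
    then have "AE x in lborel. g x = 0" using Lp_norm_eq_0_iff[OF p0 g] by (simp add: b_def)
    then have "Lp_norm p (\<lambda>x. f x + g x) = Lp_norm p f" by (intro Lp_norm_cong_AE) auto
    then show ?thesis using nn by (simp add: b_def)
  next
    case 3
    have "(\<integral>x. norm (f x + g x) powr p \<partial>lborel) \<le>
       (\<integral>x. (a + b) powr (p - 1) * (a powr (1 - p) * norm (f x) powr p + b powr (1 - p) * norm (g x) powr p) \<partial>lborel)"
    proof (rule integral_mono)
      show "integrable lborel (\<lambda>x. norm (f x + g x) powr p)"
        by (rule Lp_space_integrable[OF Lp_space_add[OF p0 f g]])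
      show "integrable lborel (\<lambda>x. (a + b) powr (p - 1) * (a powr (1 - p) * norm (f x) powr p + b powr (1 - p) * norm (g x) powr p))"
        by (intro integrable_mult_right Bochner_Integration.integrable_add Lp_space_integrable[OF f] Lp_space_integrable[OF g])
      fix x
      have "norm (f x + g x) powr p \<le> (norm (f x) + norm (g x)) powr p"
        using p0 by (intro powr_mono2 norm_triangle_ineq) auto
      also have "\<dots> \<le> (a + b) powr (p - 1) * (a powr (1 - p) * norm (f x) powr p + b powr (1 - p) * norm (g x) powr p)"
        by (rule powr_add_le_weighted[OF p 3]) auto
      finally show "norm (f x + g x) powr p \<le> (a + b) powr (p - 1) * (a powr (1 - p) * norm (f x) powr p + b powr (1 - p) * norm (g x) powr p)" .
    qed
    also have "\<dots> = (a + b) powr (p - 1) * (a powr (1 - p) * a powr p + b powr (1 - p) * b powr p)"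
      using Lp_space_integrable[OF f] Lp_space_integrable[OF g]
      by (simp add: a_def b_def Lp_norm_powr[OF p0])
    also have "\<dots> = (a + b) powr p"
      using 3 by (simp add: powr_diff)
    finally show ?thesis
      using nn by (simp add: Lp_norm_le_iff[OF p0] a_def b_def)
  qed
qed

lemma Lp_norm_triangle_diff:
  assumes "p \<ge> 1" "f \<in> Lp_space p" "g \<in> Lp_space p" "h \<in> Lp_space p"
  shows "Lp_norm p (\<lambda>x. f x - h x) \<le> Lp_norm p (\<lambda>x. f x - g x) + Lp_norm p (\<lambda>x. g x - h x)"
  using Lp_norm_triangle[OF assms(1) Lp_space_diff[OF _ assms(2,3)] Lp_space_diff[OF _ assms(3,4)]] assms(1)
  by simp

lemma Lp_norm_le_add_diff:
  assumes "p \<ge> 1" "f \<in> Lp_space p" "g \<in> Lp_space p"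
  shows "Lp_norm p f \<le> Lp_norm p g + Lp_norm p (\<lambda>x. f x - g x)"
  using Lp_norm_triangle[OF assms(1,3) Lp_space_diff[OF _ assms(2,3)]] assms(1) by simp

section \<open>Almost everywhere limits and completeness\<close>

lemma Lp_AE_convergent_subseq:
  assumes p: "p > 0" and f: "\<And>n. f n \<in> Lp_space p" and g: "g \<in> Lp_space p"
    and lim: "(\<lambda>n. Lp_norm p (\<lambda>x. f n x - g x)) \<longlonglongrightarrow> 0"
  obtains r :: "nat \<Rightarrow> nat" where "strict_mono r" "AE x in lborel. (\<lambda>n. f (r n) x) \<longlonglongrightarrow> g x"
proof -
  have "(\<lambda>n. Lp_norm p (\<lambda>x. f n x - g x) powr p) \<longlonglongrightarrow> 0 powr p"
    using p by (intro tendsto_powr' lim tendsto_const) (auto simp: Lp_norm_nonneg)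
  then have "(\<lambda>n. \<integral>x. norm (norm (f n x - g x) powr p) \<partial>lborel) \<longlonglongrightarrow> 0"
    using p by (simp add: Lp_norm_powr)
  from tendsto_L1_AE_subseq[OF _ this] obtain r where r: "strict_mono r"
    "AE x in lborel. (\<lambda>n. norm (f (r n) x - g x) powr p) \<longlonglongrightarrow> 0"
    using Lp_space_integrable[OF Lp_space_diff[OF p f g]] by blast
  from r(2) have "AE x in lborel. (\<lambda>n. f (r n) x) \<longlonglongrightarrow> g x"
  proof eventually_elim
    case (elim x)
    then have "(\<lambda>n. (norm (f (r n) x - g x) powr p) powr (1 / p)) \<longlonglongrightarrow> 0 powr (1 / p)"
      using p by (intro tendsto_powr' tendsto_const) auto
    then have "(\<lambda>n. norm (f (r n) x - g x)) \<longlonglongrightarrow> 0" using p by (simp add: powr_powr)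
    then show ?case using LIM_zero_iff tendsto_norm_zero_iff by blast
  qed
  with r(1) show ?thesis by (rule that)
qed

text \<open>Subsequences that converge almost everywhere link limits for different exponents. This
  is what identifies the L^p value of a transform with its L^2 value.\<close>

lemma Lp_limit_unique:
  assumes p: "p > 0" "p' > 0"
    and f: "\<And>n. f n \<in> Lp_space p" "g \<in> Lp_space p" "(\<lambda>n. Lp_norm p (\<lambda>x. f n x - g x)) \<longlonglongrightarrow> 0"
    and f': "\<And>n. f n \<in> Lp_space p'" "g' \<in> Lp_space p'" "(\<lambda>n. Lp_norm p' (\<lambda>x. f n x - g' x)) \<longlonglongrightarrow> 0"
  shows "AE x in lborel. g x = g' x"
proof -
  obtain r where r: "strict_mono r" "AE x in lborel. (\<lambda>n. f (r n) x) \<longlonglongrightarrow> g x"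
    using Lp_AE_convergent_subseq[OF p(1) f] by blast
  have "(\<lambda>n. Lp_norm p' (\<lambda>x. f (r n) x - g' x)) \<longlonglongrightarrow> 0"
    using LIMSEQ_subseq_LIMSEQ[OF f'(3) r(1)] by (simp add: o_def)
  then obtain r' where r': "strict_mono r'" "AE x in lborel. (\<lambda>n. f (r (r' n)) x) \<longlonglongrightarrow> g' x"
    using Lp_AE_convergent_subseq[of p' "\<lambda>n. f (r n)" g'] p f' by blast
  from r(2) r'(2) show ?thesis
  proof eventually_elim
    case (elim x)
    show ?case
      by (rule LIMSEQ_unique[OF LIMSEQ_subseq_LIMSEQ[OF elim(1) r'(1), unfolded o_def] elim(2)])
  qed
qed

lemma Lp_complete:
  fixes f :: "nat \<Rightarrow> 'a::euclidean_space \<Rightarrow> complex"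
  assumes p: "p \<ge> 1" and f: "\<And>n. f n \<in> Lp_space p"
    and cauchy: "\<And>e. e > 0 \<Longrightarrow> \<exists>N. \<forall>m\<ge>N. \<forall>n\<ge>N. Lp_norm p (\<lambda>x. f m x - f n x) < e"
  obtains g where "g \<in> Lp_space p" "(\<lambda>n. Lp_norm p (\<lambda>x. f n x - g x)) \<longlonglongrightarrow> 0"
proof -
  have p0: "p > 0" using p by simp
  have [measurable]: "f n \<in> borel_measurable borel" for n using f by (rule Lp_space_measurable)
  \<comment> \<open>The rate \<open>(1/4)^k\<close> leaves room for the factor \<open>2^k\<close> by
    which the increments are enlarged in \<open>B\<close>.\<close>
  have "\<forall>k. \<exists>N. \<forall>m\<ge>N. \<forall>n\<ge>N. Lp_norm p (\<lambda>x. f m x - f n x) < (1/4)^k"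
    by (intro allI cauchy) auto
  then obtain N where N: "\<And>k m n. m \<ge> N k \<Longrightarrow> n \<ge> N k \<Longrightarrow> Lp_norm p (\<lambda>x. f m x - f n x) < (1/4)^k"
    by metis
  \<comment> \<open>Summing the thresholds makes \<open>r\<close> monotone while keeping
    \<open>r k \<ge> N k\<close>.\<close>
  define r where "r k = (\<Sum>i\<le>k. N i)" for k :: nat
  have rN: "r k \<ge> N k" for k unfolding r_def by (rule member_le_sum) auto
  have rmono: "r k \<le> r (Suc k)" for k by (simp add: r_def)
  have step: "Lp_norm p (\<lambda>x. f (r (Suc k)) x - f (r k) x) < (1/4)^k" for k
    using N[of k "r (Suc k)" "r k"] rN[of k] rmono[of k] by linarith
  \<comment> \<open>\<open>B k x < 1\<close> means that the increment is smaller than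
    \<open>2^-k\<close>. The integrals of \<open>B k\<close> are summable, so almost everywhere this
    holds for all large \<open>k\<close>.\<close>
  define B where "B k x = 2 powr (k * p) * norm (f (r (Suc k)) x - f (r k) x) powr p" for k :: nat and x
  have [measurable]: "B k \<in> borel_measurable borel" for k unfolding B_def by measurable
  have intB: "(\<integral>\<^sup>+x. ennreal (B k x) \<partial>lborel) \<le> ennreal ((1/2)^k)" for k
  proof -
    let ?d = "\<lambda>x. f (r (Suc k)) x - f (r k) x"
    have "(\<integral>\<^sup>+x. ennreal (B k x) \<partial>lborel) = ennreal (2 powr (k * p)) * (\<integral>\<^sup>+x. ennreal (norm (?d x) powr p) \<partial>lborel)"
      unfolding B_def by (subst nn_integral_cmult[symmetric]) (auto simp: ennreal_mult)
    also have "\<dots> = ennreal (2 powr (k * p) * Lp_norm p ?d powr p)"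
      by (subst nn_integral_Lp[OF Lp_space_diff[OF p0 f f] p0]) (simp add: ennreal_mult)
    also have "\<dots> \<le> ennreal ((1/2)^k)"
    proof (rule ennreal_leI)
      have "2 powr (k * p) * Lp_norm p ?d powr p \<le> 2 powr (k * p) * ((1/4)^k) powr p"
        using step[of k] p by (intro mult_left_mono powr_mono2) (auto simp: Lp_norm_nonneg)
      also have "\<dots> = (2^k * (1/4)^k) powr p"
        by (simp add: powr_mult powr_powr[symmetric] powr_realpow)
      also have "\<dots> = ((1/2)^k) powr p" by (simp flip: power_mult_distrib)
      also have "\<dots> \<le> ((1/2)^k) powr 1"
        by (rule powr_mono') (use p in \<open>auto simp: power_le_one\<close>)
      finally show "2 powr (k * p) * Lp_norm p ?d powr p \<le> (1/2)^k" by simp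
    qed
    finally show ?thesis .
  qed
  have "(\<integral>\<^sup>+x. (\<Sum>k. ennreal (B k x)) \<partial>lborel) = (\<Sum>k. \<integral>\<^sup>+x. ennreal (B k x) \<partial>lborel)"
    by (rule nn_integral_suminf) auto
  also have "\<dots> \<le> (\<Sum>k. ennreal ((1/2)^k))" by (intro suminf_le intB) auto
  also have "\<dots> < \<infinity>"
  proof -
    have "summable (\<lambda>k. (1/2::real)^k)" by (rule summable_geometric) auto
    then show ?thesis by (simp add: suminf_ennreal2)
  qed
  finally have "AE x in lborel. (\<Sum>k. ennreal (B k x)) \<noteq> \<infinity>"
    by (intro nn_integral_PInf_AE) auto
  then have conv: "AE x in lborel. convergent (\<lambda>k. f (r k) x)"
  proof eventually_elim
    case (elim x)
    have "summable (\<lambda>k. B k x)" by (rule summable_suminf_not_top) (use elim in \<open>auto simp: B_def\<close>)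
    then have "(\<lambda>k. B k x) \<longlonglongrightarrow> 0" by (rule summable_LIMSEQ_zero)
    then have "eventually (\<lambda>k. B k x < 1) sequentially" by (rule order_tendstoD) simp
    then have "eventually (\<lambda>k. norm (f (r (Suc k)) x - f (r k) x) \<le> (1/2)^k) sequentially"
    proof eventually_elim
      case (elim k)
      have "B k x = (2^k * norm (f (r (Suc k)) x - f (r k) x)) powr p"
        unfolding B_def by (simp add: powr_mult powr_powr[symmetric] powr_realpow)
      then have "(2^k * norm (f (r (Suc k)) x - f (r k) x)) powr p < 1 powr p" using elim by simp
      then have "2^k * norm (f (r (Suc k)) x - f (r k) x) < 1"
        using p0 powr_mono2[of p 1 "2^k * norm (f (r (Suc k)) x - f (r k) x)"] by (meson leD leI less_imp_le zero_le_one)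
      then show ?case by (simp add: field_simps power_divide)
    qed
    moreover have "summable (\<lambda>k. (1/2::real)^k)" by (rule summable_geometric) auto
    ultimately have "summable (\<lambda>k. f (r (Suc k)) x - f (r k) x)"
      by (rule summable_comparison_test_ev)
    then have "convergent (\<lambda>n. \<Sum>k<n. f (r (Suc k)) x - f (r k) x)" by (simp add: summable_iff_convergent)
    then have "convergent (\<lambda>n. f (r n) x - f (r 0) x)" by (subst (asm) sum_lessThan_telescope)
    then have "convergent (\<lambda>n. (f (r n) x - f (r 0) x) + f (r 0) x)" by (intro convergent_add convergent_const)
    then show ?case by simp
  qed
  define g where "g x = lim (\<lambda>k. f (r k) x)" for x
  have [measurable]: "g \<in> borel_measurable borel"
    unfolding g_def by (rule borel_measurable_lim_metric) auto
  have lim: "AE x in lborel. (\<lambda>k. f (r k) x) \<longlonglongrightarrow> g x"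
    using conv unfolding g_def by eventually_elim (simp add: convergent_LIMSEQ_iff)
  \<comment> \<open>Fatou's lemma carries the Cauchy estimate over to the limit, for the whole
    sequence and not only for the subsequence.\<close>
  have bound: "(\<lambda>x. f n x - g x) \<in> Lp_space p \<and> Lp_norm p (\<lambda>x. f n x - g x) \<le> (1/4)^k" if n: "n \<ge> N k" for n k
  proof -
    have "(\<integral>\<^sup>+x. ennreal (norm (f n x - g x) powr p) \<partial>lborel)
        = (\<integral>\<^sup>+x. liminf (\<lambda>j. ennreal (norm (f n x - f (r j) x) powr p)) \<partial>lborel)"
    proof (rule nn_integral_cong_AE)
      show "AE x in lborel. ennreal (norm (f n x - g x) powr p) = liminf (\<lambda>j. ennreal (norm (f n x - f (r j) x) powr p))"
        using lim
      proof eventually_elim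
        case (elim x)
        have "(\<lambda>j. ennreal (norm (f n x - f (r j) x) powr p)) \<longlonglongrightarrow> ennreal (norm (f n x - g x) powr p)"
          using p0 by (intro tendsto_ennrealI tendsto_powr' tendsto_intros elim) auto
        then show ?case by (intro lim_imp_Liminf[symmetric]) auto
      qed
    qed
    also have "\<dots> \<le> liminf (\<lambda>j. \<integral>\<^sup>+x. ennreal (norm (f n x - f (r j) x) powr p) \<partial>lborel)"
      by (rule nn_integral_liminf) auto
    also have "\<dots> \<le> limsup (\<lambda>j. \<integral>\<^sup>+x. ennreal (norm (f n x - f (r j) x) powr p) \<partial>lborel)"
      by (rule Liminf_le_Limsup) auto
    also have "\<dots> \<le> ennreal (((1/4)^k) powr p)"
    proof (rule Limsup_bounded)
      show "eventually (\<lambda>j. (\<integral>\<^sup>+x. ennreal (norm (f n x - f (r j) x) powr p) \<partial>lborel) \<le> ennreal (((1/4)^k) powr p)) sequentially"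
        using eventually_ge_at_top[of k]
      proof eventually_elim
        case (elim j)
        have "r k \<le> r j" using elim unfolding r_def by (intro sum_mono2) auto
        then have "r j \<ge> N k" using rN[of k] by linarith
        then have "Lp_norm p (\<lambda>x. f n x - f (r j) x) \<le> (1/4)^k" using N[OF n, of "r j"] by simp
        then show ?case
          using p0 by (subst nn_integral_Lp[OF Lp_space_diff[OF p0 f f] p0])
            (auto intro!: ennreal_leI powr_mono2 simp: Lp_norm_nonneg)
      qed
    qed
    finally show ?thesis by (intro conjI Lp_nn_integral_bound[OF p0]) auto
  qed
  show ?thesis
  proof (rule that)
    have "(\<lambda>x. f (N 0) x - (f (N 0) x - g x)) \<in> Lp_space p"
      by (rule Lp_space_diff[OF p0 f[of "N 0"] conjunct1[OF bound[OF order_refl]]])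
    then show "g \<in> Lp_space p" by simp
    show "(\<lambda>n. Lp_norm p (\<lambda>x. f n x - g x)) \<longlonglongrightarrow> 0"
    proof (rule LIMSEQ_I)
      fix e :: real assume "e > 0"
      then obtain k where k: "(1/4::real)^k < e" using real_arch_pow_inv[of e "1/4"] by auto
      show "\<exists>no. \<forall>n\<ge>no. norm (Lp_norm p (\<lambda>x. f n x - g x) - 0) < e"
        using bound[of k] k by (intro exI[of _ "N k"]) (auto simp: Lp_norm_nonneg intro: le_less_trans)
    qed
  qed
qed


section \<open>Density of the test functions\<close>

lemma Lp_dominated_convergence:
  fixes f :: "nat \<Rightarrow> 'a::euclidean_space \<Rightarrow> complex" and W :: "'a \<Rightarrow> real"
  assumes p: "p > 0" and f: "\<And>n. f n \<in> borel_measurable borel" and g: "g \<in> borel_measurable borel"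
    and W: "integrable lborel (\<lambda>x. W x powr p)"
    and bf: "\<And>n x. norm (f n x) \<le> W x" and bg: "\<And>x. norm (g x) \<le> W x"
    and lim: "AE x in lborel. (\<lambda>n. f n x) \<longlonglongrightarrow> g x"
  shows "(\<lambda>n. Lp_norm p (\<lambda>x. f n x - g x)) \<longlonglongrightarrow> 0"
proof -
  have [measurable]: "\<And>n. f n \<in> borel_measurable borel" "g \<in> borel_measurable borel" by fact+
  have "(\<lambda>n. \<integral>x. norm (f n x - g x) powr p \<partial>lborel) \<longlonglongrightarrow> (\<integral>x. 0 \<partial>(lborel :: 'a measure))"
  proof (rule integral_dominated_convergence)
    show "integrable lborel (\<lambda>x. 2 powr p * W x powr p)" using W by simp
    show "AE x in lborel. (\<lambda>n. norm (f n x - g x) powr p) \<longlonglongrightarrow> 0"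
      using lim
    proof eventually_elim
      case (elim x)
      have "(\<lambda>n. norm (f n x - g x) powr p) \<longlonglongrightarrow> norm (g x - g x) powr p"
        using p by (intro tendsto_powr' tendsto_intros elim) auto
      then show ?case using p by simp
    qed
    fix n
    have "norm (f n x - g x) powr p \<le> 2 powr p * W x powr p" for x
    proof -
      have W0: "W x \<ge> 0" using bg[of x] norm_ge_zero[of "g x"] by linarith
      have "norm (f n x - g x) \<le> 2 * W x"
        using norm_triangle_ineq4[of "f n x" "g x"] bf[of n x] bg[of x] by simp
      then have "norm (f n x - g x) powr p \<le> (2 * W x) powr p" using p by (intro powr_mono2) auto
      then show ?thesis using W0 by (simp add: powr_mult)
    qed
    then show "AE x in lborel. norm (norm (f n x - g x) powr p) \<le> 2 powr p * W x powr p" by simp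
  qed auto
  then have "(\<lambda>n. (\<integral>x. norm (f n x - g x) powr p \<partial>lborel) powr (1 / p)) \<longlonglongrightarrow> 0 powr (1 / p)"
    using p by (intro tendsto_powr' tendsto_const) auto
  then show ?thesis using p by (simp add: Lp_norm_def)
qed

section \<open>Truncation and approximation by continuous functions\<close>

text \<open>The radial retraction onto the closed disc of radius \<open>R\<close>, written as one
  formula so that its continuity is immediate.\<close>

definition clip :: "real \<Rightarrow> complex \<Rightarrow> complex" where
  "clip R z = of_real (R / max R (cmod z)) * z"

definition cutoff :: "real \<Rightarrow> 'a::euclidean_space \<Rightarrow> complex" where
  "cutoff R x = of_real (max 0 (min 1 (R + 1 - norm x)))"

lemma norm_clip_le: "R > 0 \<Longrightarrow> cmod (clip R z) \<le> R"
  by (auto simp: clip_def norm_mult norm_divide max_def divide_simps)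

lemma clip_eq: "R > 0 \<Longrightarrow> cmod z \<le> R \<Longrightarrow> clip R z = z"
  by (simp add: clip_def max_def)

lemma continuous_clip [continuous_intros]:
  "R > 0 \<Longrightarrow> continuous_on A f \<Longrightarrow> continuous_on A (\<lambda>x. clip R (f x))"
  unfolding clip_def by (intro continuous_intros) auto

lemma continuous_cutoff [continuous_intros]: "continuous_on A (cutoff R)"
  unfolding cutoff_def by (intro continuous_intros)

lemma norm_cutoff: "cmod (cutoff R x) \<le> indicator (cball 0 (R + 1)) x"
  by (auto simp: cutoff_def indicator_def norm_of_real)

lemma cutoff_eq_1: "norm x \<le> R \<Longrightarrow> cutoff R x = 1"
  by (simp add: cutoff_def)

lemma integrable_indicator_cball:
  "integrable lborel (indicator (cball c r) :: 'a::euclidean_space \<Rightarrow> real)"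
  by (intro integrable_real_indicator emeasure_bounded_finite bounded_cball) auto

lemma integrable_powr_ball:
  fixes R r p :: real
  shows
  "integrable lborel (\<lambda>x::'a::euclidean_space. (R * indicator (cball 0 r) x) powr p)"
proof -
  have "(\<lambda>x::'a. (R * indicator (cball 0 r) x) powr p) = (\<lambda>x. R powr p * indicator (cball 0 r) x)"
    by (auto simp: indicator_def)
  moreover have "integrable lborel (\<lambda>x::'a. R powr p * indicator (cball 0 r) x)"
    by (intro integrable_mult_right integrable_indicator_cball)
  ultimately show ?thesis by (simp only:)
qed

lemma compactly_supported_boundE:
  fixes f :: "'a::euclidean_space \<Rightarrow> complex"
  assumes "continuous_on UNIV f" "compact (closure {x. f x \<noteq> 0})"
  obtains R where "R > 0" "\<And>x. norm (f x) \<le> R * indicator (cball 0 R) x"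
proof -
  define K where "K = closure {x. f x \<noteq> 0}"
  have "compact (f ` K)" using assms by (intro compact_continuous_image) (auto simp: K_def intro: continuous_on_subset)
  then have "bounded (f ` K)" "bounded K"
    using assms(2) by (auto simp: K_def intro: compact_imp_bounded)
  then obtain B C where BC: "\<forall>z\<in>f ` K. norm z \<le> B" "\<forall>x\<in>K. norm x \<le> C"
    unfolding bounded_iff by auto
  then have B: "norm (f x) \<le> B" and C: "norm x \<le> C" if "x \<in> K" for x
    using that by auto
  define R where "R = \<bar>B\<bar> + \<bar>C\<bar> + 1"
  have "norm (f x) \<le> R * indicator (cball 0 R) x" for x
  proof (cases "f x = 0")
    case False
    then have "x \<in> K" unfolding K_def by (intro subsetD[OF closure_subset]) simp
    then show ?thesis using B[of x] C[of x] by (auto simp: R_def indicator_def)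
  qed (auto simp: R_def indicator_def)
  then show ?thesis by (intro that[of R]) (auto simp: R_def)
qed

lemma compactly_supported_Lp:
  fixes f :: "'a::euclidean_space \<Rightarrow> complex"
  assumes p: "p > 0" and f: "f \<in> borel_measurable borel" and b: "\<And>x. norm (f x) \<le> R * indicator (cball 0 R) x"
  shows "f \<in> Lp_space p"
proof -
  have [measurable]: "f \<in> borel_measurable borel" by fact
  have "integrable lborel (\<lambda>x. norm (f x) powr p)"
  proof (rule Bochner_Integration.integrable_bound[OF integrable_powr_ball[of R R p]])
    have "norm (f x) powr p \<le> (R * indicator (cball 0 R) x) powr p" for x
      using p b by (intro powr_mono2) auto
    then show "AE x in lborel. norm (norm (f x) powr p) \<le> norm ((R * indicator (cball 0 R) x) powr p)" by simp
  qed measurable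
  then show ?thesis using f by (simp add: Lp_space_def)
qed

lemma test_function_boundE:
  assumes "f \<in> test_functions"
  obtains R where "R > 0" "\<And>x. norm (f x) \<le> R * indicator (cball 0 R) x"
  using assms compactly_supported_boundE[of f] by (auto simp: test_functions_def)

lemma test_function_measurable: "f \<in> test_functions \<Longrightarrow> f \<in> borel_measurable borel"
  by (auto simp: test_functions_def intro: borel_measurable_continuous_onI)

lemma test_function_Lp:
  assumes "f \<in> test_functions" "p > 0"
  shows "f \<in> Lp_space p"
proof -
  obtain R where "\<And>x. norm (f x) \<le> R * indicator (cball 0 R) x"
    using test_function_boundE[OF assms(1)] by blast
  then show ?thesis by (rule compactly_supported_Lp[OF assms(2) test_function_measurable[OF assms(1)]])
qed

lemma Lp_bounded_approx:
  fixes f :: "'a::euclidean_space \<Rightarrow> complex"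
  assumes p: "p > 0" and f: "f \<in> Lp_space p" and e: "e > 0"
  obtains g R where "R > 0" "g \<in> borel_measurable borel" "\<And>x. norm (g x) \<le> R * indicator (cball 0 R) x"
    "Lp_norm p (\<lambda>x. g x - f x) < e"
proof -
  have [measurable]: "f \<in> borel_measurable borel" using f by (rule Lp_space_measurable)
  define g where "g n x = (if norm x \<le> real n \<and> norm (f x) \<le> real n then f x else 0)" for n x
  have [measurable]: "g n \<in> borel_measurable borel" for n unfolding g_def by measurable
  have "(\<lambda>n. Lp_norm p (\<lambda>x. g n x - f x)) \<longlonglongrightarrow> 0"
  proof (rule Lp_dominated_convergence[OF p, where W = "\<lambda>x. norm (f x)"])
    have "(\<lambda>n. g n x) \<longlonglongrightarrow> f x" for x
    proof (rule tendsto_eventually)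
      show "eventually (\<lambda>n. g n x = f x) sequentially"
        using eventually_ge_at_top[of "nat \<lceil>max (norm x) (norm (f x))\<rceil>"]
        by eventually_elim (auto simp: g_def nat_ceiling_le_eq)
    qed
    then show "AE x in lborel. (\<lambda>n. g n x) \<longlonglongrightarrow> f x" by simp
  qed (use Lp_space_integrable[OF f] in \<open>auto simp: g_def\<close>)
  then have "eventually (\<lambda>n. Lp_norm p (\<lambda>x. g n x - f x) < e) sequentially"
    by (rule order_tendstoD) (use e in auto)
  then obtain N where "\<And>n. n \<ge> N \<Longrightarrow> Lp_norm p (\<lambda>x. g n x - f x) < e"
    by (auto simp: eventually_sequentially)
  then have "Lp_norm p (\<lambda>x. g (Suc N) x - f x) < e" by simp
  then show ?thesis
    by (intro that[of "real (Suc N)" "g (Suc N)"]) (auto simp: g_def indicator_def)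
qed

text \<open>A measurable function is, off a negligible set, a pointwise limit of continuous
  functions. These may be unbounded and without a common support, so they are clipped and cut off;
  both operations fix \<open>g\<close>, and dominated convergence applies.\<close>

lemma bounded_continuous_approx:
  fixes g :: "'a::euclidean_space \<Rightarrow> complex"
  assumes p: "p > 0" and R: "R > 0" and g: "g \<in> borel_measurable borel"
    and bg: "\<And>x. norm (g x) \<le> R * indicator (cball 0 R) x" and e: "e > 0"
  obtains v where "continuous_on UNIV v" "\<And>x. norm (v x) \<le> (R + 1) * indicator (cball 0 (R + 1)) x"
    "Lp_norm p (\<lambda>x. v x - g x) < e"
proof -
  have [measurable]: "g \<in> borel_measurable borel" by fact
  have "g measurable_on UNIV"
    by (rule lebesgue_measurable_imp_measurable_on) (auto intro: measurable_completion)
  then obtain N u where N: "negligible N" and u: "\<And>n. continuous_on UNIV (u n)"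
    "\<And>x. x \<notin> N \<Longrightarrow> (\<lambda>n. u n x) \<longlonglongrightarrow> g x"
    unfolding measurable_on_def by auto
  define v where "v n x = cutoff R x * clip R (u n x)" for n x
  have cv: "continuous_on UNIV (v n)" for n
    unfolding v_def by (intro continuous_intros R u)
  have nv: "norm (v n x) \<le> R * indicator (cball 0 (R + 1)) x" for n x
    using mult_mono[OF norm_cutoff[of R x] norm_clip_le[OF R, of "u n x"]] R
    by (simp add: v_def norm_mult mult.commute)
  have bg': "norm (g x) \<le> R" "norm (g x) \<le> R * indicator (cball 0 (R + 1)) x" for x
    using bg[of x] R by (cases "x \<in> cball 0 R"; simp)+
  have g_eq: "cutoff R x * clip R (g x) = g x" for x
  proof (cases "norm x \<le> R")
    case True
    then show ?thesis by (simp add: clip_eq[OF R bg'(1)] cutoff_eq_1)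
  next
    case False
    then have "g x = 0" using bg[of x] by simp
    then show ?thesis by (simp add: clip_def)
  qed
  have "(\<lambda>n. Lp_norm p (\<lambda>x. v n x - g x)) \<longlonglongrightarrow> 0"
  proof (rule Lp_dominated_convergence[OF p _ _ integrable_powr_ball nv bg'(2)])
    show "v n \<in> borel_measurable borel" for n by (rule borel_measurable_continuous_onI[OF cv])
    have "N \<in> null_sets lebesgue" using N by (simp add: negligible_iff_null_sets)
    then have "AE x in lborel. x \<notin> N"
      using AE_not_in[OF \<open>N \<in> null_sets lebesgue\<close>] by (simp add: AE_completion_iff)
    then show "AE x in lborel. (\<lambda>n. v n x) \<longlonglongrightarrow> g x"
    proof eventually_elim
      case (elim x)
      have "(\<lambda>n. v n x) \<longlonglongrightarrow> cutoff R x * clip R (g x)"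
        unfolding v_def
        by (intro tendsto_mult tendsto_const continuous_on_tendsto_compose[OF continuous_clip[OF R continuous_on_id, of UNIV] u(2)[OF elim]]) auto
      then show ?case by (simp add: g_eq)
    qed
  qed (use g in auto)
  then have "eventually (\<lambda>n. Lp_norm p (\<lambda>x. v n x - g x) < e) sequentially"
    by (rule order_tendstoD) (use e in auto)
  then obtain n where n: "Lp_norm p (\<lambda>x. v n x - g x) < e"
    by (auto simp: eventually_sequentially)
  show ?thesis
    by (rule that[OF cv order_trans[OF nv mult_right_mono] n]) auto
qed

lemma compact_support_of_bound:
  fixes f :: "'a::euclidean_space \<Rightarrow> complex"
  assumes "\<And>x. norm (f x) \<le> C * indicator (cball 0 R) x"
  shows "compact (closure {x. f x \<noteq> 0})"
proof -
  have "{x. f x \<noteq> 0} \<subseteq> cball 0 R"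
  proof
    fix x assume x: "x \<in> {x. f x \<noteq> 0}"
    show "x \<in> cball 0 R" using assms[of x] x by (cases "x \<in> cball 0 R") auto
  qed
  then have "bounded {x. f x \<noteq> 0}" using bounded_cball bounded_subset by blast
  then show ?thesis by (simp add: compact_closure)
qed

section \<open>Correction of the mean\<close>

text \<open>Mass 1 is spread over a large ball: a profile of integral \<open>I\<close>, divided by
  \<open>I\<close>, has norm at most \<open>I powr (- ((p - 1) / p))\<close>, which tends to 0
  because \<open>p > 1\<close>. Such bumps remove the integral of a function at arbitrarily small
  cost in L^p.\<close>

lemma spread_bump:
  assumes p: "p > 1" and e: "e > 0"
  obtains \<phi> :: "'a::euclidean_space \<Rightarrow> complex" and R
  where "continuous_on UNIV \<phi>" "\<And>x. norm (\<phi> x) \<le> R * indicator (cball 0 R) x" "R > 0"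
    "(\<integral>x. \<phi> x \<partial>lborel) = 1" "Lp_norm p \<phi> < e"
proof -
  have "((\<lambda>I. I powr (- ((p - 1) / p))) \<longlongrightarrow> 0) at_top"
    by (rule tendsto_neg_powr) (use p in \<open>auto intro: filterlim_ident\<close>)
  then have "eventually (\<lambda>I. I powr (- ((p - 1) / p)) < e) at_top"
    by (rule order_tendstoD) (use e in auto)
  then obtain I0 where I0: "\<And>I. I \<ge> I0 \<Longrightarrow> I powr (- ((p - 1) / p)) < e"
    by (auto simp: eventually_at_top_linorder)
  define c where "c = measure lborel (cball 0 1 :: 'a set)"
  have c: "c > 0" unfolding c_def by (simp add: content_cball_pos)
  \<comment> \<open>\<open>R \<ge> 1\<close> makes the volume \<open>R ^ DIM('a) * c\<close> of the
    ball at least \<open>R * c\<close>, hence at least \<open>I0\<close>.\<close>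
  define R where "R = max 1 (\<bar>I0\<bar> / c)"
  have R: "R \<ge> 1" "c * R \<ge> I0" using c by (auto simp: R_def max_def field_simps)
  define \<tau> where "\<tau> x = max 0 (min 1 (R + 1 - norm x))" for x :: 'a
  have ct: "continuous_on UNIV \<tau>" unfolding \<tau>_def by (intro continuous_intros)
  then have [measurable]: "\<tau> \<in> borel_measurable borel" by (rule borel_measurable_continuous_onI)
  have t01: "0 \<le> \<tau> x" "\<tau> x \<le> 1" for x by (auto simp: \<tau>_def)
  have ti: "\<tau> x \<le> indicator (cball 0 (R + 1)) x" for x by (auto simp: \<tau>_def indicator_def)
  have intt: "integrable lborel \<tau>"
  proof (rule Bochner_Integration.integrable_bound)
    show "integrable lborel (indicator (cball 0 (R + 1)) :: 'a \<Rightarrow> real)"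
      by (rule integrable_indicator_cball)
    show "AE x in lborel. norm (\<tau> x) \<le> norm (indicator (cball 0 (R + 1)) x :: real)"
      using ti t01 by simp
  qed measurable
  define I where "I = (\<integral>x. \<tau> x \<partial>lborel)"
  have "c * R \<le> I"
  proof -
    have "c * R \<le> measure lborel (cball 0 R :: 'a set)"
    proof -
      have "measure lborel (cball 0 R :: 'a set) = R ^ DIM('a) * c"
        unfolding c_def using R by (simp add: content_cball)
      moreover have "R ^ 1 \<le> R ^ DIM('a)" using R by (intro power_increasing) (auto simp: Suc_le_eq)
      ultimately show ?thesis using c by (simp add: mult.commute mult_left_mono)
    qed
    also have "\<dots> = (\<integral>x. indicator (cball 0 R) x \<partial>(lborel :: 'a measure))" by simp
    also have "\<dots> \<le> I" unfolding I_def
    proof (rule integral_mono[OF _ intt])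
      show "integrable lborel (indicator (cball 0 R) :: 'a \<Rightarrow> real)"
        by (rule integrable_indicator_cball)
    qed (auto simp: \<tau>_def indicator_def)
    finally show ?thesis .
  qed
  then have I: "I \<ge> I0" "I > 0" using R c by (auto intro: order_trans) (smt (verit) mult_pos_pos)
  define \<phi> where "\<phi> x = complex_of_real (\<tau> x / I)" for x
  show ?thesis
  proof (rule that[of \<phi> "max (R + 1) (1 / I)"])
    show cph: "continuous_on UNIV \<phi>" unfolding \<phi>_def using I by (intro continuous_intros ct) auto
    then have [measurable]: "\<phi> \<in> borel_measurable borel" by (rule borel_measurable_continuous_onI)
    show "norm (\<phi> x) \<le> max (R + 1) (1 / I) * indicator (cball 0 (max (R + 1) (1 / I))) x" for x
    proof -
      have "norm (\<phi> x) = \<tau> x / I" using t01[of x] I by (simp add: \<phi>_def norm_divide)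
      moreover have "\<tau> x / I \<le> 1 / I * indicator (cball 0 (R + 1)) x"
        using ti[of x] I by (simp add: divide_right_mono)
      moreover have "\<dots> \<le> max (R + 1) (1 / I) * indicator (cball 0 (max (R + 1) (1 / I))) x"
        using R I by (intro mult_mono) (auto simp: indicator_def)
      ultimately show ?thesis by linarith
    qed
    show "max (R + 1) (1 / I) > 0" using R by auto
    show "(\<integral>x. \<phi> x \<partial>lborel) = 1" using I unfolding \<phi>_def by (simp add: I_def)
    have pw: "norm (\<phi> x) powr p \<le> I powr (- p) * \<tau> x" for x
    proof -
      have "norm (\<phi> x) = \<tau> x / I" using t01[of x] I by (simp add: \<phi>_def norm_divide)
      moreover have "\<tau> x powr p \<le> \<tau> x"
        using t01[of x] p powr_mono'[of 1 p "\<tau> x"] by simp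
      ultimately show ?thesis
        using t01[of x] I by (simp add: powr_divide powr_minus_divide divide_right_mono)
    qed
    have "(\<integral>x. norm (\<phi> x) powr p \<partial>lborel) \<le> (\<integral>x. I powr (- p) * \<tau> x \<partial>lborel)"
    proof (rule integral_mono)
      show "integrable lborel (\<lambda>x. norm (\<phi> x) powr p)"
      proof (rule Bochner_Integration.integrable_bound[of _ "\<lambda>x. I powr (-p) * \<tau> x"])
        show "AE x in lborel. norm (norm (\<phi> x) powr p) \<le> norm (I powr (-p) * \<tau> x)"
          using pw t01 by (auto intro: order_trans)
      qed (use intt in auto)
    qed (use intt pw in auto)
    also have "\<dots> = I powr (1 - p)"
      using I by (simp add: I_def[symmetric] powr_diff powr_minus_divide)
    finally have "Lp_norm p \<phi> \<le> (I powr (1 - p)) powr (1 / p)"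
      unfolding Lp_norm_def using p by (intro powr_mono2) auto
    also have "\<dots> = I powr (- ((p - 1) / p))" by (simp add: powr_powr minus_divide_left)
    also have "\<dots> < e" by (rule I0[OF I(1)])
    finally show "Lp_norm p \<phi> < e" .
  qed
qed

proposition test_functions_dense:
  fixes f :: "'a::euclidean_space \<Rightarrow> complex"
  assumes p: "p > 1" and f: "f \<in> Lp_space p" and e: "e > 0"
  obtains g where "g \<in> test_functions" "Lp_norm p (\<lambda>x. g x - f x) < e"
proof -
  have p0: "p > 0" "p \<ge> 1" using p by auto
  have e3: "e / 3 > 0" using e by simp
  obtain g R where R: "R > 0" and g: "g \<in> borel_measurable borel"
    "\<And>x. norm (g x) \<le> R * indicator (cball 0 R) x" "Lp_norm p (\<lambda>x. g x - f x) < e / 3"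
    by (rule Lp_bounded_approx[OF p0(1) f e3]) (rule that, simp_all)
  obtain v where v: "continuous_on UNIV v" "\<And>x. norm (v x) \<le> (R + 1) * indicator (cball 0 (R + 1)) x"
    "Lp_norm p (\<lambda>x. v x - g x) < e / 3"
    by (rule bounded_continuous_approx[OF p0(1) R g(1,2) e3]) (rule that, simp_all)
  define c where "c = (\<integral>x. v x \<partial>lborel)"
  obtain \<phi> :: "'a \<Rightarrow> complex" and S where \<phi>: "continuous_on UNIV \<phi>" "\<And>x. norm (\<phi> x) \<le> S * indicator (cball 0 S) x" "S > 0"
    "(\<integral>x. \<phi> x \<partial>(lborel::'a measure)) = 1" "Lp_norm p \<phi> < e / 3 / (cmod c + 1)"
    by (rule spread_bump[OF p, of "e / 3 / (cmod c + 1)"])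
      (use e3 in \<open>simp add: divide_pos_pos add_nonneg_pos\<close>, rule that, simp_all)
  have mv: "v \<in> borel_measurable borel" "\<phi> \<in> borel_measurable borel"
    using v \<phi> by (auto intro: borel_measurable_continuous_onI)
  have L: "g \<in> Lp_space p'" "v \<in> Lp_space p'" "\<phi> \<in> Lp_space p'" if "p' > 0" for p'
    using compactly_supported_Lp[OF that g(1,2)] compactly_supported_Lp[OF that mv(1) v(2)]
      compactly_supported_Lp[OF that mv(2) \<phi>(2)] by auto
  have int: "integrable lborel v" "integrable lborel \<phi>"
    using L(2,3)[of 1] integrable_norm_cancel[of lborel v] integrable_norm_cancel[of lborel \<phi>] mv
    by (auto simp: Lp_space_def)
  \<comment> \<open>The bump carries away the integral \<open>c\<close> of \<open>v\<close>; its
    norm was chosen against \<open>cmod c\<close>.\<close>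
  define h where "h x = v x - c * \<phi> x" for x
  have Lh: "h \<in> Lp_space p" "(\<lambda>x. c * \<phi> x) \<in> Lp_space p"
    unfolding h_def using p0 L by (auto intro!: Lp_space_diff Lp_space_cmult)
  show ?thesis
  proof (rule that)
    have "continuous_on UNIV h" unfolding h_def by (intro continuous_intros v \<phi>)
    moreover have "(\<integral>x. h x \<partial>lborel) = 0"
      unfolding h_def using int \<phi>(4) by (simp add: c_def)
    moreover have "compact (closure {x. h x \<noteq> 0})"
    proof (rule compact_support_of_bound)
      fix x
      have "norm (h x) \<le> norm (v x) + cmod c * norm (\<phi> x)"
        unfolding h_def using norm_triangle_ineq4[of "v x" "c * \<phi> x"] by (simp add: norm_mult)
      also have "\<dots> \<le> (R + 1) * indicator (cball 0 (R + 1)) x + cmod c * (S * indicator (cball 0 S) x)"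
        by (intro add_mono mult_left_mono v \<phi>) auto
      also have "\<dots> \<le> (R + 1 + cmod c * S) * indicator (cball 0 (max (R + 1) S)) x"
        using R \<phi>(3) by (auto simp: indicator_def)
      finally show "norm (h x) \<le> (R + 1 + cmod c * S) * indicator (cball 0 (max (R + 1) S)) x" .
    qed
    ultimately show "h \<in> test_functions" by (simp add: test_functions_def)
    have "Lp_norm p (\<lambda>x. h x - f x) \<le> Lp_norm p (\<lambda>x. h x - v x) + Lp_norm p (\<lambda>x. v x - f x)"
      using L p0 f Lh by (intro Lp_norm_triangle_diff) auto
    also have "Lp_norm p (\<lambda>x. v x - f x) \<le> Lp_norm p (\<lambda>x. v x - g x) + Lp_norm p (\<lambda>x. g x - f x)"
      using L p0 f by (intro Lp_norm_triangle_diff) auto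
    also have "Lp_norm p (\<lambda>x. h x - v x) = cmod c * Lp_norm p \<phi>"
    proof -
      have "(\<lambda>x. h x - v x) = (\<lambda>x. (- c) * \<phi> x)" by (auto simp: h_def)
      then show ?thesis using Lp_norm_cmult[OF p0(1), of "- c" \<phi>] by simp
    qed
    also have "cmod c * Lp_norm p \<phi> \<le> cmod c * (e / 3 / (cmod c + 1))"
      using \<phi>(5) by (intro mult_left_mono) auto
    also have "\<dots> \<le> e / 3"
      using e by (simp add: field_simps add_pos_nonneg)
    finally show "Lp_norm p (\<lambda>x. h x - f x) < e" using v(3) g(3) by simp
  qed
qed


section \<open>Binary filtrations and their Haar functions\<close>

text \<open>\<open>B t x\<close> is a label of the atom of generation \<open>t\<close> that contains \<open>x\<close>; generations become
  coarser as \<open>t\<close> grows, and \<open>bit t\<close> splits each atom of generation \<open>t\<close> into two of generation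
  \<open>t - 1\<close>.\<close>

locale binary_filtration =
  fixes B :: "int \<Rightarrow> 'a::euclidean_space \<Rightarrow> 'm" and bit :: "int \<Rightarrow> 'a \<Rightarrow> bool" and \<kappa> :: real
  assumes \<kappa>_pos: "\<kappa> > 0"
    and refine: "B (t - 1) x = B (t - 1) y \<longleftrightarrow> B t x = B t y \<and> bit t x = bit t y"
    and cell_measurable: "{y. B t y = B t x} \<in> sets borel"
    and cell_measure: "emeasure lborel {y. B t y = B t x} = ennreal (\<kappa> * 2 powi t)"
    and cells_small: "e > 0 \<Longrightarrow> \<exists>t0. \<forall>t\<le>t0. \<forall>x y. B t x = B t y \<longrightarrow> dist x y < e"
    and cells_bounded: "\<exists>C. \<forall>x y. B t x = B t y \<longrightarrow> dist x y \<le> C"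
begin

definition cell :: "int \<Rightarrow> 'm \<Rightarrow> 'a set" where "cell t a = {y. B t y = a}"

definition half :: "int \<Rightarrow> 'm \<Rightarrow> bool \<Rightarrow> 'a set" where "half t a b = {y. B t y = a \<and> bit t y = b}"

definition vol :: "int \<Rightarrow> real" where "vol t = \<kappa> * 2 powi t"

definition nodes :: "(int \<times> 'm) set" where "nodes = {(t, a). a \<in> range (B t)}"

definition haar :: "int \<times> 'm \<Rightarrow> 'a \<Rightarrow> real" where
  "haar i x = (indicator (half (fst i) (snd i) True) x - indicator (half (fst i) (snd i) False) x)
                / sqrt (vol (fst i))"

section \<open>Cells, halves and their Haar functions\<close>

lemma vol_pos: "vol t > 0"
  using \<kappa>_pos by (simp add: vol_def)

lemma vol_minus_1: "vol (t - 1) = vol t / 2"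
  by (simp add: vol_def power_int_diff)

lemma coarsen: "t \<le> s \<Longrightarrow> B t x = B t y \<Longrightarrow> B s x = B s y"
proof (induction s rule: int_ge_induct)
  case (step s)
  then show ?case using refine[of "s + 1" x y] by simp
qed

lemma coarsen_bit: "t < s \<Longrightarrow> B t x = B t y \<Longrightarrow> bit s x = bit s y"
  using coarsen[of t "s - 1" x y] refine[of s x y] by simp

lemma measurable_cell: "cell t a \<in> sets borel"
proof (cases "a \<in> range (B t)")
  case True
  then show ?thesis using cell_measurable by (auto simp: cell_def)
next
  case False
  then have "cell t a = {}" by (auto simp: cell_def)
  then show ?thesis by simp
qed

lemma emeasure_cell: "a \<in> range (B t) \<Longrightarrow> emeasure lborel (cell t a) = ennreal (vol t)"
  using cell_measure by (auto simp: cell_def vol_def)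

lemma half_cases: "half t a b = {} \<or> (\<exists>c\<in>range (B (t - 1)). half t a b = cell (t - 1) c)"
proof (cases "half t a b = {}")
  case False
  then obtain x where x: "B t x = a" "bit t x = b" by (auto simp: half_def)
  then have "half t a b = cell (t - 1) (B (t - 1) x)"
    unfolding half_def cell_def using refine[of t _ x] by auto
  then show ?thesis by blast
qed simp

lemma measurable_half [measurable]: "half t a b \<in> sets borel"
  using half_cases[of t a b] measurable_cell by auto

lemma cell_half: "cell t a = half t a True \<union> half t a False" "half t a True \<inter> half t a False = {}"
  by (auto simp: cell_def half_def)

text \<open>An empty half would leave the whole cell to the other half, whose measure is at most
  that of a cell one generation finer, and this is only half of what the cell has.\<close>

lemma half_cell:
  assumes "a \<in> range (B t)"
  obtains c where "c \<in> range (B (t - 1))" "half t a b = cell (t - 1) c"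
proof -
  have "half t a b \<noteq> {}"
  proof
    assume E: "half t a b = {}"
    then have "cell t a = half t a (\<not> b)" using cell_half(1)[of t a] by (cases b) auto
    moreover have "emeasure lborel (half t a (\<not> b)) \<le> ennreal (vol (t - 1))"
      using half_cases[of t a "\<not> b"] emeasure_cell by auto
    ultimately have "ennreal (vol t) \<le> ennreal (vol (t - 1))"
      using emeasure_cell[OF assms] by simp
    then show False using vol_pos[of t] vol_minus_1[of t] by simp
  qed
  then show ?thesis using half_cases[of t a b] that by blast
qed

lemma emeasure_half: "a \<in> range (B t) \<Longrightarrow> emeasure lborel (half t a b) = ennreal (vol t / 2)"
  by (metis half_cell emeasure_cell vol_minus_1)

lemma measure_half: "a \<in> range (B t) \<Longrightarrow> measure lborel (half t a b) = vol t / 2"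
  using emeasure_half[of a t b] vol_pos[of t] by (simp add: measure_def)

lemma integrable_half: "integrable lborel (indicator (half t a b) :: 'a \<Rightarrow> real)"
proof (cases "half t a b = {}")
  case False
  then have "a \<in> range (B t)" by (auto simp: half_def)
  then show ?thesis by (intro integrable_real_indicator) (simp_all add: emeasure_half)
qed simp

lemma bounded_cell: "bounded (cell t a)"
proof -
  obtain C where C: "\<And>x y. B t x = B t y \<Longrightarrow> dist x y \<le> C" using cells_bounded[of t] by auto
  show ?thesis
  proof (cases "cell t a = {}")
    case False
    then obtain x where "B t x = a" by (auto simp: cell_def)
    then have "\<forall>y\<in>cell t a. dist x y \<le> C" using C by (auto simp: cell_def)
    then show ?thesis by (auto simp: bounded_def)
  qed simp
qed

lemma haar_alt: "haar (t, a) x = (if B t x = a then (if bit t x then 1 else - 1) / sqrt (vol t) else 0)"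
  by (simp add: haar_def half_def)

lemma haar_measurable [measurable]: "haar i \<in> borel_measurable borel"
  unfolding haar_def by measurable

lemma haar_norm_le: "\<bar>haar (t, a) x\<bar> \<le> 1 / sqrt (vol t) * indicator (cell t a) x"
  using vol_pos[of t] by (simp add: haar_alt cell_def abs_divide)

lemma cell_subset_cball:
  obtains R where "R > 0" "cell t a \<subseteq> cball 0 R"
proof -
  obtain C where "C > 0" "\<forall>x\<in>cell t a. norm x \<le> C" using bounded_cell[of t a] by (auto simp: bounded_pos)
  then show ?thesis by (intro that[of C]) auto
qed

lemma haar_boundE:
  obtains R where "R > 0" "\<And>x. norm (complex_of_real (haar i x)) \<le> R * indicator (cball 0 R) x"
proof -
  obtain t a where i: "i = (t, a)" by (cases i)
  obtain r where r: "r > 0" "cell t a \<subseteq> cball 0 r" by (rule cell_subset_cball)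
  define R where "R = max r (1 / sqrt (vol t))"
  have R: "R > 0" "r \<le> R" "1 / sqrt (vol t) \<le> R" using r by (auto simp: R_def)
  have "norm (complex_of_real (haar i x)) \<le> R * indicator (cball 0 R) x" for x
  proof -
    have "norm (complex_of_real (haar i x)) \<le> 1 / sqrt (vol t) * indicator (cell t a) x"
      using haar_norm_le[of t a x] by (simp add: i)
    also have "\<dots> \<le> R * indicator (cball 0 R) x"
    proof (rule mult_mono)
      have "cell t a \<subseteq> cball 0 R" using r(2) R(2) by auto
      then show "indicat_real (cell t a) x \<le> indicat_real (cball 0 R) x" by (intro indicator_leI) auto
    qed (use R in auto)
    finally show ?thesis .
  qed
  with R(1) show ?thesis by (rule that)
qed

lemma haar_Lp: "p > 0 \<Longrightarrow> (\<lambda>x. complex_of_real (haar i x)) \<in> Lp_space p"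
  by (rule haar_boundE[of i]) (rule compactly_supported_Lp, auto)

lemma haar_sum_Lp: "p > 0 \<Longrightarrow> (\<lambda>x. \<Sum>i\<in>F. c i * complex_of_real (haar i x)) \<in> Lp_space p"
  by (intro Lp_space_sum Lp_space_cmult haar_Lp)

text \<open>A Haar function of the same generation on another cell vanishes here, and one of a
  coarser generation sees only the cell. This constancy drives both the coarse-to-fine induction and
  orthogonality.\<close>

lemma haar_constant:
  assumes "fst j \<ge> t" "j \<noteq> (t, a)" "x \<in> cell t a" "y \<in> cell t a"
  shows "haar j x = haar j y"
proof -
  obtain s b where j: "j = (s, b)" by (cases j)
  have xy: "B t x = a" "B t y = a" using assms by (auto simp: cell_def)
  show ?thesis
  proof (cases "s = t")
    case True
    then show ?thesis using assms j xy by (simp add: haar_alt)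
  next
    case False
    then have "t < s" using assms j by simp
    then show ?thesis using coarsen[of t s x y] coarsen_bit[of t s x y] xy by (simp add: j haar_alt)
  qed
qed

subsection \<open>The inequality for finite sums\<close>

lemma zigzag_integral_nonpos:
  fixes c \<sigma> :: "int \<times> 'm \<Rightarrow> complex"
  assumes U0: "U 0 0 = (0::real)"
    and zigzag: "\<And>x y h k. cmod h = cmod k \<Longrightarrow> U (x + h) (y + k) + U (x - h) (y - k) \<le> 2 * U x y"
    and F: "finite F" "F \<subseteq> nodes" and \<sigma>: "\<And>i. i \<in> F \<Longrightarrow> cmod (\<sigma> i) = 1"
  defines "f \<equiv> \<lambda>F x. \<Sum>i\<in>F. c i * complex_of_real (haar i x)"
    and "g \<equiv> \<lambda>F x. \<Sum>i\<in>F. \<sigma> i * c i * complex_of_real (haar i x)"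
  shows "integrable lborel (\<lambda>x. U (f F x) (g F x)) \<and> (\<integral>x. U (f F x) (g F x) \<partial>lborel) \<le> 0"
  using F \<sigma>
\<comment> \<open>Ranking by \<open>- fst i\<close> inserts the nodes from coarse to fine, so that
  the partial sums are constant on the cell of the inserted node.\<close>
proof (induction F rule: finite_ranking_induct[where f = "\<lambda>i. - fst i"])
  case empty
  then show ?case by (simp add: f_def g_def U0)
next
  case (insert i S)
  show ?case
  proof (cases "i \<in> S")
    case True
    then show ?thesis using insert by (simp add: insert_absorb)
  next
    case False
    obtain t a where i: "i = (t, a)" by (cases i)
    have a: "a \<in> range (B t)" using insert.prems by (simp add: i nodes_def)
    then obtain z where z: "z \<in> cell t a" by (auto simp: cell_def)
    define x0 y0 where "x0 = f S z" and "y0 = g S z"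
    define h where "h = c i / complex_of_real (sqrt (vol t))"
    have const: "f S x = x0" "g S x = y0" if "x \<in> cell t a" for x
    proof -
      have "haar j x = haar j z" if "j \<in> S" for j
      proof (rule haar_constant[OF _ _ \<open>x \<in> cell t a\<close> z])
        show "t \<le> fst j" using insert.hyps(2)[OF that] i by simp
        show "j \<noteq> (t, a)" using that False i by auto
      qed
      then show "f S x = x0" "g S x = y0" by (simp_all add: f_def g_def x0_def y0_def)
    qed
    define uT uF where "uT = U (x0 + h) (y0 + \<sigma> i * h)" and "uF = U (x0 - h) (y0 - \<sigma> i * h)"
    \<comment> \<open>Inserting \<open>i\<close> changes the integrand by one constant on each half,
      and the halves have equal measure. The integral therefore changes by
      \<open>uT + uF - 2 * U x0 y0\<close> times \<open>vol t / 2\<close>.\<close>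
    have step: "U (f (insert i S) x) (g (insert i S) x) = U (f S x) (g S x)
        + (uT - U x0 y0) * indicator (half t a True) x + (uF - U x0 y0) * indicator (half t a False) x" for x
    proof -
      have fi: "f (insert i S) x = f S x + c i * complex_of_real (haar i x)"
        "g (insert i S) x = g S x + \<sigma> i * c i * complex_of_real (haar i x)"
        using insert.hyps(1) False by (simp_all add: f_def g_def)
      consider "x \<in> half t a True" | "x \<in> half t a False" | "x \<notin> cell t a"
        using cell_half(1) by blast
      then show ?thesis
      proof cases
        case 1
        then have "x \<in> cell t a" "haar i x = 1 / sqrt (vol t)" "x \<notin> half t a False"
          by (auto simp: cell_half(1) i haar_alt half_def)
        then show ?thesis using 1 unfolding fi by (simp add: const uT_def h_def)
      next
        case 2
        then have "x \<in> cell t a" "haar i x = - 1 / sqrt (vol t)" "x \<notin> half t a True"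
          by (auto simp: cell_half(1) i haar_alt half_def)
        then show ?thesis using 2 unfolding fi by (simp add: const uF_def h_def)
      next
        case 3
        then have "haar i x = 0" "x \<notin> half t a True" "x \<notin> half t a False"
          by (auto simp: cell_half(1) i haar_alt half_def)
        then show ?thesis unfolding fi by simp
      qed
    qed
    have IH: "integrable lborel (\<lambda>x. U (f S x) (g S x))" "(\<integral>x. U (f S x) (g S x) \<partial>lborel) \<le> 0"
      using insert.IH insert.prems by auto
    have "uT + uF \<le> 2 * U x0 y0"
      unfolding uT_def uF_def by (rule zigzag) (use insert.prems in \<open>simp add: norm_mult\<close>)
    then have neg: "(uT - U x0 y0 + (uF - U x0 y0)) * (vol t / 2) \<le> 0"
      using vol_pos[of t] by (intro mult_nonpos_nonneg) auto
    have "(\<integral>x. U (f (insert i S) x) (g (insert i S) x) \<partial>lborel) = (\<integral>x. U (f S x) (g S x) \<partial>lborel)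
       + (uT - U x0 y0) * (vol t / 2) + (uF - U x0 y0) * (vol t / 2)"
      unfolding step using IH(1) integrable_half by (simp add: measure_half[OF a])
    moreover have "integrable lborel (\<lambda>x. U (f (insert i S) x) (g (insert i S) x))"
      unfolding step using IH(1) integrable_half
      by (intro Bochner_Integration.integrable_add integrable_mult_right) auto
    ultimately show ?thesis using IH(2) neg unfolding distrib_right by linarith
  qed
qed

proposition finite_transform_bound:
  assumes p: "1 < p" and q: "1 / p + 1 / q = 1"
    and F: "finite F" "F \<subseteq> nodes" and \<sigma>: "\<And>i. i \<in> F \<Longrightarrow> cmod (\<sigma> i) = 1"
  shows "Lp_norm p (\<lambda>x. \<Sum>i\<in>F. \<sigma> i * c i * complex_of_real (haar i x))
           \<le> (max p q - 1) * Lp_norm p (\<lambda>x. \<Sum>i\<in>F. c i * complex_of_real (haar i x))"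
proof -
  define C where "C = max p q - 1"
  have C: "C > 0" using p by (auto simp: C_def)
  have p0: "p > 0" using p by simp
  obtain U :: "complex \<Rightarrow> complex \<Rightarrow> real" where U: "U 0 0 = 0"
    "\<And>x y h k. cmod h = cmod k \<Longrightarrow> U (x + h) (y + k) + U (x - h) (y - k) \<le> 2 * U x y"
    "\<And>x y. cmod y powr p - (max p q - 1) powr p * cmod x powr p \<le> U x y"
    by (rule burkholder_function_exists[OF p q]) (rule that, assumption, simp_all)
  define f g where "f = (\<lambda>x. \<Sum>i\<in>F. c i * complex_of_real (haar i x))"
    and "g = (\<lambda>x. \<Sum>i\<in>F. \<sigma> i * c i * complex_of_real (haar i x))"
  have L: "f \<in> Lp_space p" "g \<in> Lp_space p"
    using haar_sum_Lp[OF p0, of c F] haar_sum_Lp[OF p0, of "\<lambda>i. \<sigma> i * c i" F] by (simp_all add: f_def g_def)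
  note int = Lp_space_integrable[OF L(1)] Lp_space_integrable[OF L(2)]
  have Z: "integrable lborel (\<lambda>x. U (f x) (g x))" "(\<integral>x. U (f x) (g x) \<partial>lborel) \<le> 0"
    unfolding f_def g_def using zigzag_integral_nonpos[where U = U, OF U(1) U(2) F \<sigma>] by auto
  have "(\<integral>x. norm (g x) powr p \<partial>lborel) - C powr p * (\<integral>x. norm (f x) powr p \<partial>lborel)
    = (\<integral>x. norm (g x) powr p - C powr p * norm (f x) powr p \<partial>lborel)"
    using int by simp
  also have "\<dots> \<le> (\<integral>x. U (f x) (g x) \<partial>lborel)"
    by (rule integral_mono[OF _ Z(1) U(3)[folded C_def]]) (use int in simp)
  also note Z(2)
  finally have "(\<integral>x. norm (g x) powr p \<partial>lborel) \<le> (C * Lp_norm p f) powr p"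
    using C by (simp add: powr_mult Lp_norm_nonneg Lp_norm_powr[OF p0])
  then show ?thesis
    using C by (subst (asm) Lp_norm_le_iff[OF p0, symmetric]) (simp_all add: Lp_norm_nonneg f_def g_def C_def)
qed

subsection \<open>Orthonormality\<close>

lemma integrable_haar: "integrable lborel (haar i)"
  unfolding haar_def by (intro Bochner_Integration.integrable_diff integrable_divide integrable_half)

lemma integral_haar:
  assumes "i \<in> nodes"
  shows "(\<integral>x. haar i x \<partial>lborel) = 0"
proof -
  have "snd i \<in> range (B (fst i))" using assms by (auto simp: nodes_def)
  then show ?thesis unfolding haar_def using integrable_half by (simp add: measure_half)
qed

text \<open>For different nodes the factor of the coarser or equal generation is constant on the
  cell of the other one. The product is then a multiple of that other function, whose integral is
  0.\<close>

lemma haar_orthonormal: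
  assumes "i \<in> nodes" "j \<in> nodes"
  shows "integrable lborel (\<lambda>x. haar i x * haar j x)"
    and "(\<integral>x. haar i x * haar j x \<partial>lborel) = (if i = j then 1 else 0)"
proof -
  have eq: "(\<lambda>x. haar i x * haar i x) = (\<lambda>x. (indicator (half (fst i) (snd i) True) x + indicator (half (fst i) (snd i) False) x) / vol (fst i))"
    if "i \<in> nodes" for i
    using vol_pos[of "fst i"] by (auto simp: haar_def half_def indicator_def)
  have ne: "\<exists>v. (\<lambda>x. haar i x * haar j x) = (\<lambda>x. v * haar i x)"
    if ij: "i \<noteq> j" "i \<in> nodes" "fst i \<le> fst j" for i j
  proof -
    obtain t a where i: "i = (t, a)" by (cases i)
    then obtain z where z: "z \<in> cell t a" using ij(2) by (auto simp: nodes_def cell_def)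
    have "haar i x * haar j x = haar j z * haar i x" for x
    proof (cases "x \<in> cell t a")
      case True
      have "haar j x = haar j z"
        by (rule haar_constant[OF _ _ True z]) (use ij i in auto)
      then show ?thesis by simp
    next
      case False
      then show ?thesis by (simp add: i haar_alt cell_def)
    qed
    then show ?thesis by blast
  qed
  have "integrable lborel (\<lambda>x. haar i x * haar j x) \<and> (\<integral>x. haar i x * haar j x \<partial>lborel) = (if i = j then 1 else 0)"
  proof (cases "i = j")
    case True
    have a: "snd i \<in> range (B (fst i))" using assms by (auto simp: nodes_def)
    have "integrable lborel (\<lambda>x. haar i x * haar i x) \<and> (\<integral>x. haar i x * haar i x \<partial>lborel) = 1"
      unfolding eq[OF assms(1)] using integrable_half vol_pos[of "fst i"]
      by (simp add: measure_half[OF a] add_divide_distrib[symmetric])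
    then show ?thesis using True by simp
  next
    case False
    show ?thesis
    proof (cases "fst i \<le> fst j")
      case True
      from ne[OF False assms(1) True] obtain v where v: "(\<lambda>x. haar i x * haar j x) = (\<lambda>x. v * haar i x)" ..
      show ?thesis unfolding v using False integrable_haar integral_haar[OF assms(1)] by simp
    next
      case le: False
      then obtain v where v: "(\<lambda>x. haar j x * haar i x) = (\<lambda>x. v * haar j x)"
        using ne[of j i] False assms(2) by auto
      have "(\<lambda>x. haar i x * haar j x) = (\<lambda>x. v * haar j x)" using v by (simp add: mult.commute)
      then show ?thesis using False integrable_haar integral_haar[OF assms(2)] by simp
    qed
  qed
  then show "integrable lborel (\<lambda>x. haar i x * haar j x)"
    "(\<integral>x. haar i x * haar j x \<partial>lborel) = (if i = j then 1 else 0)" by auto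
qed

end


section \<open>Approximation by finite Haar sums\<close>

lemma sum_telescope_int:
  fixes G :: "int \<Rightarrow> 'b::ab_group_add"
  assumes "a \<le> b"
  shows "(\<Sum>t\<in>{a + 1..b}. G (t - 1) - G t) = G a - G b"
  using assms
proof (induction b rule: int_ge_induct)
  case (step b)
  have "{a + 1..b + 1} = insert (b + 1) {a + 1..b}" using step.hyps by auto
  then show ?case using step by simp
qed simp

context binary_filtration
begin

definition coeff :: "('a \<Rightarrow> complex) \<Rightarrow> int \<times> 'm \<Rightarrow> complex" where
  "coeff f i = (\<integral>y. f y * complex_of_real (haar i y) \<partial>lborel)"

definition avg :: "('a \<Rightarrow> complex) \<Rightarrow> int \<Rightarrow> 'a \<Rightarrow> complex" where
  "avg f t x = (\<integral>y. indicator (cell t (B t x)) y *\<^sub>R f y \<partial>lborel) / complex_of_real (vol t)"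

text \<open>Generations start at \<open>- int N + 1\<close> because a Haar function of generation
  \<open>t\<close> records the passage from averages at \<open>t\<close> to averages at
  \<open>t - 1\<close>; the sum over the window telescopes to averages at \<open>- int N\<close> and
  \<open>int N\<close>. Cells that miss the ball contribute nothing when the ball contains the
  support.\<close>

definition window :: "real \<Rightarrow> nat \<Rightarrow> (int \<times> 'm) set" where
  "window R N = (SIGMA t:{- int N + 1..int N}. B t ` cball 0 R)"

lemma measure_cell: "a \<in> range (B t) \<Longrightarrow> measure lborel (cell t a) = vol t"
  using emeasure_cell[of a t] vol_pos[of t] by (simp add: measure_def)

text \<open>A packing argument: the cells of one generation are disjoint and of equal measure, and
  those meeting \<open>S\<close> lie in one ball of finite measure.\<close>

lemma finite_cells_meeting:
  assumes "bounded S"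
  shows "finite (B t ` S)"
proof -
  obtain C where C: "\<And>x y. B t x = B t y \<Longrightarrow> dist x y \<le> C" using cells_bounded[of t] by auto
  obtain r where r: "\<And>x. x \<in> S \<Longrightarrow> norm x \<le> r" using assms by (auto simp: bounded_iff)
  define M where "M = measure lborel (cball 0 (r + C) :: 'a set)"
  have "finite (B t ` S) \<and> card (B t ` S) \<le> nat \<lceil>M / vol t\<rceil>"
  proof (rule finite_if_finite_subsets_card_bdd)
    fix T assume T: "T \<subseteq> B t ` S" "finite T"
    have sub: "(\<Union>a\<in>T. cell t a) \<subseteq> cball 0 (r + C)"
    proof
      fix x assume "x \<in> (\<Union>a\<in>T. cell t a)"
      then obtain y where y: "y \<in> S" "B t x = B t y" using T by (auto simp: cell_def)
      have "norm x \<le> norm y + dist x y" using norm_triangle_sub[of x y] by (simp add: dist_norm)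
      then show "x \<in> cball 0 (r + C)" using C[OF y(2)] r[OF y(1)] by simp
    qed
    have fin: "a \<in> T \<Longrightarrow> emeasure lborel (cell t a) \<noteq> \<infinity>" for a
      using emeasure_cell[of a t] T by auto
    have "real (card T) * vol t = (\<Sum>a\<in>T. measure lborel (cell t a))"
      using T measure_cell by (subst sum.cong[OF refl, of _ _ "\<lambda>_. vol t"]) auto
    also have "\<dots> = measure lborel (\<Union>a\<in>T. cell t a)"
      by (rule measure_finite_Union[symmetric]) (use T fin measurable_cell in \<open>auto simp: disjoint_family_on_def cell_def\<close>)
    also have "\<dots> \<le> M" unfolding M_def
      by (rule measure_mono_fmeasurable[OF sub])
        (use T in \<open>auto intro!: measurable_cell fmeasurableI emeasure_bounded_finite sets.finite_UN\<close>)
    finally have "real (card T) \<le> M / vol t" using vol_pos[of t] by (simp add: field_simps)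
    then show "card T \<le> nat \<lceil>M / vol t\<rceil>" by linarith
  qed
  then show ?thesis ..
qed

lemma window_finite: "finite (window R N)"
  unfolding window_def by (intro finite_SigmaI finite_cells_meeting) auto

lemma window_nodes: "window R N \<subseteq> nodes"
  by (auto simp: window_def nodes_def)

context
  fixes f :: "'a \<Rightarrow> complex" and R :: real
  assumes f: "f \<in> test_functions" and R: "R > 0"
    and bf: "\<And>x. norm (f x) \<le> R * indicator (cball 0 R) x"
begin

lemma f_meas [measurable]: "f \<in> borel_measurable borel"
  using f by (rule test_function_measurable)

lemma f_int: "integrable lborel f"
  using test_function_Lp[OF f, of 1] integrable_norm_cancel[of lborel f] by (simp add: Lp_space_def)

lemma f_int_ind: "A \<in> sets borel \<Longrightarrow> integrable lborel (\<lambda>y. indicator A y *\<^sub>R f y)"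
  by (rule integrable_mult_indicator[OF _ f_int]) simp

lemma f_zero: "x \<notin> cball 0 R \<Longrightarrow> f x = 0"
  using bf[of x] by simp

lemma coeff_zero: "a \<notin> B t ` cball 0 R \<Longrightarrow> coeff f (t, a) = 0"
proof -
  assume a: "a \<notin> B t ` cball 0 R"
  have "f y * complex_of_real (haar (t, a) y) = 0" for y
    using a f_zero[of y] by (cases "y \<in> cball 0 R") (auto simp: haar_alt)
  then have "(\<lambda>y. f y * complex_of_real (haar (t, a) y)) = (\<lambda>_. 0)" by (rule ext)
  then show ?thesis unfolding coeff_def by (simp only: Bochner_Integration.integral_zero)
qed

lemma avg_split:
  "avg f t x = ((\<integral>y. indicator (half t (B t x) True) y *\<^sub>R f y \<partial>lborel)
      + (\<integral>y. indicator (half t (B t x) False) y *\<^sub>R f y \<partial>lborel)) / complex_of_real (vol t)"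
proof -
  have "indicator (cell t (B t x)) y *\<^sub>R f y = indicator (half t (B t x) True) y *\<^sub>R f y
      + indicator (half t (B t x) False) y *\<^sub>R f y" for y
    by (auto simp: cell_def half_def indicator_def)
  then show ?thesis unfolding avg_def
    by (simp add: Bochner_Integration.integral_add f_int_ind measurable_half)
qed

text \<open>A Haar term is a martingale difference: the half selected by \<open>bit t x\<close> is
  the next cell of \<open>x\<close>, and the average over it is twice the integral divided by
  \<open>vol t\<close>.\<close>

lemma haar_term:
  "coeff f (t, B t x) * complex_of_real (haar (t, B t x) x) = avg f (t - 1) x - avg f t x"
proof -
  define J where "J b = (\<integral>y. indicator (half t (B t x) b) y *\<^sub>R f y \<partial>lborel)" for b
  have v: "complex_of_real (sqrt (vol t)) * complex_of_real (sqrt (vol t)) = complex_of_real (vol t)"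
    "complex_of_real (vol t) \<noteq> 0"
    using vol_pos[of t] by (simp_all flip: of_real_mult)
  have "f y * complex_of_real (haar (t, B t x) y) = (indicator (half t (B t x) True) y *\<^sub>R f y
      - indicator (half t (B t x) False) y *\<^sub>R f y) / complex_of_real (sqrt (vol t))" for y
    by (simp add: haar_def scaleR_conv_of_real algebra_simps diff_divide_distrib)
  then have c: "coeff f (t, B t x) = (J True - J False) / complex_of_real (sqrt (vol t))"
    unfolding coeff_def J_def by (simp add: f_int_ind measurable_half)
  have "half t (B t x) (bit t x) = cell (t - 1) (B (t - 1) x)"
    unfolding half_def cell_def using refine[of t _ x] by auto
  then have a1: "avg f (t - 1) x = 2 * J (bit t x) / complex_of_real (vol t)"
    unfolding avg_def J_def by (simp add: vol_minus_1)
  have "coeff f (t, B t x) * complex_of_real (haar (t, B t x) x)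
      = (J True - J False) * (if bit t x then 1 else - 1) / complex_of_real (vol t)"
    unfolding c haar_alt using v by (simp add: field_simps)
  also have "\<dots> = avg f (t - 1) x - avg f t x"
    unfolding a1 avg_split[of t x] J_def[symmetric] by (cases "bit t x") (simp_all add: diff_divide_distrib[symmetric])
  finally show ?thesis .
qed

lemma window_sum:
  "(\<Sum>i\<in>window R N. coeff f i * complex_of_real (haar i x)) = avg f (- int N) x - avg f (int N) x"
proof -
  have "(\<Sum>i\<in>window R N. coeff f i * complex_of_real (haar i x))
     = (\<Sum>t\<in>{- int N + 1..int N}. \<Sum>a\<in>B t ` cball 0 R. coeff f (t, a) * complex_of_real (haar (t, a) x))"
    unfolding window_def by (subst sum.Sigma) (auto intro: finite_cells_meeting simp: case_prod_unfold)
  also have "\<dots> = (\<Sum>t\<in>{- int N + 1..int N}. avg f (t - 1) x - avg f t x)"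
  proof (rule sum.cong[OF refl])
    fix t
    have "(\<Sum>a\<in>B t ` cball 0 R. coeff f (t, a) * complex_of_real (haar (t, a) x))
       = (\<Sum>a\<in>B t ` cball 0 R. if B t x = a then coeff f (t, a) * complex_of_real (haar (t, a) x) else 0)"
      by (rule sum.cong) (auto simp: haar_alt)
    also have "\<dots> = coeff f (t, B t x) * complex_of_real (haar (t, B t x) x)"
      using coeff_zero[of "B t x" t] by (subst sum.delta'[OF finite_cells_meeting[OF bounded_cball]]) auto
    finally show "(\<Sum>a\<in>B t ` cball 0 R. coeff f (t, a) * complex_of_real (haar (t, a) x))
       = avg f (t - 1) x - avg f t x"
      by (simp only: haar_term)
  qed
  also have "\<dots> = avg f (- int N) x - avg f (int N) x"
    by (rule sum_telescope_int) simp
  finally show ?thesis .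
qed

lemma avg_alt:
  "avg f t x = (\<Sum>a\<in>B t ` cball 0 R. indicator (cell t a) x *\<^sub>R
      ((\<integral>y. indicator (cell t a) y *\<^sub>R f y \<partial>lborel) / complex_of_real (vol t)))"
proof -
  define J where "J a = (\<integral>y. indicator (cell t a) y *\<^sub>R f y \<partial>lborel) / complex_of_real (vol t)" for a
  have "J a = 0" if "a \<notin> B t ` cball 0 R" for a
  proof -
    have "indicator (cell t a) y *\<^sub>R f y = 0" for y
      using that f_zero[of y] by (cases "y \<in> cball 0 R") (auto simp: cell_def indicator_def)
    then have "(\<lambda>y. indicator (cell t a) y *\<^sub>R f y) = (\<lambda>_. 0)" by (rule ext)
    then show ?thesis unfolding J_def by (simp only: Bochner_Integration.integral_zero div_0)
  qed
  then have "avg f t x = (\<Sum>a\<in>B t ` cball 0 R. if B t x = a then J a else 0)"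
    by (subst sum.delta'[OF finite_cells_meeting[OF bounded_cball]]) (auto simp: avg_def J_def)
  also have "\<dots> = (\<Sum>a\<in>B t ` cball 0 R. indicator (cell t a) x *\<^sub>R J a)"
    by (rule sum.cong) (auto simp: cell_def indicator_def)
  finally show ?thesis by (simp add: J_def)
qed

lemma avg_measurable [measurable]: "avg f t \<in> borel_measurable borel"
proof -
  have [measurable]: "cell t a \<in> sets borel" for a by (rule measurable_cell)
  have "avg f t = (\<lambda>x. \<Sum>a\<in>B t ` cball 0 R. indicator (cell t a) x *\<^sub>R
      ((\<integral>y. indicator (cell t a) y *\<^sub>R f y \<partial>lborel) / complex_of_real (vol t)))"
    by (rule ext) (rule avg_alt)
  then show ?thesis by simp
qed

lemma integrable_cell: "integrable lborel (indicator (cell t a) :: 'a \<Rightarrow> real)"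
  by (intro integrable_real_indicator emeasure_bounded_finite bounded_cell) (simp add: measurable_cell)

lemma avg_diff_le:
  assumes e: "\<And>y. B t y = B t x \<Longrightarrow> norm (f y - c) \<le> e"
  shows "norm (avg f t x - c) \<le> e"
proof -
  let ?A = "cell t (B t x)"
  have m: "measure lborel ?A = vol t" by (simp add: measure_cell)
  have ic: "integrable lborel (\<lambda>y. indicator ?A y *\<^sub>R c)"
    using integrable_cell[of t "B t x"] by (rule integrable_scaleR_left)
  have ie: "integrable lborel (\<lambda>y. indicator ?A y * e)"
    using integrable_cell[of t "B t x"] by (rule integrable_mult_left)
  have "(\<integral>y. indicator ?A y *\<^sub>R f y \<partial>lborel) - vol t *\<^sub>R c = (\<integral>y. indicator ?A y *\<^sub>R f y - indicator ?A y *\<^sub>R c \<partial>lborel)"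
    using ic integrable_cell[of t "B t x"] by (simp add: f_int_ind measurable_cell m)
  also have "norm \<dots> \<le> (\<integral>y. indicator ?A y * e \<partial>lborel)"
  proof (rule order_trans[OF integral_norm_bound integral_mono[OF _ ie]])
    show "integrable lborel (\<lambda>y. norm (indicator ?A y *\<^sub>R f y - indicator ?A y *\<^sub>R c))"
      by (intro integrable_norm Bochner_Integration.integrable_diff ic f_int_ind measurable_cell)
    show "norm (indicator ?A y *\<^sub>R f y - indicator ?A y *\<^sub>R c) \<le> indicator ?A y * e" for y
      using e[of y] by (auto simp: indicator_def cell_def)
  qed
  also have "\<dots> = vol t * e" by (simp add: m)
  finally have "norm ((\<integral>y. indicator ?A y *\<^sub>R f y \<partial>lborel) - vol t *\<^sub>R c) \<le> vol t * e" .
  moreover have "avg f t x - c = ((\<integral>y. indicator ?A y *\<^sub>R f y \<partial>lborel) - vol t *\<^sub>R c) / complex_of_real (vol t)"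
    using vol_pos[of t] by (simp add: avg_def scaleR_conv_of_real diff_divide_distrib)
  ultimately show ?thesis
    using vol_pos[of t] by (simp add: norm_divide pos_divide_le_eq mult.commute)
qed

section \<open>Limits of the averages\<close>

lemma avg_fine_limit:
  assumes p: "p > 0"
  shows "(\<lambda>n. Lp_norm p (\<lambda>x. avg f (- int n) x - f x)) \<longlonglongrightarrow> 0"
proof -
  obtain t1 where t1: "\<And>t x y. t \<le> t1 \<Longrightarrow> B t x = B t y \<Longrightarrow> dist x y < 1"
    using cells_small[of 1] by auto
  \<comment> \<open>From this index on, points of one cell are less than 1 apart, so all averages
    vanish outside the ball of radius \<open>R + 1\<close> and have a common majorant.\<close>
  define n0 where "n0 = nat (- t1)"
  have shift: "- int (n + n0) \<le> t1" for n by (simp add: n0_def)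
  have "(\<lambda>n. Lp_norm p (\<lambda>x. avg f (- int (n + n0)) x - f x)) \<longlonglongrightarrow> 0"
  proof (rule Lp_dominated_convergence[OF p, where W = "\<lambda>x. R * indicator (cball 0 (R + 1)) x"])
    show "norm (avg f (- int (n + n0)) x) \<le> R * indicator (cball 0 (R + 1)) x" for n x
    proof -
      have "norm (f y - 0) \<le> R * indicator (cball 0 (R + 1)) x"
        if "B (- int (n + n0)) y = B (- int (n + n0)) x" for y
      proof (cases "y \<in> cball 0 R")
        case True
        have "norm x \<le> norm y + dist y x" using norm_triangle_sub[of x y] by (simp add: dist_norm norm_minus_commute)
        then have "x \<in> cball 0 (R + 1)" using t1[OF shift that] True by simp
        then show ?thesis using bf[of y] True by simp
      next
        case False
        then show ?thesis using f_zero[OF False] R by simp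
      qed
      from avg_diff_le[OF this] show ?thesis by simp
    qed
    show "norm (f x) \<le> R * indicator (cball 0 (R + 1)) x" for x
      by (rule order_trans[OF bf mult_left_mono]) (use R in \<open>auto simp: indicator_def\<close>)
    show "AE x in lborel. (\<lambda>n. avg f (- int (n + n0)) x) \<longlonglongrightarrow> f x"
    proof (rule AE_I2, rule LIMSEQ_I)
      fix x and e :: real assume e: "e > 0"
      have "continuous (at x) f"
        using f by (simp add: test_functions_def continuous_on_eq_continuous_at)
      then obtain d where d: "d > 0" "\<And>y. dist y x < d \<Longrightarrow> dist (f y) (f x) < e / 2"
        unfolding continuous_at_eps_delta using e by (metis half_gt_zero)
      obtain t2 where t2: "\<And>t x y. t \<le> t2 \<Longrightarrow> B t x = B t y \<Longrightarrow> dist x y < d"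
        using cells_small[OF d(1)] by auto
      show "\<exists>no. \<forall>n\<ge>no. norm (avg f (- int (n + n0)) x - f x) < e"
      proof (intro exI allI impI)
        fix n assume n: "n \<ge> nat (- t2)"
        have "norm (avg f (- int (n + n0)) x - f x) \<le> e / 2"
        proof (rule avg_diff_le)
          fix y assume "B (- int (n + n0)) y = B (- int (n + n0)) x"
          then have "dist y x < d" by (rule t2[rotated]) (use n in auto)
          then show "norm (f y - f x) \<le> e / 2" using d(2)[of y] by (simp add: dist_norm)
        qed
        then show "norm (avg f (- int (n + n0)) x - f x) < e" using e by linarith
      qed
    qed
  qed (auto intro: integrable_powr_ball)
  then show ?thesis by (rule LIMSEQ_offset)
qed

lemma avg_Lp: "p > 0 \<Longrightarrow> avg f t \<in> Lp_space p"
proof -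
  assume p: "p > 0"
  have "(\<lambda>x. complex_of_real (indicator (cell t a) x)) \<in> Lp_space p" for a
  proof -
    obtain r where r: "r > 0" "cell t a \<subseteq> cball 0 r" by (rule cell_subset_cball)
    show ?thesis
    proof (rule compactly_supported_Lp[OF p, where R = "max 1 r"])
      have [measurable]: "cell t a \<in> sets borel" by (rule measurable_cell)
      show "(\<lambda>x. complex_of_real (indicator (cell t a) x)) \<in> borel_measurable borel" by measurable
      show "norm (complex_of_real (indicator (cell t a) x)) \<le> max 1 r * indicator (cball 0 (max 1 r)) x" for x
        using r(2) by (cases "x \<in> cell t a") (auto simp: subset_iff)
    qed
  qed
  then have "(\<lambda>x. \<Sum>a\<in>B t ` cball 0 R. ((\<integral>y. indicator (cell t a) y *\<^sub>R f y \<partial>lborel) / complex_of_real (vol t))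
      * complex_of_real (indicator (cell t a) x)) \<in> Lp_space p"
    by (intro Lp_space_sum[OF p] Lp_space_cmult[OF p])
  moreover have "avg f t = (\<lambda>x. \<Sum>a\<in>B t ` cball 0 R. ((\<integral>y. indicator (cell t a) y *\<^sub>R f y \<partial>lborel) / complex_of_real (vol t))
      * complex_of_real (indicator (cell t a) x))"
    by (rule ext, subst avg_alt) (simp add: scaleR_conv_of_real mult.commute)
  ultimately show ?thesis by (simp only:)
qed

lemma avg_L1: "(\<integral>x. norm (avg f t x) \<partial>lborel) \<le> (\<integral>x. norm (f x) \<partial>lborel)"
proof -
  define J where "J a = (\<integral>y. indicator (cell t a) y *\<^sub>R f y \<partial>lborel) / complex_of_real (vol t)" for a
  have fin: "finite (B t ` cball 0 R)" by (rule finite_cells_meeting) simp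
  have "(\<integral>x. norm (avg f t x) \<partial>lborel) \<le> (\<integral>x. (\<Sum>a\<in>B t ` cball 0 R. indicator (cell t a) x * norm (J a)) \<partial>lborel)"
  proof (rule integral_mono)
    show "integrable lborel (\<lambda>x. norm (avg f t x))" using Lp_space_integrable[OF avg_Lp[of 1 t]] by simp
    show "norm (avg f t x) \<le> (\<Sum>a\<in>B t ` cball 0 R. indicator (cell t a) x * norm (J a))" for x
      unfolding avg_alt J_def[symmetric] by (rule order_trans[OF norm_sum]) (simp add: sum_mono)
  qed (use integrable_cell in auto)
  also have "\<dots> = (\<Sum>a\<in>B t ` cball 0 R. vol t * norm (J a))"
    using integrable_cell by (subst Bochner_Integration.integral_sum) (auto simp: measure_cell intro!: sum.cong)
  also have "\<dots> \<le> (\<Sum>a\<in>B t ` cball 0 R. \<integral>y. indicator (cell t a) y * norm (f y) \<partial>lborel)"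
  proof (rule sum_mono)
    fix a
    have "vol t * norm (J a) = norm (\<integral>y. indicator (cell t a) y *\<^sub>R f y \<partial>lborel)"
      using vol_pos[of t] by (simp add: J_def norm_divide)
    also have "\<dots> \<le> (\<integral>y. norm (indicator (cell t a) y *\<^sub>R f y) \<partial>lborel)" by (rule integral_norm_bound)
    finally show "vol t * norm (J a) \<le> (\<integral>y. indicator (cell t a) y * norm (f y) \<partial>lborel)" by simp
  qed
  also have "\<dots> = (\<integral>y. (\<Sum>a\<in>B t ` cball 0 R. indicator (cell t a) y * norm (f y)) \<partial>lborel)"
    using integrable_norm[OF f_int_ind[OF measurable_cell]] by (subst Bochner_Integration.integral_sum) auto
  also have "\<dots> \<le> (\<integral>y. norm (f y) \<partial>lborel)"
  proof (rule integral_mono)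
    show "integrable lborel (\<lambda>y. \<Sum>a\<in>B t ` cball 0 R. indicator (cell t a) y * norm (f y))"
      using integrable_norm[OF f_int_ind[OF measurable_cell]] by (intro Bochner_Integration.integrable_sum) simp
    show "integrable lborel (\<lambda>y. norm (f y))" using f_int by (rule integrable_norm)
    fix y
    have "(\<Sum>a\<in>B t ` cball 0 R. indicator (cell t a) y * norm (f y))
        = (\<Sum>a\<in>B t ` cball 0 R. if B t y = a then norm (f y) else 0)"
      by (rule sum.cong) (auto simp: cell_def indicator_def)
    also have "\<dots> \<le> norm (f y)" by (subst sum.delta'[OF fin]) auto
    finally show "(\<Sum>a\<in>B t ` cball 0 R. indicator (cell t a) y * norm (f y)) \<le> norm (f y)" .
  qed
  finally show ?thesis .
qed

text \<open>Averages are bounded pointwise by \<open>n1 / vol t\<close> and in L^1 by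
  \<open>n1\<close>. Splitting the \<open>p\<close>-th power into exponents \<open>p - 1\<close> and
  \<open>1\<close> bounds its integral by \<open>(n1 / vol t) powr (p - 1) * n1\<close>, which tends
  to 0 because \<open>p > 1\<close>.\<close>

lemma avg_coarse_limit:
  assumes p: "p > 1"
  shows "(\<lambda>n. Lp_norm p (avg f (int n))) \<longlonglongrightarrow> 0"
proof -
  define n1 where "n1 = (\<integral>x. norm (f x) \<partial>lborel)"
  have n1: "n1 \<ge> 0" unfolding n1_def by (rule integral_nonneg_AE) auto
  have pt: "norm (avg f t x) \<le> n1 / vol t" for t x
  proof -
    have "norm (\<integral>y. indicator (cell t (B t x)) y *\<^sub>R f y \<partial>lborel) \<le> (\<integral>y. norm (indicator (cell t (B t x)) y *\<^sub>R f y) \<partial>lborel)"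
      by (rule integral_norm_bound)
    also have "\<dots> \<le> n1" unfolding n1_def
      by (rule integral_mono[OF integrable_norm[OF f_int_ind[OF measurable_cell]] integrable_norm[OF f_int]])
        (auto simp: indicator_def)
    finally show ?thesis using vol_pos[of t] by (simp add: avg_def norm_divide divide_right_mono)
  qed
  have bound: "(\<integral>x. norm (avg f t x) powr p \<partial>lborel) \<le> (n1 / vol t) powr (p - 1) * n1" for t
  proof -
    have i1: "integrable lborel (\<lambda>x. norm (avg f t x))" using Lp_space_integrable[OF avg_Lp[of 1 t]] by simp
    have "(\<integral>x. norm (avg f t x) powr p \<partial>lborel) \<le> (\<integral>x. (n1 / vol t) powr (p - 1) * norm (avg f t x) \<partial>lborel)"
    proof (rule integral_mono)
      show "integrable lborel (\<lambda>x. norm (avg f t x) powr p)" using p by (intro Lp_space_integrable avg_Lp) simp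
      show "integrable lborel (\<lambda>x. (n1 / vol t) powr (p - 1) * norm (avg f t x))" using i1 by simp
      fix x
      have "norm (avg f t x) powr p = norm (avg f t x) powr (p - 1) * norm (avg f t x)"
        by (cases "avg f t x = 0") (simp_all add: powr_diff)
      also have "\<dots> \<le> (n1 / vol t) powr (p - 1) * norm (avg f t x)"
        using p pt[of t x] by (intro mult_right_mono powr_mono2) auto
      finally show "norm (avg f t x) powr p \<le> (n1 / vol t) powr (p - 1) * norm (avg f t x)" .
    qed
    also have "\<dots> \<le> (n1 / vol t) powr (p - 1) * n1"
      using avg_L1[of t] i1 by (simp add: n1_def mult_left_mono)
    finally show ?thesis .
  qed
  have "(\<lambda>n. n1 / \<kappa> * (1 / 2) ^ n) \<longlonglongrightarrow> n1 / \<kappa> * 0"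
    by (intro tendsto_mult tendsto_const LIMSEQ_power_zero) simp
  then have v0: "(\<lambda>n. n1 / vol (int n)) \<longlonglongrightarrow> 0"
    using \<kappa>_pos by (simp add: vol_def power_int_def power_divide)
  have "(\<lambda>n. (n1 / vol (int n)) powr (p - 1) * n1) \<longlonglongrightarrow> 0 powr (p - 1) * n1"
    using p n1 vol_pos by (intro tendsto_mult tendsto_powr' v0 tendsto_const) (auto simp: less_imp_le)
  then have s0: "(\<lambda>n. (n1 / vol (int n)) powr (p - 1) * n1) \<longlonglongrightarrow> 0" by simp
  have "(\<lambda>n. \<integral>x. norm (avg f (int n) x) powr p \<partial>lborel) \<longlonglongrightarrow> 0"
    by (rule tendsto_sandwich[OF _ _ tendsto_const s0]) (use bound in \<open>auto intro!: always_eventually integral_nonneg_AE\<close>)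
  then have "(\<lambda>n. (\<integral>x. norm (avg f (int n) x) powr p \<partial>lborel) powr (1 / p)) \<longlonglongrightarrow> 0 powr (1 / p)"
    using p by (intro tendsto_powr' tendsto_const) auto
  then show ?thesis using p by (simp add: Lp_norm_def)
qed

lemma window_sum_limit:
  assumes p: "p > 1"
  shows "(\<lambda>n. Lp_norm p (\<lambda>x. (\<Sum>i\<in>window R n. coeff f i * complex_of_real (haar i x)) - f x)) \<longlonglongrightarrow> 0"
proof -
  have lim: "(\<lambda>n. Lp_norm p (\<lambda>x. avg f (- int n) x - f x) + Lp_norm p (avg f (int n))) \<longlonglongrightarrow> 0"
    using tendsto_add[OF avg_fine_limit avg_coarse_limit[OF p]] p by simp
  have fL: "f \<in> Lp_space p" using p by (intro test_function_Lp[OF f]) simp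
  show ?thesis
  proof (rule tendsto_sandwich[OF _ _ tendsto_const lim])
    have "Lp_norm p (\<lambda>x. (\<Sum>i\<in>window R n. coeff f i * complex_of_real (haar i x)) - f x)
       \<le> Lp_norm p (\<lambda>x. avg f (- int n) x - f x) + Lp_norm p (avg f (int n))" for n
    proof -
      have "(\<lambda>x. (\<Sum>i\<in>window R n. coeff f i * complex_of_real (haar i x)) - f x)
         = (\<lambda>x. (avg f (- int n) x - f x) + (- 1) * avg f (int n) x)"
        by (rule ext) (simp add: window_sum)
      moreover have "Lp_norm p (\<lambda>x. (avg f (- int n) x - f x) + (- 1) * avg f (int n) x)
         \<le> Lp_norm p (\<lambda>x. avg f (- int n) x - f x) + Lp_norm p (\<lambda>x. (- 1) * avg f (int n) x)"
        using p by (intro Lp_norm_triangle Lp_space_diff Lp_space_cmult avg_Lp fL) auto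
      moreover have "Lp_norm p (\<lambda>x. (- 1) * avg f (int n) x) = Lp_norm p (avg f (int n))"
        using Lp_norm_cmult[of p "- 1" "avg f (int n)"] p by simp
      ultimately show ?thesis by simp
    qed
    then show "\<forall>\<^sub>F n in sequentially. Lp_norm p (\<lambda>x. (\<Sum>i\<in>window R n. coeff f i * complex_of_real (haar i x)) - f x)
       \<le> Lp_norm p (\<lambda>x. avg f (- int n) x - f x) + Lp_norm p (avg f (int n))"
      by (intro always_eventually allI)
  qed (simp add: Lp_norm_nonneg)
qed

end

text \<open>One sequence of finite sets serves all exponents. This uniformity is what later allows
  limits in L^p and in L^2 to be compared.\<close>

proposition haar_approximation:
  assumes "f \<in> test_functions"
  obtains F :: "nat \<Rightarrow> (int \<times> 'm) set" where "\<And>n. finite (F n)" "\<And>n. F n \<subseteq> nodes"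
    "\<And>p. p > 1 \<Longrightarrow> (\<lambda>n. Lp_norm p (\<lambda>x. (\<Sum>i\<in>F n. coeff f i * complex_of_real (haar i x)) - f x)) \<longlonglongrightarrow> 0"
proof -
  obtain R where R: "R > 0" "\<And>x. norm (f x) \<le> R * indicator (cball 0 R) x"
    by (rule test_function_boundE[OF assms]) (rule that, assumption, simp)
  show ?thesis
    by (rule that[of "window R"]) (use window_finite window_nodes window_sum_limit[OF assms R] in auto)
qed

end


section \<open>The transforms as closed operators\<close>

context binary_filtration
begin

definition haar_sum :: "(int \<times> 'm \<Rightarrow> complex) \<Rightarrow> (int \<times> 'm) set \<Rightarrow> 'a \<Rightarrow> complex" where
  "haar_sum c F x = (\<Sum>i\<in>F. c i * complex_of_real (haar i x))"

definition transform_pairs ::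
  "(int \<times> 'm \<Rightarrow> complex) \<Rightarrow> (('a \<Rightarrow> complex) \<times> ('a \<Rightarrow> complex)) set" where
  "transform_pairs s = {(haar_sum c F, haar_sum (\<lambda>i. s i * c i) F) | c F. finite F \<and> F \<subseteq> nodes}"

text \<open>A relation rather than a function, since values are determined only almost everywhere
  and an element of L^p is approximated by many sequences of finite sums.\<close>

definition transform_graph ::
  "real \<Rightarrow> (int \<times> 'm \<Rightarrow> complex) \<Rightarrow> ('a \<Rightarrow> complex) \<Rightarrow> ('a \<Rightarrow> complex) \<Rightarrow> bool" where
  "transform_graph p s f g \<longleftrightarrow> f \<in> Lp_space p \<and> g \<in> Lp_space p \<and>
     (\<exists>u v. (\<forall>n::nat. (u n, v n) \<in> transform_pairs s) \<and>
        (\<lambda>n. Lp_norm p (\<lambda>x. u n x - f x)) \<longlonglongrightarrow> 0 \<and> (\<lambda>n. Lp_norm p (\<lambda>x. v n x - g x)) \<longlonglongrightarrow> 0)"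

lemma transform_pairsI:
  "finite F \<Longrightarrow> F \<subseteq> nodes \<Longrightarrow> (haar_sum c F, haar_sum (\<lambda>i. s i * c i) F) \<in> transform_pairs s"
  unfolding transform_pairs_def by blast

lemma haar_sum_in_Lp: "p > 0 \<Longrightarrow> haar_sum c F \<in> Lp_space p"
  using haar_sum_Lp[of p c F] by (simp add: haar_sum_def[abs_def])

lemma haar_sum_extend:
  assumes "finite F'" "F \<subseteq> F'"
  shows "haar_sum c F = haar_sum (\<lambda>i. if i \<in> F then c i else 0) F'"
proof
  fix x
  have "(\<Sum>i\<in>F. c i * complex_of_real (haar i x))
      = (\<Sum>i\<in>F'. (if i \<in> F then c i else 0) * complex_of_real (haar i x))"
    using assms by (intro sum.mono_neutral_cong_left) auto
  then show "haar_sum c F x = haar_sum (\<lambda>i. if i \<in> F then c i else 0) F' x"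
    by (simp add: haar_sum_def)
qed

section \<open>Linearity, boundedness and single-valuedness of the closure\<close>

lemma transform_pairs_add:
  assumes "(u, v) \<in> transform_pairs s" "(u', v') \<in> transform_pairs s"
  shows "(\<lambda>x. u x + u' x, \<lambda>x. v x + v' x) \<in> transform_pairs s"
proof -
  obtain c F where F: "finite F" "F \<subseteq> nodes" "u = haar_sum c F" "v = haar_sum (\<lambda>i. s i * c i) F"
    using assms(1) by (auto simp: transform_pairs_def)
  obtain c' F' where F': "finite F'" "F' \<subseteq> nodes" "u' = haar_sum c' F'" "v' = haar_sum (\<lambda>i. s i * c' i) F'"
    using assms(2) by (auto simp: transform_pairs_def)
  define G where "G = F \<union> F'"
  define d where "d i = (if i \<in> F then c i else 0) + (if i \<in> F' then c' i else 0)" for i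
  have G: "finite G" "F \<subseteq> G" "F' \<subseteq> G" "G \<subseteq> nodes" using F F' by (auto simp: G_def)
  have "u x + u' x = haar_sum d G x" for x
    unfolding F F' haar_sum_extend[OF G(1,2)] haar_sum_extend[OF G(1,3)] d_def
    by (simp add: haar_sum_def sum.distrib distrib_right)
  moreover have "v x + v' x = haar_sum (\<lambda>i. s i * d i) G x" for x
    unfolding F F' haar_sum_extend[OF G(1,2)] haar_sum_extend[OF G(1,3)] d_def
    unfolding haar_sum_def sum.distrib[symmetric] by (rule sum.cong) (auto simp: algebra_simps)
  ultimately show ?thesis
    using G unfolding transform_pairs_def by (auto intro!: exI[of _ d] exI[of _ G])
qed

lemma transform_pairs_cmult:
  assumes "(u, v) \<in> transform_pairs s"
  shows "(\<lambda>x. a * u x, \<lambda>x. a * v x) \<in> transform_pairs s"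
proof -
  obtain c F where F: "finite F" "F \<subseteq> nodes" "u = haar_sum c F" "v = haar_sum (\<lambda>i. s i * c i) F"
    using assms(1) by (auto simp: transform_pairs_def)
  have "(\<lambda>x. a * u x) = haar_sum (\<lambda>i. a * c i) F" "(\<lambda>x. a * v x) = haar_sum (\<lambda>i. s i * (a * c i)) F"
    by (auto simp: F haar_sum_def sum_distrib_left algebra_simps)
  then show ?thesis using F(1,2) unfolding transform_pairs_def by blast
qed

lemma transform_pairs_diff:
  assumes "(u, v) \<in> transform_pairs s" "(u', v') \<in> transform_pairs s"
  shows "(\<lambda>x. u x - u' x, \<lambda>x. v x - v' x) \<in> transform_pairs s"
  using transform_pairs_add[OF assms(1) transform_pairs_cmult[OF assms(2), of "- 1"]] by simp

lemma transform_pairs_Lp: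
  assumes "(u, v) \<in> transform_pairs s" "p > 0"
  shows "u \<in> Lp_space p" "v \<in> Lp_space p"
  using assms haar_sum_in_Lp by (auto simp: transform_pairs_def)

lemma transform_pairs_bound:
  assumes p: "1 < p" "1 / p + 1 / q = 1" and s: "\<And>i. i \<in> nodes \<Longrightarrow> cmod (s i) = 1"
    and uv: "(u, v) \<in> transform_pairs s"
  shows "Lp_norm p v \<le> (max p q - 1) * Lp_norm p u"
proof -
  obtain c F where F: "finite F" "F \<subseteq> nodes" "u = haar_sum c F" "v = haar_sum (\<lambda>i. s i * c i) F"
    using uv by (auto simp: transform_pairs_def)
  show ?thesis
    unfolding F(3,4) haar_sum_def[abs_def]
    by (rule finite_transform_bound[OF p F(1,2)]) (use s F(2) in auto)
qed

lemma Lp_norm_limit: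
  assumes p: "p \<ge> 1" and u: "\<And>n. u n \<in> Lp_space p" and f: "f \<in> Lp_space p"
    and lim: "(\<lambda>n. Lp_norm p (\<lambda>x. u n x - f x)) \<longlonglongrightarrow> 0"
  shows "(\<lambda>n. Lp_norm p (u n)) \<longlonglongrightarrow> Lp_norm p f"
proof -
  have "\<bar>Lp_norm p (u n) - Lp_norm p f\<bar> \<le> Lp_norm p (\<lambda>x. u n x - f x)" for n
    using Lp_norm_le_add_diff[OF p u f, of n] Lp_norm_le_add_diff[OF p f u, of n]
    by (simp add: Lp_norm_minus_commute[of p f "u n"])
  then have "(\<lambda>n. Lp_norm p (u n) - Lp_norm p f) \<longlonglongrightarrow> 0"
    by (intro Lim_null_comparison[OF _ lim] always_eventually) auto
  then show ?thesis by (simp add: LIM_zero_iff)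
qed

lemma transform_graph_bound:
  assumes p: "1 < p" "1 / p + 1 / q = 1" and s: "\<And>i. i \<in> nodes \<Longrightarrow> cmod (s i) = 1"
    and G: "transform_graph p s f g"
  shows "Lp_norm p g \<le> (max p q - 1) * Lp_norm p f"
proof -
  have p1: "p \<ge> 1" "p > 0" using p by auto
  obtain u v where uv: "\<And>n::nat. (u n, v n) \<in> transform_pairs s"
    "(\<lambda>n. Lp_norm p (\<lambda>x. u n x - f x)) \<longlonglongrightarrow> 0" "(\<lambda>n. Lp_norm p (\<lambda>x. v n x - g x)) \<longlonglongrightarrow> 0"
    and fg: "f \<in> Lp_space p" "g \<in> Lp_space p"
    using G by (auto simp: transform_graph_def)
  have "(\<lambda>n. Lp_norm p (u n)) \<longlonglongrightarrow> Lp_norm p f" "(\<lambda>n. Lp_norm p (v n)) \<longlonglongrightarrow> Lp_norm p g"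
    by (rule Lp_norm_limit[OF p1(1) transform_pairs_Lp(1)[OF uv(1) p1(2)] fg(1) uv(2)],
        rule Lp_norm_limit[OF p1(1) transform_pairs_Lp(2)[OF uv(1) p1(2)] fg(2) uv(3)])
  then show ?thesis
    by (intro LIMSEQ_le[OF _ tendsto_mult[OF tendsto_const]])
      (use transform_pairs_bound[OF p s uv(1)] in auto)
qed

lemma transform_graph_lin:
  assumes p: "1 < p" and G: "transform_graph p s f g" "transform_graph p s f' g'"
  shows "transform_graph p s (\<lambda>x. f x + a * f' x) (\<lambda>x. g x + a * g' x)"
proof -
  have p1: "p \<ge> 1" "p > 0" using p by auto
  obtain u v where uv: "\<And>n::nat. (u n, v n) \<in> transform_pairs s"
    "(\<lambda>n. Lp_norm p (\<lambda>x. u n x - f x)) \<longlonglongrightarrow> 0" "(\<lambda>n. Lp_norm p (\<lambda>x. v n x - g x)) \<longlonglongrightarrow> 0"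
    and fg: "f \<in> Lp_space p" "g \<in> Lp_space p"
    using G by (auto simp: transform_graph_def)
  obtain u' v' where uv': "\<And>n::nat. (u' n, v' n) \<in> transform_pairs s"
    "(\<lambda>n. Lp_norm p (\<lambda>x. u' n x - f' x)) \<longlonglongrightarrow> 0" "(\<lambda>n. Lp_norm p (\<lambda>x. v' n x - g' x)) \<longlonglongrightarrow> 0"
    and fg': "f' \<in> Lp_space p" "g' \<in> Lp_space p"
    using G by (auto simp: transform_graph_def)
  have lin: "(\<lambda>n. Lp_norm p (\<lambda>x. (w n x + a * w' n x) - (h x + a * h' x))) \<longlonglongrightarrow> 0"
    if w: "\<And>n. w n \<in> Lp_space p" "\<And>n. w' n \<in> Lp_space p" "h \<in> Lp_space p" "h' \<in> Lp_space p"
      "(\<lambda>n. Lp_norm p (\<lambda>x. w n x - h x)) \<longlonglongrightarrow> 0" "(\<lambda>n. Lp_norm p (\<lambda>x. w' n x - h' x)) \<longlonglongrightarrow> 0" for w w' h h'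
  proof -
    have l: "(\<lambda>n. Lp_norm p (\<lambda>x. w n x - h x) + cmod a * Lp_norm p (\<lambda>x. w' n x - h' x)) \<longlonglongrightarrow> 0"
      using tendsto_add[OF w(5) tendsto_mult[OF tendsto_const w(6)], of "cmod a"] by simp
    have "Lp_norm p (\<lambda>x. (w n x + a * w' n x) - (h x + a * h' x))
        \<le> Lp_norm p (\<lambda>x. w n x - h x) + cmod a * Lp_norm p (\<lambda>x. w' n x - h' x)" for n
    proof -
      have "(\<lambda>x. (w n x + a * w' n x) - (h x + a * h' x)) = (\<lambda>x. (w n x - h x) + a * (w' n x - h' x))"
        by (rule ext) (simp add: algebra_simps)
      then show ?thesis
        using Lp_norm_triangle[OF p1(1) Lp_space_diff[OF p1(2) w(1)[of n] w(3)] Lp_space_cmult[OF p1(2) Lp_space_diff[OF p1(2) w(2)[of n] w(4)], of a]]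
          Lp_norm_cmult[OF p1(2), of a "\<lambda>x. w' n x - h' x"] by simp
    qed
    then show ?thesis
      by (intro tendsto_sandwich[OF _ _ tendsto_const l] always_eventually allI) (simp_all add: Lp_norm_nonneg)
  qed
  note L = transform_pairs_Lp(1)[OF uv(1) p1(2)] transform_pairs_Lp(2)[OF uv(1) p1(2)]
    transform_pairs_Lp(1)[OF uv'(1) p1(2)] transform_pairs_Lp(2)[OF uv'(1) p1(2)]
  show ?thesis unfolding transform_graph_def
  proof (intro conjI exI allI)
    show "(\<lambda>x. f x + a * f' x) \<in> Lp_space p" "(\<lambda>x. g x + a * g' x) \<in> Lp_space p"
      using fg fg' p1 by (auto intro!: Lp_space_add Lp_space_cmult)
    show "(\<lambda>x. u n x + a * u' n x, \<lambda>x. v n x + a * v' n x) \<in> transform_pairs s" for n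
      by (rule transform_pairs_add[OF uv(1) transform_pairs_cmult[OF uv'(1)]])
    show "(\<lambda>n. Lp_norm p (\<lambda>x. (u n x + a * u' n x) - (f x + a * f' x))) \<longlonglongrightarrow> 0"
      by (rule lin[OF L(1,3) fg(1) fg'(1) uv(2) uv'(2)])
    show "(\<lambda>n. Lp_norm p (\<lambda>x. (v n x + a * v' n x) - (g x + a * g' x))) \<longlonglongrightarrow> 0"
      by (rule lin[OF L(2,4) fg(2) fg'(2) uv(3) uv'(3)])
  qed
qed

text \<open>By linearity two values at \<open>f\<close> differ by a value at 0, and the norm bound
  forces that value to have norm 0.\<close>

lemma transform_graph_unique:
  assumes p: "1 < p" and s: "\<And>i. i \<in> nodes \<Longrightarrow> cmod (s i) = 1"
    and G: "transform_graph p s f g" "transform_graph p s f g'"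
  shows "AE x in lborel. g x = g' x"
proof -
  define q where "q = p / (p - 1)"
  have q: "1 / p + 1 / q = 1" using p by (simp add: q_def field_simps)
  have "transform_graph p s (\<lambda>x. f x + (- 1) * f x) (\<lambda>x. g x + (- 1) * g' x)"
    by (rule transform_graph_lin[OF p G])
  from transform_graph_bound[OF p q s this]
  have "Lp_norm p (\<lambda>x. g x + (- 1) * g' x) = 0"
    using Lp_norm_nonneg[of p "\<lambda>x. g x + (- 1) * g' x"] by simp
  moreover have "(\<lambda>x. g x + (- 1) * g' x) \<in> Lp_space p"
    using transform_graph_lin[OF p G, of "- 1"] by (simp add: transform_graph_def)
  ultimately have "AE x in lborel. g x + (- 1) * g' x = 0"
    using p by (subst (asm) Lp_norm_eq_0_iff) auto
  then show ?thesis by simp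
qed

lemma Lp_convergent_imp_Cauchy:
  assumes p: "p \<ge> 1" and u: "\<And>n. u n \<in> Lp_space p" and f: "f \<in> Lp_space p"
    and lim: "(\<lambda>n. Lp_norm p (\<lambda>x. u n x - f x)) \<longlonglongrightarrow> 0" and e: "e > 0"
  shows "\<exists>N. \<forall>m\<ge>N. \<forall>n\<ge>N. Lp_norm p (\<lambda>x. u m x - u n x) < e"
proof -
  have "eventually (\<lambda>n. Lp_norm p (\<lambda>x. u n x - f x) < e / 2) sequentially"
    by (rule order_tendstoD(2)[OF lim]) (use e in simp)
  then obtain N where N: "\<And>n. n \<ge> N \<Longrightarrow> Lp_norm p (\<lambda>x. u n x - f x) < e / 2"
    by (auto simp: eventually_sequentially)
  have "Lp_norm p (\<lambda>x. u m x - u n x) < e" if "m \<ge> N" "n \<ge> N" for m n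
    using Lp_norm_triangle_diff[OF p u f u, of m n] N[OF that(1)] N[OF that(2)]
    by (simp add: Lp_norm_minus_commute[of p f "u n"])
  then show ?thesis by blast
qed

text \<open>The norm bound, applied to differences, turns a convergent sequence of finite sums into
  a Cauchy sequence of images; completeness supplies the limit.\<close>

lemma transform_pairs_convergent:
  assumes p: "1 < p" and s: "\<And>i. i \<in> nodes \<Longrightarrow> cmod (s i) = 1"
    and uv: "\<And>n::nat. (u n, v n) \<in> transform_pairs s" and f: "f \<in> Lp_space p"
    and lim: "(\<lambda>n. Lp_norm p (\<lambda>x. u n x - f x)) \<longlonglongrightarrow> 0"
  obtains g where "g \<in> Lp_space p" "(\<lambda>n. Lp_norm p (\<lambda>x. v n x - g x)) \<longlonglongrightarrow> 0"
    "transform_graph p s f g"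
proof -
  have p1: "p \<ge> 1" "p > 0" using p by auto
  define q where "q = p / (p - 1)"
  have q: "1 / p + 1 / q = 1" using p by (simp add: q_def field_simps)
  define C where "C = max p q - 1"
  have C: "C > 0" using p by (auto simp: C_def)
  note L = transform_pairs_Lp[OF uv p1(2)]
  have cauchy: "\<exists>N. \<forall>m\<ge>N. \<forall>n\<ge>N. Lp_norm p (\<lambda>x. v m x - v n x) < e" if e: "e > 0" for e
  proof -
    have "e / C > 0" using e C by simp
    from Lp_convergent_imp_Cauchy[OF p1(1) L(1) f lim this] obtain N
      where N: "\<And>m n. m \<ge> N \<Longrightarrow> n \<ge> N \<Longrightarrow> Lp_norm p (\<lambda>x. u m x - u n x) < e / C" by auto
    have "Lp_norm p (\<lambda>x. v m x - v n x) < e" if "m \<ge> N" "n \<ge> N" for m n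
    proof -
      have "Lp_norm p (\<lambda>x. v m x - v n x) \<le> C * Lp_norm p (\<lambda>x. u m x - u n x)"
        unfolding C_def by (rule transform_pairs_bound[OF p q s transform_pairs_diff[OF uv uv]])
      also have "\<dots> < C * (e / C)" using N[OF that] C by (intro mult_strict_left_mono) auto
      finally show ?thesis using C by simp
    qed
    then show ?thesis by blast
  qed
  obtain g where g: "g \<in> Lp_space p" "(\<lambda>n. Lp_norm p (\<lambda>x. v n x - g x)) \<longlonglongrightarrow> 0"
    by (rule Lp_complete[where f = v, OF p1(1) L(2) cauchy])
  then have "transform_graph p s f g"
    unfolding transform_graph_def using f uv lim by blast
  with g show ?thesis by (rule that)
qed

lemma transform_graph_finite:
  assumes "p > 0" "finite F" "F \<subseteq> nodes"
  shows "transform_graph p s (haar_sum c F) (haar_sum (\<lambda>i. s i * c i) F)"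
proof -
  have "(haar_sum c F, haar_sum (\<lambda>i. s i * c i) F) \<in> transform_pairs s"
    using assms by (auto simp: transform_pairs_def)
  then show ?thesis unfolding transform_graph_def
    using assms(1) haar_sum_in_Lp
    by (intro conjI exI[of _ "\<lambda>n. haar_sum c F"] exI[of _ "\<lambda>n. haar_sum (\<lambda>i. s i * c i) F"]) auto
qed

text \<open>Test functions are dense and are themselves limits of finite Haar sums, so every
  \<open>f\<close> is a limit of such sums.\<close>

lemma transform_graph_exists:
  assumes p: "1 < p" and s: "\<And>i. i \<in> nodes \<Longrightarrow> cmod (s i) = 1" and f: "f \<in> Lp_space p"
  obtains g where "transform_graph p s f g"
proof -
  have p1: "p \<ge> 1" "p > 0" using p by auto
  have "\<exists>uv \<in> transform_pairs s. Lp_norm p (\<lambda>x. fst uv x - f x) < 1 / real (Suc n)" for n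
  proof -
    have e: "1 / real (Suc n) / 2 > 0" by simp
    obtain h where h: "h \<in> test_functions" "Lp_norm p (\<lambda>x. h x - f x) < 1 / real (Suc n) / 2"
      by (rule test_functions_dense[OF p f e])
    obtain F :: "nat \<Rightarrow> (int \<times> 'm) set" where F: "\<And>n. finite (F n)" "\<And>n. F n \<subseteq> nodes"
      "\<And>p. p > 1 \<Longrightarrow> (\<lambda>n. Lp_norm p (\<lambda>x. (\<Sum>i\<in>F n. coeff h i * complex_of_real (haar i x)) - h x)) \<longlonglongrightarrow> 0"
      by (rule haar_approximation[OF h(1)]) blast
    have "eventually (\<lambda>k. Lp_norm p (\<lambda>x. haar_sum (coeff h) (F k) x - h x) < 1 / real (Suc n) / 2) sequentially"
      by (rule order_tendstoD(2)[OF F(3)[OF p, folded haar_sum_def]]) (rule e)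
    then obtain k where k: "Lp_norm p (\<lambda>x. haar_sum (coeff h) (F k) x - h x) < 1 / real (Suc n) / 2"
      by (auto simp: eventually_sequentially)
    have "Lp_norm p (\<lambda>x. haar_sum (coeff h) (F k) x - f x) < 1 / real (Suc n)"
      using Lp_norm_triangle_diff[OF p1(1) haar_sum_in_Lp[OF p1(2)] test_function_Lp[OF h(1) p1(2)] f, of "coeff h" "F k"]
        k h(2) by linarith
    moreover have "(haar_sum (coeff h) (F k), haar_sum (\<lambda>i. s i * coeff h i) (F k)) \<in> transform_pairs s"
      using F by (intro transform_pairsI)
    ultimately show ?thesis by (intro bexI) auto
  qed
  then obtain uv where uv: "\<And>n. uv n \<in> transform_pairs s" "\<And>n. Lp_norm p (\<lambda>x. fst (uv n) x - f x) < 1 / real (Suc n)"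
    by metis
  have "(\<lambda>n. 1 / real (Suc n)) \<longlonglongrightarrow> 0" using LIMSEQ_inverse_real_of_nat by (simp add: inverse_eq_divide)
  then have lim: "(\<lambda>n. Lp_norm p (\<lambda>x. fst (uv n) x - f x)) \<longlonglongrightarrow> 0"
    by (rule tendsto_sandwich[OF _ _ tendsto_const, rotated 2])
      (use uv(2) in \<open>auto intro!: always_eventually less_imp_le simp: Lp_norm_nonneg\<close>)
  have P: "(fst (uv n), snd (uv n)) \<in> transform_pairs s" for n using uv(1) by simp
  show ?thesis
    by (rule transform_pairs_convergent[OF p s P f lim]) (auto intro: that)
qed

end


section \<open>The lower bound\<close>

text \<open>\<open>reach p K x y v\<close>: some finite dyadic martingale started at \<open>x\<close> has a \<open>\<plusminus>1\<close>-transform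
  started at \<open>y\<close> for which the expectation of the final value of \<open>\<bar>y\<bar>\<^sup>p - K \<bar>x\<bar>\<^sup>p\<close> is \<open>v\<close>.\<close>

inductive reach :: "real \<Rightarrow> real \<Rightarrow> real \<Rightarrow> real \<Rightarrow> real \<Rightarrow> bool" for p K :: real where
  stop: "reach p K x y (\<bar>y\<bar> powr p - K * \<bar>x\<bar> powr p)"
| step: "\<bar>d\<bar> = \<bar>e\<bar> \<Longrightarrow> reach p K (x + d) (y + e) v \<Longrightarrow> reach p K (x - d) (y - e) w
    \<Longrightarrow> reach p K x y ((v + w) / 2)"

lemma reach_uminus_left: "reach p K x y v \<Longrightarrow> reach p K (- x) y v"
proof (induction rule: reach.induct)
  case (stop x y)
  then show ?case using reach.stop[of p K "- x" y] by simp
next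
  case (step d e x y v w)
  then show ?case using reach.step[of "- d" e p K "- x" y v w] by simp
qed

lemma reach_uminus_right: "reach p K x y v \<Longrightarrow> reach p K x (- y) v"
proof (induction rule: reach.induct)
  case (stop x y)
  then show ?case using reach.stop[of p K x "- y"] by simp
next
  case (step d e x y v w)
  then show ?case using reach.step[of d "- e" p K x "- y" v w] by simp
qed

lemma reach_scale:
  assumes t: "t > 0" and "reach p K x y v"
  shows "reach p K (t * x) (t * y) (t powr p * v)"
  using assms(2)
proof (induction rule: reach.induct)
  case (stop x y)
  have "t powr p * (\<bar>y\<bar> powr p - K * \<bar>x\<bar> powr p) = \<bar>t * y\<bar> powr p - K * \<bar>t * x\<bar> powr p"
    using t by (simp add: abs_mult powr_mult algebra_simps)
  then show ?case using reach.stop[of p K "t * x" "t * y"] by simp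
next
  case (step d e x y v w)
  have "reach p K (t * x) (t * y) ((t powr p * v + t powr p * w) / 2)"
    by (rule reach.step[of "t * d" "t * e"]) (use step in \<open>simp_all add: abs_mult algebra_simps\<close>)
  then show ?case by (simp add: algebra_simps)
qed

section \<open>The extremal value as a diagonally concave function\<close>

text \<open>Repeated halving towards \<open>(x, y)\<close> turns midpoint concavity along the
  antidiagonal into concavity with the weights \<open>(1/2)^m\<close>, the only ones that the
  limiting argument uses.\<close>

lemma midpoint_concave_dyadic:
  fixes b :: "real \<Rightarrow> real \<Rightarrow> real"
  assumes mid: "\<And>x y d e. \<bar>d\<bar> = \<bar>e\<bar> \<Longrightarrow> b (x + d) (y + e) + b (x - d) (y - e) \<le> 2 * b x y"
  shows "(1 - (1/2)^m) * b x y + (1/2)^m * b (x + u) (y - u) \<le> b (x + (1/2)^m * u) (y - (1/2)^m * u)"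
proof (induction m)
  case (Suc m)
  define l where "l = (1/2::real)^m"
  define h where "h = l / 2 * u"
  have e: "x + h + h = x + l * u" "y - h + - h = y - l * u" "x + h - h = x" "y - h - - h = y"
    by (simp_all add: h_def)
  have "b (x + h + h) (y - h + - h) + b (x + h - h) (y - h - - h) \<le> 2 * b (x + h) (y - h)"
    by (rule mid) simp
  then have "b (x + l * u) (y - l * u) + b x y \<le> 2 * b (x + l / 2 * u) (y - l / 2 * u)"
    unfolding e unfolding h_def .
  moreover have "(1 - l) * b x y + l * b (x + u) (y - u) \<le> b (x + l * u) (y - l * u)"
    using Suc by (simp add: l_def)
  ultimately have "(1 - l / 2) * b x y + l / 2 * b (x + u) (y - u) \<le> b (x + l / 2 * u) (y - l / 2 * u)"
    by (simp add: algebra_simps)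
  then show ?case by (simp add: l_def)
qed simp

text \<open>From \<open>(0, 1)\<close> the near-extremal martingale makes a small diagonal step to \<open>(\<plusminus>\<delta>, 1 \<plusminus> \<delta>)\<close> and
  then returns along the antidiagonal either to the axis or, with the small probability \<open>p * \<delta>\<close>, to
  the ray through \<open>(1/p, 1 - 1/p)\<close>; to first order in \<open>\<delta>\<close> the values on the axis cancel.\<close>

lemma diagonal_concave_majorant_nonpos:
  fixes b W :: "real \<Rightarrow> real \<Rightarrow> real"
  assumes p: "p > 1"
    and mid: "\<And>x y d e. \<bar>d\<bar> = \<bar>e\<bar> \<Longrightarrow> b (x + d) (y + e) + b (x - d) (y - e) \<le> 2 * b x y"
    and even: "\<And>x y. b (- x) y = b x y"
    and hom: "\<And>t x y. t > 0 \<Longrightarrow> b (t * x) (t * y) = t powr p * b x y"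
    and major: "\<And>x y. W x y \<le> b x y"
    and cont: "continuous_on UNIV (\<lambda>y. W (1 / p) y)"
  shows "W (1 / p) (1 - 1 / p) \<le> 0"
proof -
  define l where "l m = (1/2::real)^m" for m :: nat
  define X where "X m = (1 + 2 / p * l m) powr p" for m
  define b1 where "b1 = b 0 1"
  have lpos: "l m > 0" for m by (simp add: l_def)
  have main: "b1 * ((X m - 1) / l m - (X m + 1)) + (W (1/p) (1 + 2 / p * l m - 1 / p) + W (1/p) (1 - 1 / p)) \<le> 0" for m
  proof -
    define d where "d = l m / p"
    have d: "d > 0" using lpos[of m] p by (simp add: d_def)
    have dl: "l m * (1 / p) = d" "2 / p * l m = 2 * d" by (simp_all add: d_def)
    have one: "1 + 2 * d - d = 1 + d" by simp
    have ax: "b 0 (1 + 2 * d) = X m * b1"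
      using hom[of "1 + 2 * d" 0 1] d unfolding X_def b1_def dl(2) by simp
    \<comment> \<open>\<open>(d, 1 + d)\<close> lies at the fraction \<open>l m\<close> of the
      antidiagonal segment from the axis point \<open>(0, 1 + 2 * d)\<close> to
      \<open>(1 / p, 1 + 2 * d - 1 / p)\<close>.\<close>
    have "(1 - l m) * b 0 (1 + 2 * d) + l m * b (1 / p) (1 + 2 * d - 1 / p) \<le> b d (1 + d)"
      by (rule midpoint_concave_dyadic[of b m 0 "1 + 2 * d" "1 / p", OF mid, folded l_def, unfolded dl(1) add_0_left one])
    moreover have "l m * W (1 / p) (1 + 2 * d - 1 / p) \<le> l m * b (1 / p) (1 + 2 * d - 1 / p)"
      using lpos[of m] major by (intro mult_left_mono) auto
    moreover have "(1 - l m) * b1 + l m * b (1 / p) (1 - 1 / p) \<le> b d (1 - d)"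
      using midpoint_concave_dyadic[of b m 0 1 "1 / p", OF mid, folded l_def, unfolded dl(1)] by (simp add: b1_def)
    moreover have "l m * W (1 / p) (1 - 1 / p) \<le> l m * b (1 / p) (1 - 1 / p)"
      using lpos[of m] major by (intro mult_left_mono) auto
    \<comment> \<open>The diagonal step from \<open>(0, 1)\<close>, whose other end
      \<open>(- d, 1 - d)\<close> is reflected to \<open>(d, 1 - d)\<close>.\<close>
    moreover have "b d (1 + d) + b d (1 - d) \<le> 2 * b1"
      using mid[of d d 0 1] even[of d "1 - d"] by (simp add: b1_def)
    ultimately have pre: "(1 - l m) * (X m * b1) + (1 - l m) * b1 + l m * (W (1/p) (1 + 2 * d - 1 / p) + W (1/p) (1 - 1 / p)) \<le> 2 * b1"
      unfolding ax by (simp add: distrib_left)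
    define Y S where "Y = (X m - 1) / l m" and "S = W (1/p) (1 + 2 * d - 1 / p) + W (1/p) (1 - 1 / p)"
    have Y: "l m * Y = X m - 1" using lpos[of m] by (simp add: Y_def)
    have "l m * (b1 * (Y - (X m + 1)) + S) = b1 * (l m * Y) - l m * b1 * (X m + 1) + l m * S"
      by (simp add: algebra_simps)
    also have "\<dots> \<le> 0"
      unfolding Y using pre[folded S_def] by (simp add: algebra_simps)
    finally have "l m * (b1 * ((X m - 1) / l m - (X m + 1)) + (W (1/p) (1 + 2 * d - 1 / p) + W (1/p) (1 - 1 / p))) \<le> 0"
      unfolding Y_def S_def .
    then show ?thesis using lpos[of m] unfolding dl(2) by (simp add: mult_le_0_iff)
  qed
  have l0: "l \<longlonglongrightarrow> 0" unfolding l_def by (intro LIMSEQ_power_zero) simp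
  have X1: "X \<longlonglongrightarrow> 1"
  proof -
    have "X \<longlonglongrightarrow> (1 + 2 / p * 0) powr p" unfolding X_def by (intro tendsto_intros l0) auto
    then show ?thesis by simp
  qed
  \<comment> \<open>The slope of \<open>(1 + 2 / p * x) powr p\<close> at 0 is 2 for every
    \<open>p\<close>. Hence the coefficient of the unknown \<open>b1\<close> tends to
    \<open>2 - (1 + 1) = 0\<close>, and only values of \<open>W\<close> survive in the
    limit.\<close>
  have X': "(\<lambda>m. (X m - 1) / l m) \<longlonglongrightarrow> 2"
  proof -
    have "((\<lambda>x. (1 + 2 / p * x) powr p) has_real_derivative 2) (at 0)"
      using p by (auto intro!: derivative_eq_intros)
    then have "((\<lambda>h. ((1 + 2 / p * (0 + h)) powr p - (1 + 2 / p * 0) powr p) / h) \<longlongrightarrow> 2) (at 0)"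
      by (simp add: DERIV_def)
    moreover have "filterlim l (at 0) sequentially"
      using l0 lpos by (simp add: filterlim_at less_imp_neq[symmetric])
    ultimately show ?thesis using filterlim_compose[of _ "nhds 2" "at 0" l sequentially] by (simp add: X_def)
  qed
  have W': "(\<lambda>m. W (1/p) (1 + 2 / p * l m - 1 / p)) \<longlonglongrightarrow> W (1/p) (1 + 2 / p * 0 - 1 / p)"
    by (rule continuous_on_tendsto_compose[OF cont]) (intro tendsto_intros l0, simp_all)
  have "(\<lambda>m. b1 * ((X m - 1) / l m - (X m + 1)) + (W (1/p) (1 + 2 / p * l m - 1 / p) + W (1/p) (1 - 1 / p)))
     \<longlonglongrightarrow> b1 * (2 - (1 + 1)) + (W (1/p) (1 + 2 / p * 0 - 1 / p) + W (1/p) (1 - 1 / p))"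
    by (intro tendsto_intros X1 X' W')
  then have "b1 * (2 - (1 + 1)) + (W (1/p) (1 + 2 / p * 0 - 1 / p) + W (1/p) (1 - 1 / p)) \<le> 0"
    by (rule LIMSEQ_le_const2) (use main in auto)
  then show ?thesis by simp
qed

text \<open>\<open>b\<close> is the Bellman function of the problem. Its finiteness is the point
  that needs the hypothesis on \<open>C\<close>: a value reachable from \<open>(x, y)\<close> is
  bounded because \<open>(x, y)\<close> can itself be reached from \<open>(0, 0)\<close> in two
  steps.\<close>

proposition reach_sharp:
  fixes p q C :: real
  assumes p: "1 < p" "1 / p + 1 / q = 1" and C: "0 \<le> C"
    and neg: "\<And>v. reach p (C powr p) 0 0 v \<Longrightarrow> v \<le> 0"
  shows "max p q - 1 \<le> C"
proof -
  define K where "K = C powr p"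
  define V where "V x y = \<bar>y\<bar> powr p - K * \<bar>x\<bar> powr p" for x y
  define b where "b x y = Sup {v. reach p K x y v}" for x y
  \<comment> \<open>The step from \<open>(0, 0)\<close> to \<open>(x, x)\<close> and
    \<open>(- x, - x)\<close>, with the reflected continuation at the second point.\<close>
  have diag: "v \<le> 0" if "reach p K x x v" for x v
  proof -
    have "reach p K (- x) (- x) v" by (intro reach_uminus_left reach_uminus_right that)
    then have "reach p K 0 0 ((v + v) / 2)"
      using that by (intro reach.step[of x x]) auto
    then show ?thesis using neg by (auto simp: K_def)
  qed
  \<comment> \<open>An antidiagonal step from \<open>(m, m)\<close> leads to \<open>(x, y)\<close>
    and \<open>(y, x)\<close>; stopping at the latter bounds \<open>v\<close> by minus the value
    collected there.\<close>
  have bound: "v \<le> - V y x" if "reach p K x y v" for x y v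
  proof -
    define m d where "m = (x + y) / 2" and "d = (x - y) / 2"
    have e: "m + d = x" "m - d = y" "m + - d = y" "m - - d = x" by (auto simp: m_def d_def field_simps)
    have "reach p K m m ((v + V y x) / 2)"
      by (rule reach.step[of d "- d"]) (unfold e V_def, use that reach.stop[of p K y x] in auto)
    then have "(v + V y x) / 2 \<le> 0" by (rule diag)
    then show ?thesis by simp
  qed
  have bdd: "bdd_above {v. reach p K x y v}" for x y using bound by (auto simp: bdd_above_def)
  have ne: "{v. reach p K x y v} \<noteq> {}" for x y using reach.stop by blast
  have up: "v \<le> b x y" if "reach p K x y v" for x y v
    unfolding b_def using that by (intro cSup_upper bdd) simp
  have least: "b x y \<le> c" if "\<And>v. reach p K x y v \<Longrightarrow> v \<le> c" for x y c
    unfolding b_def using that by (intro cSup_least ne) auto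
  have major: "V x y \<le> b x y" for x y unfolding V_def by (rule up[OF reach.stop])
  have mid: "b (x + d) (y + e) + b (x - d) (y - e) \<le> 2 * b x y" if de: "\<bar>d\<bar> = \<bar>e\<bar>" for x y d e
  proof -
    have vw: "v + w \<le> 2 * b x y" if "reach p K (x + d) (y + e) v" "reach p K (x - d) (y - e) w" for v w
      using up[OF reach.step[OF de that]] by simp
    have "v \<le> 2 * b x y - b (x - d) (y - e)" if v: "reach p K (x + d) (y + e) v" for v
    proof -
      have "b (x - d) (y - e) \<le> 2 * b x y - v"
      proof (rule least)
        fix w assume "reach p K (x - d) (y - e) w"
        from vw[OF v this] show "w \<le> 2 * b x y - v" by linarith
      qed
      then show ?thesis by linarith
    qed
    then have "b (x + d) (y + e) \<le> 2 * b x y - b (x - d) (y - e)" by (rule least)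
    then show ?thesis by simp
  qed
  have even: "b (- x) y = b x y" "b x (- y) = b x y" for x y
  proof -
    have "reach p K (- x) y v \<longleftrightarrow> reach p K x y v" for v
      using reach_uminus_left[of p K x y v] reach_uminus_left[of p K "- x" y v]
      unfolding minus_minus by (rule iffI[rotated])
    moreover have "reach p K x (- y) v \<longleftrightarrow> reach p K x y v" for v
      using reach_uminus_right[of p K x y v] reach_uminus_right[of p K x "- y" v]
      unfolding minus_minus by (rule iffI[rotated])
    ultimately show "b (- x) y = b x y" "b x (- y) = b x y" by (simp_all only: b_def)
  qed
  have hom_le: "t powr p * b x y \<le> b (t * x) (t * y)" if t: "t > 0" for t x y
  proof -
    have "b x y \<le> b (t * x) (t * y) / t powr p"
    proof (rule least)
      fix v assume "reach p K x y v"
      from up[OF reach_scale[OF t this]] show "v \<le> b (t * x) (t * y) / t powr p"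
        using t by (simp add: pos_le_divide_eq mult.commute[of v])
    qed
    then show ?thesis using t by (simp add: pos_le_divide_eq mult.commute)
  qed
  have hom: "b (t * x) (t * y) = t powr p * b x y" if t: "t > 0" for t x y
  proof (rule antisym[OF _ hom_le[OF t]])
    have "(1 / t) powr p * b (t * x) (t * y) \<le> b x y"
      using hom_le[of "1 / t" "t * x" "t * y"] t by simp
    then show "b (t * x) (t * y) \<le> t powr p * b x y"
      using t by (simp add: powr_divide field_simps)
  qed
  have "V (1 / p) (1 - 1 / p) \<le> 0"
  proof (rule diagonal_concave_majorant_nonpos[OF p(1) mid even(1) hom major])
    show "continuous_on UNIV (V (1 / p))"
      unfolding V_def using p by (intro continuous_intros continuous_on_powr') auto
  qed
  then have "(1 - 1 / p) powr p \<le> (C * (1 / p)) powr p"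
    using p C by (simp add: V_def K_def powr_mult powr_divide)
  then have "1 - 1 / p \<le> C * (1 / p)"
    using p C powr_less_mono2[of p "C * (1 / p)" "1 - 1 / p"] by force
  then have "(1 - 1 / p) * p \<le> C * (1 / p) * p" using p by (intro mult_right_mono) auto
  then have C1: "p - 1 \<le> C" using p(1) by (simp add: left_diff_distrib)
  \<comment> \<open>Exchanging the coordinates replaces the start near \<open>(0, 1)\<close> by one
    near \<open>(1, 0)\<close> and gives the other lower bound,
    \<open>1 / (p - 1) \<le> C\<close>.\<close>
  have "V (1 - 1 / p) (1 / p) \<le> 0"
  proof (rule diagonal_concave_majorant_nonpos[OF p(1), where b = "\<lambda>x y. b y x" and W = "\<lambda>x y. V y x"])
    show "continuous_on UNIV (\<lambda>y. V y (1 / p))"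
      unfolding V_def using p by (intro continuous_intros continuous_on_powr') auto
  qed (use mid even hom major in auto)
  then have "(1 / p) powr p \<le> (C * (1 - 1 / p)) powr p"
    using p C by (simp add: V_def K_def powr_mult powr_divide)
  moreover have "C * (1 - 1 / p) \<ge> 0" using p C by (intro mult_nonneg_nonneg) auto
  ultimately have "1 / p \<le> C * (1 - 1 / p)"
    using p powr_less_mono2[of p "C * (1 - 1 / p)" "1 / p"] by force
  then have C2: "1 / (p - 1) \<le> C" using p by (simp add: field_simps)
  show ?thesis using C1 C2 conjugate_exponent_constant[OF p] by simp
qed

context binary_filtration
begin

section \<open>Realization by finite Haar sums\<close>

text \<open>Each step of the abstract martingale is carried out by one halving. The cell and its
  generation have to be arbitrary because the two continuations are placed on the two halves, one
  generation finer. The integral over the cell is the expectation times the volume.\<close>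

lemma reach_realised:
  assumes "reach p K x y v" "a \<in> range (B t)"
  shows "\<exists>F c s. finite F \<and> F \<subseteq> nodes \<and> (\<forall>i\<in>F. cell (fst i) (snd i) \<subseteq> cell t a) \<and> (\<forall>i. \<bar>s i\<bar> = (1::real)) \<and>
    has_bochner_integral lborel (\<lambda>z. indicator (cell t a) z *
       (\<bar>y + (\<Sum>i\<in>F. s i * c i * haar i z)\<bar> powr p - K * \<bar>x + (\<Sum>i\<in>F. c i * haar i z)\<bar> powr p)) (vol t * v)"
  using assms
proof (induction arbitrary: t a rule: reach.induct)
  case (stop x y)
  have "has_bochner_integral lborel (\<lambda>z. indicator (cell t a) z * (\<bar>y\<bar> powr p - K * \<bar>x\<bar> powr p))
     (measure lborel (cell t a) * (\<bar>y\<bar> powr p - K * \<bar>x\<bar> powr p))"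
    by (intro has_bochner_integral_mult_left has_bochner_integral_real_indicator)
      (simp_all add: measurable_cell emeasure_cell[OF stop])
  then show ?case using measure_cell[OF stop]
    by (intro exI[of _ "{}"] exI[of _ "\<lambda>_. 0"] exI[of _ "\<lambda>_. 1"]) simp
next
  case (step d e x y v w)
  have at: "a \<in> range (B t)" by fact
  obtain a1 where a1: "a1 \<in> range (B (t - 1))" "half t a True = cell (t - 1) a1" by (rule half_cell[OF at])
  obtain a2 where a2: "a2 \<in> range (B (t - 1))" "half t a False = cell (t - 1) a2" by (rule half_cell[OF at])
  let ?W = "\<lambda>F c s x y z. \<bar>y + (\<Sum>i\<in>F. s i * c i * haar i z)\<bar> powr p - K * \<bar>x + (\<Sum>i\<in>F. c i * haar i z)\<bar> powr p"
  obtain F1 c1 s1 where 1: "finite F1" "F1 \<subseteq> nodes" "\<forall>i\<in>F1. cell (fst i) (snd i) \<subseteq> half t a True"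
    "\<And>i. \<bar>s1 i\<bar> = (1::real)"
    "has_bochner_integral lborel (\<lambda>z. indicator (half t a True) z * ?W F1 c1 s1 (x + d) (y + e) z) (vol (t - 1) * v)"
    using step.IH(1)[OF a1(1)] unfolding a1(2) by auto
  obtain F2 c2 s2 where 2: "finite F2" "F2 \<subseteq> nodes" "\<forall>i\<in>F2. cell (fst i) (snd i) \<subseteq> half t a False"
    "\<And>i. \<bar>s2 i\<bar> = (1::real)"
    "has_bochner_integral lborel (\<lambda>z. indicator (half t a False) z * ?W F2 c2 s2 (x - d) (y - e) z) (vol (t - 1) * w)"
    using step.IH(2)[OF a2(1)] unfolding a2(2) by auto
  define i0 where "i0 = (t, a)"
  define F where "F = insert i0 (F1 \<union> F2)"
  \<comment> \<open>The factor \<open>sqrt (vol t)\<close> undoes the normalization of the Haar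
    function, so that this term equals \<open>d\<close> on one half and \<open>- d\<close> on the
    other.\<close>
  define c where "c i = (if i = i0 then d * sqrt (vol t) else if i \<in> F1 then c1 i else c2 i)" for i
  define \<epsilon> :: real where "\<epsilon> = (if d = e then 1 else - 1)"
  have e: "e = \<epsilon> * d" using step.hyps(1) by (auto simp: \<epsilon>_def abs_if split: if_splits)
  define s where "s i = (if i = i0 then \<epsilon> else if i \<in> F1 then s1 i else s2 i)" for i
  have nz: "i \<in> nodes \<Longrightarrow> cell (fst i) (snd i) \<noteq> {}" for i by (auto simp: nodes_def cell_def)
  have hne: "half t a b \<noteq> {}" for b
    using half_cell[OF at, of b] by (auto simp: cell_def)
  \<comment> \<open>Nodes are told apart by their cells: those of \<open>F1\<close> and
    \<open>F2\<close> lie in opposite halves, while the cell of \<open>i0\<close> fits into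
    neither.\<close>
  have disj: "i0 \<notin> F1" "i0 \<notin> F2" "F1 \<inter> F2 = {}"
  proof -
    have "\<not> cell t a \<subseteq> half t a True" "\<not> cell t a \<subseteq> half t a False"
      using hne[of True] hne[of False] cell_half[of t a] by auto
    moreover have "cell (fst i0) (snd i0) = cell t a" by (simp add: i0_def)
    ultimately show "i0 \<notin> F1" "i0 \<notin> F2" using 1(3) 2(3) by metis+
    show "F1 \<inter> F2 = {}"
    proof (rule ccontr)
      assume "F1 \<inter> F2 \<noteq> {}"
      then obtain i where "i \<in> F1" "i \<in> F2" by auto
      then have "cell (fst i) (snd i) \<subseteq> half t a True \<inter> half t a False" using 1(3) 2(3) by auto
      then show False using nz[of i] 1(2) \<open>i \<in> F1\<close> cell_half(2)[of t a] by auto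
    qed
  qed
  have out: "haar i z = 0" if "z \<notin> cell (fst i) (snd i)" for i z
    using that by (cases i) (simp add: haar_alt cell_def)
  have split: "(\<Sum>i\<in>F. f i) = f i0 + (\<Sum>i\<in>F1. f i) + (\<Sum>i\<in>F2. f i)" for f :: "int \<times> 'm \<Rightarrow> real"
    using disj 1(1) 2(1) by (simp add: F_def sum.union_disjoint)
  have c_eq: "(\<Sum>i\<in>F1. c i * haar i z) = (\<Sum>i\<in>F1. c1 i * haar i z)" "(\<Sum>i\<in>F2. c i * haar i z) = (\<Sum>i\<in>F2. c2 i * haar i z)"
    "(\<Sum>i\<in>F1. s i * c i * haar i z) = (\<Sum>i\<in>F1. s1 i * c1 i * haar i z)" "(\<Sum>i\<in>F2. s i * c i * haar i z) = (\<Sum>i\<in>F2. s2 i * c2 i * haar i z)" for z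
    using disj by (auto intro!: sum.cong simp: c_def s_def)
  have zero1: "(\<Sum>i\<in>F1. f i * haar i z) = 0" if "z \<in> half t a False" for f z
    using 1(3) that cell_half(2)[of t a] out by (intro sum.neutral) (metis disjoint_iff mult_zero_right subsetD)
  have zero2: "(\<Sum>i\<in>F2. f i * haar i z) = 0" if "z \<in> half t a True" for f z
    using 2(3) that cell_half(2)[of t a] out by (intro sum.neutral) (metis disjoint_iff mult_zero_right subsetD)
  have sv: "sqrt (vol t) > 0" using vol_pos[of t] by simp
  have hT: "c i0 * haar i0 z = d" if "z \<in> half t a True" for z
    using that sv by (simp add: c_def i0_def haar_alt half_def)
  have hF: "c i0 * haar i0 z = - d" if "z \<in> half t a False" for z
    using that sv by (simp add: c_def i0_def haar_alt half_def)
  have pw: "indicator (cell t a) z * ?W F c s x y z = indicator (half t a True) z * ?W F1 c1 s1 (x + d) (y + e) z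
     + indicator (half t a False) z * ?W F2 c2 s2 (x - d) (y - e) z" for z
  proof -
    consider "z \<in> half t a True" | "z \<in> half t a False" | "z \<notin> cell t a" using cell_half(1) by blast
    then show ?thesis
    proof cases
      case z: 1
      then have n: "z \<notin> half t a False" "z \<in> cell t a" using cell_half[of t a] by auto
      have "s i0 * c i0 * haar i0 z = e" using hT[OF z] by (simp add: s_def e mult.assoc)
      then show ?thesis unfolding split c_eq using z n hT[OF z] zero2[OF z, of c2] zero2[OF z, of "\<lambda>i. s2 i * c2 i"]
        by (simp add: add.assoc)
    next
      case z: 2
      then have n: "z \<notin> half t a True" "z \<in> cell t a" using cell_half[of t a] by auto
      have "s i0 * c i0 * haar i0 z = - e" using hF[OF z] by (simp add: s_def e mult.assoc)
      then show ?thesis unfolding split c_eq using z n hF[OF z] zero1[OF z, of c1] zero1[OF z, of "\<lambda>i. s1 i * c1 i"]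
        by (simp add: algebra_simps)
    next
      case 3
      then have "z \<notin> half t a True" "z \<notin> half t a False" by (auto simp: cell_half(1))
      then show ?thesis using 3 by simp
    qed
  qed
  have "has_bochner_integral lborel (\<lambda>z. indicator (cell t a) z * ?W F c s x y z) (vol (t - 1) * v + vol (t - 1) * w)"
    unfolding pw by (rule has_bochner_integral_add[OF 1(5) 2(5)])
  moreover have "vol (t - 1) * v + vol (t - 1) * w = vol t * ((v + w) / 2)"
    by (simp add: vol_minus_1 algebra_simps)
  moreover have "finite F" "F \<subseteq> nodes" "\<forall>i\<in>F. cell (fst i) (snd i) \<subseteq> cell t a" "\<forall>i. \<bar>s i\<bar> = 1"
    using 1(1-4) 2(1-4) at cell_half(1)[of t a] by (auto simp: F_def i0_def nodes_def s_def \<epsilon>_def)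
  ultimately show ?case by (intro exI[of _ F] exI[of _ c] exI[of _ s] conjI) simp_all
qed

text \<open>Contraposition of \<open>reach_sharp\<close> supplies a positive value reachable from
  \<open>(0, 0)\<close>. It is realized on the cell of generation 0 around the origin, outside which
  both sums vanish, so the integral over the cell is the integral over the whole space.\<close>

proposition finite_transform_sharp:
  assumes p: "1 < p" "1 / p + 1 / q = 1" and C: "0 \<le> C" "C < max p q - 1"
  obtains F c s where "finite F" "F \<subseteq> nodes" "\<And>i. cmod (s i) = 1"
    "C * Lp_norm p (haar_sum c F) < Lp_norm p (haar_sum (\<lambda>i. s i * c i) F)"
proof -
  have "\<not> (\<forall>v. reach p (C powr p) 0 0 v \<longrightarrow> v \<le> 0)"
    using reach_sharp[OF p C(1)] C(2) by force
  then obtain v where v: "reach p (C powr p) 0 0 v" "v > 0" by auto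
  define a where "a = B 0 0"
  have "a \<in> range (B 0)" by (simp add: a_def)
  from reach_realised[OF v(1) this] obtain F c s where F: "finite F" "F \<subseteq> nodes"
    "\<forall>i\<in>F. cell (fst i) (snd i) \<subseteq> cell 0 a" "\<And>i. \<bar>s i\<bar> = (1::real)"
    "has_bochner_integral lborel (\<lambda>z. indicator (cell 0 a) z *
       (\<bar>\<Sum>i\<in>F. s i * c i * haar i z\<bar> powr p - C powr p * \<bar>\<Sum>i\<in>F. c i * haar i z\<bar> powr p)) (vol 0 * v)"
    by auto
  define c' s' where "c' i = complex_of_real (c i)" and "s' i = complex_of_real (s i)" for i
  define f g where "f = haar_sum c' F" and "g = haar_sum (\<lambda>i. s' i * c' i) F"
  have fr: "f z = complex_of_real (\<Sum>i\<in>F. c i * haar i z)" "g z = complex_of_real (\<Sum>i\<in>F. s i * c i * haar i z)" for z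
    by (simp_all add: f_def g_def haar_sum_def c'_def s'_def)
  have out: "haar i z = 0" if "z \<notin> cell (fst i) (snd i)" for i z
    using that by (cases i) (simp add: haar_alt cell_def)
  have "indicator (cell 0 a) z * (\<bar>\<Sum>i\<in>F. s i * c i * haar i z\<bar> powr p - C powr p * \<bar>\<Sum>i\<in>F. c i * haar i z\<bar> powr p)
      = norm (g z) powr p - C powr p * norm (f z) powr p" for z
  proof (cases "z \<in> cell 0 a")
    case False
    then have "haar i z = 0" if "i \<in> F" for i using F(3) that out by blast
    then show ?thesis using False by (simp add: fr)
  qed (simp only: fr norm_of_real indicator_simps mult_1_left)
  then have "(\<integral>z. norm (g z) powr p - C powr p * norm (f z) powr p \<partial>lborel) = vol 0 * v"
    using F(5) by (simp add: has_bochner_integral_iff)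
  moreover have L: "f \<in> Lp_space p" "g \<in> Lp_space p" using p by (simp_all add: f_def g_def haar_sum_in_Lp)
  moreover have "vol 0 * v > 0" using vol_pos[of 0] v by simp
  ultimately have "(\<integral>z. norm (g z) powr p \<partial>lborel) > C powr p * (\<integral>z. norm (f z) powr p \<partial>lborel)"
    using Lp_space_integrable[OF L(1)] Lp_space_integrable[OF L(2)] by simp
  then have "\<not> (\<integral>z. norm (g z) powr p \<partial>lborel) \<le> (C * Lp_norm p f) powr p"
    using p C by (simp add: powr_mult Lp_norm_powr Lp_norm_nonneg)
  then have "\<not> Lp_norm p g \<le> C * Lp_norm p f"
    using p C by (subst Lp_norm_le_iff) (simp_all add: Lp_norm_nonneg)
  then show ?thesis
    by (intro that[OF F(1,2), of s' c']) (use F(4) in \<open>auto simp: f_def g_def s'_def\<close>)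
qed

end


section \<open>Sharp bounds for systems of Haar functions\<close>

lemma powr_2_eq: "(a::real) \<ge> 0 \<Longrightarrow> a powr 2 = a\<^sup>2"
  by (cases "a = 0") (simp_all add: powr_numeral)

lemma Lp_norm_2_le:
  assumes "(\<integral>x. (cmod (f x))\<^sup>2 \<partial>lborel) \<le> (\<integral>x. (cmod (g x))\<^sup>2 \<partial>lborel)"
  shows "Lp_norm 2 f \<le> Lp_norm 2 g"
proof -
  have "(\<integral>x. cmod (f x) powr 2 \<partial>lborel) \<le> Lp_norm 2 g powr 2"
    using assms by (simp add: Lp_norm_powr powr_2_eq)
  then show ?thesis by (subst Lp_norm_le_iff) (simp_all add: Lp_norm_nonneg)
qed

section \<open>Unconditional summation in L^2\<close>

lemma has_transform_sum_unique:
  assumes g: "has_transform_sum H \<sigma> f g" "has_transform_sum H \<sigma> f g'" and H: "\<And>h. h \<in> H \<Longrightarrow> (\<lambda>x. complex_of_real (h x)) \<in> Lp_space 2"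
  shows "AE x in lborel. g x = g' x"
proof -
  define S where "S F x = (\<Sum>h\<in>F. \<sigma> h * (\<integral>y. f y * of_real (h y) \<partial>lborel) * complex_of_real (h x))" for F x
  have L: "g \<in> Lp_space 2" "g' \<in> Lp_space 2" using g by (auto simp: has_transform_sum_def)
  have lim: "((\<lambda>F. Lp_norm 2 (\<lambda>x. S F x - g x) + Lp_norm 2 (\<lambda>x. S F x - g' x)) \<longlongrightarrow> 0 + 0) (finite_subsets_at_top H)"
    using g unfolding has_transform_sum_def S_def by (intro tendsto_add) auto
  have "Lp_norm 2 (\<lambda>x. g x - g' x) \<le> 0 + 0"
  proof (rule tendsto_lowerbound[OF lim])
    show "\<forall>\<^sub>F F in finite_subsets_at_top H. Lp_norm 2 (\<lambda>x. g x - g' x) \<le> Lp_norm 2 (\<lambda>x. S F x - g x) + Lp_norm 2 (\<lambda>x. S F x - g' x)"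
    proof (rule eventually_finite_subsets_at_top_weakI)
      fix F assume F: "finite F" "F \<subseteq> H"
      have "S F \<in> Lp_space 2"
        unfolding S_def[abs_def] using F H by (intro Lp_space_sum Lp_space_cmult) auto
      then show "Lp_norm 2 (\<lambda>x. g x - g' x) \<le> Lp_norm 2 (\<lambda>x. S F x - g x) + Lp_norm 2 (\<lambda>x. S F x - g' x)"
        using Lp_norm_triangle_diff[of 2 g "S F" g'] L by (simp add: Lp_norm_minus_commute[of 2 g "S F"])
    qed
  qed simp
  then have "Lp_norm 2 (\<lambda>x. g x - g' x) = 0" using Lp_norm_nonneg[of 2 "\<lambda>x. g x - g' x"] by simp
  then show ?thesis using Lp_norm_eq_0_iff[OF _ Lp_space_diff[OF _ L]] by simp
qed

context binary_filtration
begin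

lemma integrable_test_haar:
  assumes f: "f \<in> test_functions"
  shows "integrable lborel (\<lambda>x. f x * complex_of_real (haar i x))"
proof (rule Bochner_Integration.integrable_bound)
  have [measurable]: "f \<in> borel_measurable borel" using f by (rule test_function_measurable)
  show "integrable lborel (\<lambda>x. norm (f x) * (1 / sqrt (vol (fst i))))"
    using Lp_space_integrable[OF test_function_Lp[OF f, of 1]] by simp
  show "(\<lambda>x. f x * complex_of_real (haar i x)) \<in> borel_measurable lborel" by simp
  have "norm (f x * complex_of_real (haar i x)) \<le> norm (f x) * (1 / sqrt (vol (fst i)))" for x
  proof -
    have "\<bar>haar i x\<bar> \<le> 1 / sqrt (vol (fst i))"
      using haar_norm_le[of "fst i" "snd i" x] vol_pos[of "fst i"]
      by (auto simp: indicator_def split: if_splits intro: order_trans)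
    then show ?thesis unfolding norm_mult norm_of_real by (rule mult_left_mono) simp
  qed
  then show "AE x in lborel. norm (f x * complex_of_real (haar i x)) \<le> norm (norm (f x) * (1 / sqrt (vol (fst i))))"
    using vol_pos[of "fst i"] by simp
qed

text \<open>The residual has inner product \<open>c\<close> with the new function because the
  earlier ones are orthogonal to it; expanding the square shows that the squared error drops by
  \<open>|c|^2\<close>.\<close>

lemma projection_step:
  assumes f: "f \<in> test_functions" and Y: "finite Y" "Y \<subseteq> nodes" and i: "i \<in> nodes" "i \<notin> Y"
  shows "Lp_norm 2 (\<lambda>x. haar_sum (coeff f) (insert i Y) x - f x) \<le> Lp_norm 2 (\<lambda>x. haar_sum (coeff f) Y x - f x)"
proof (rule Lp_norm_2_le)
  define c where "c = coeff f i"
  define r where "r x = f x - haar_sum (coeff f) Y x" for x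
  have rL: "r \<in> Lp_space 2"
    unfolding r_def by (intro Lp_space_diff test_function_Lp[OF f] haar_sum_in_Lp) simp_all
  have int_r: "integrable lborel (\<lambda>x. (cmod (r x))\<^sup>2)"
    using Lp_space_integrable[OF rL] by (simp add: powr_2_eq)
  have hh: "integrable lborel (\<lambda>x. complex_of_real (haar j x * haar i x))" if "j \<in> nodes" for j
    using haar_orthonormal(1)[OF that i(1)] by (rule integrable_of_real)
  have sum_eq: "haar_sum (coeff f) Y x * complex_of_real (haar i x) = (\<Sum>j\<in>Y. coeff f j * complex_of_real (haar j x * haar i x))" for x
    by (simp add: haar_sum_def sum_distrib_right mult.assoc)
  have int_s: "integrable lborel (\<lambda>x. haar_sum (coeff f) Y x * complex_of_real (haar i x))"
    unfolding sum_eq using Y hh by (intro Bochner_Integration.integrable_sum integrable_mult_right) auto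
  have s0: "(\<integral>x. haar_sum (coeff f) Y x * complex_of_real (haar i x) \<partial>lborel) = 0"
  proof -
    have "(\<integral>x. haar_sum (coeff f) Y x * complex_of_real (haar i x) \<partial>lborel)
      = (\<Sum>j\<in>Y. coeff f j * (\<integral>x. complex_of_real (haar j x * haar i x) \<partial>lborel))"
      unfolding sum_eq using Y hh by (subst Bochner_Integration.integral_sum) (auto intro!: integrable_mult_right)
    also have "\<dots> = 0"
    proof (rule sum.neutral, rule ballI)
      fix j assume j: "j \<in> Y"
      then have "(\<integral>x. haar j x * haar i x \<partial>lborel) = 0"
        using haar_orthonormal(2)[of j i] Y i by auto
      moreover have "(\<integral>x. complex_of_real (haar j x * haar i x) \<partial>lborel) = complex_of_real (\<integral>x. haar j x * haar i x \<partial>lborel)"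
        by (rule integral_complex_of_real)
      ultimately show "coeff f j * (\<integral>x. complex_of_real (haar j x * haar i x) \<partial>lborel) = 0"
        by (simp only: of_real_0 mult_zero_right)
    qed
    finally show ?thesis .
  qed
  have int_rh: "integrable lborel (\<lambda>x. r x * complex_of_real (haar i x))"
    unfolding r_def left_diff_distrib by (intro Bochner_Integration.integrable_diff integrable_test_haar[OF f] int_s)
  have rh: "(\<integral>x. r x * complex_of_real (haar i x) \<partial>lborel) = c"
    unfolding r_def left_diff_distrib
    by (subst Bochner_Integration.integral_diff[OF integrable_test_haar[OF f] int_s]) (simp add: s0 c_def coeff_def)
  have pw: "(cmod (haar_sum (coeff f) (insert i Y) x - f x))\<^sup>2
     = (cmod (r x))\<^sup>2 - 2 * Re (cnj c * (r x * complex_of_real (haar i x))) + (cmod c)\<^sup>2 * (haar i x * haar i x)" for x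
  proof -
    have "haar_sum (coeff f) (insert i Y) x - f x = c * complex_of_real (haar i x) - r x"
      using Y i by (simp add: haar_sum_def r_def c_def)
    then have "(cmod (haar_sum (coeff f) (insert i Y) x - f x))\<^sup>2 = (cmod (c * complex_of_real (haar i x) - r x))\<^sup>2"
      by (simp only:)
    also have "\<dots> = (cmod (r x))\<^sup>2 - 2 * Re (cnj c * (r x * complex_of_real (haar i x))) + (cmod c)\<^sup>2 * (haar i x * haar i x)"
      unfolding cmod_power2 by (simp add: algebra_simps power2_eq_square)
    finally show ?thesis .
  qed
  have int_re: "integrable lborel (\<lambda>x. 2 * Re (cnj c * (r x * complex_of_real (haar i x))))"
    by (intro integrable_mult_right integrable_Re int_rh)
  have re: "(\<integral>x. 2 * Re (cnj c * (r x * complex_of_real (haar i x))) \<partial>lborel) = 2 * (cmod c)\<^sup>2"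
  proof -
    have "(\<integral>x. Re (cnj c * (r x * complex_of_real (haar i x))) \<partial>lborel) = Re (\<integral>x. cnj c * (r x * complex_of_real (haar i x)) \<partial>lborel)"
      by (intro integral_Re integrable_mult_right int_rh)
    also have "\<dots> = Re (cnj c * c)" using int_rh rh by simp
    also have "\<dots> = (cmod c)\<^sup>2" unfolding cmod_power2 by (simp add: power2_eq_square)
    finally have "2 * (\<integral>x. Re (cnj c * (r x * complex_of_real (haar i x))) \<partial>lborel) = 2 * (cmod c)\<^sup>2"
      by (rule arg_cong)
    then show ?thesis by (simp only: integral_mult_right_zero)
  qed
  have "(\<integral>x. (cmod (haar_sum (coeff f) (insert i Y) x - f x))\<^sup>2 \<partial>lborel)
     = (\<integral>x. (cmod (r x))\<^sup>2 \<partial>lborel) - 2 * (cmod c)\<^sup>2 + (cmod c)\<^sup>2 * 1"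
    unfolding pw
    by (subst Bochner_Integration.integral_add)
      (use int_r int_re haar_orthonormal[OF i(1) i(1)] re in \<open>auto simp del: integral_mult_right_zero\<close>)
  also have "\<dots> \<le> (\<integral>x. (cmod (r x))\<^sup>2 \<partial>lborel)" by simp
  finally show "(\<integral>x. (cmod (haar_sum (coeff f) (insert i Y) x - f x))\<^sup>2 \<partial>lborel)
      \<le> (\<integral>x. (cmod (haar_sum (coeff f) Y x - f x))\<^sup>2 \<partial>lborel)"
    by (simp add: r_def norm_minus_commute)
qed

text \<open>Once a finite sum of the series is close to \<open>f\<close>, so is the sum over every
  larger finite set. This upgrades convergence along one sequence to convergence along the net of
  finite subsets.\<close>

lemma projection_mono:
  assumes f: "f \<in> test_functions" and Y: "finite Y" "Y \<subseteq> nodes" and F: "F \<subseteq> Y"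
  shows "Lp_norm 2 (\<lambda>x. haar_sum (coeff f) Y x - f x) \<le> Lp_norm 2 (\<lambda>x. haar_sum (coeff f) F x - f x)"
proof -
  have "finite G \<Longrightarrow> G \<subseteq> nodes \<Longrightarrow> G \<inter> F = {} \<Longrightarrow>
    Lp_norm 2 (\<lambda>x. haar_sum (coeff f) (F \<union> G) x - f x) \<le> Lp_norm 2 (\<lambda>x. haar_sum (coeff f) F x - f x)" for G
  proof (induction G rule: finite_induct)
    case (insert i G)
    have "Lp_norm 2 (\<lambda>x. haar_sum (coeff f) (insert i (F \<union> G)) x - f x) \<le> Lp_norm 2 (\<lambda>x. haar_sum (coeff f) (F \<union> G) x - f x)"
      by (rule projection_step[OF f]) (use insert Y F in \<open>auto intro: finite_subset\<close>)
    also have "\<dots> \<le> Lp_norm 2 (\<lambda>x. haar_sum (coeff f) F x - f x)" using insert by auto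
    finally show ?case by simp
  qed simp
  from this[of "Y - F"] show ?thesis using Y F by (auto simp: Un_absorb1)
qed

text \<open>The value obtained in L^p is also the unconditional L^2 sum: one sequence of finite sums
  converges to \<open>f\<close> for both exponents, and the two limits of its images agree almost
  everywhere.\<close>

proposition transform_of_test_function:
  assumes p: "1 < p" and s: "\<And>i. i \<in> nodes \<Longrightarrow> cmod (s i) = 1" and f: "f \<in> test_functions"
  obtains g where "transform_graph p s f g" "g \<in> Lp_space 2"
    "\<And>e. e > 0 \<Longrightarrow> \<exists>F. finite F \<and> F \<subseteq> nodes \<and> (\<forall>Y. finite Y \<and> F \<subseteq> Y \<and> Y \<subseteq> nodes \<longrightarrow>
        Lp_norm 2 (\<lambda>x. haar_sum (\<lambda>i. s i * coeff f i) Y x - g x) < e)"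
proof -
  obtain F :: "nat \<Rightarrow> (int \<times> 'm) set" where F: "\<And>n. finite (F n)" "\<And>n. F n \<subseteq> nodes"
    "\<And>p. p > 1 \<Longrightarrow> (\<lambda>n. Lp_norm p (\<lambda>x. (\<Sum>i\<in>F n. coeff f i * complex_of_real (haar i x)) - f x)) \<longlonglongrightarrow> 0"
    by (rule haar_approximation[OF f]) blast
  define u v where "u n = haar_sum (coeff f) (F n)" and "v n = haar_sum (\<lambda>i. s i * coeff f i) (F n)" for n
  have uv: "(u n, v n) \<in> transform_pairs s" for n unfolding u_def v_def by (intro transform_pairsI F)
  have ul: "(\<lambda>n. Lp_norm p (\<lambda>x. u n x - f x)) \<longlonglongrightarrow> 0" if "p > 1" for p
    using F(3)[OF that] by (simp add: u_def haar_sum_def)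
  have fL: "f \<in> Lp_space p" if "p > 0" for p using test_function_Lp[OF f that] .
  obtain g where g: "g \<in> Lp_space p" "(\<lambda>n. Lp_norm p (\<lambda>x. v n x - g x)) \<longlonglongrightarrow> 0" "transform_graph p s f g"
    by (rule transform_pairs_convergent[OF p s uv fL ul[OF p]]) (use p in auto)
  obtain g2 where g2: "g2 \<in> Lp_space 2" "(\<lambda>n. Lp_norm 2 (\<lambda>x. v n x - g2 x)) \<longlonglongrightarrow> 0"
    by (rule transform_pairs_convergent[OF _ s uv fL ul, of 2]) auto
  have vL: "v n \<in> Lp_space p" if "p > 0" for n p using transform_pairs_Lp(2)[OF uv that] .
  have ae: "AE x in lborel. g2 x = g x"
    by (rule Lp_limit_unique[of 2 p v g2 g]) (use p vL g g2 in auto)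
  have gg: "g \<in> Lp_space 2" by (rule Lp_space_cong_AE[OF ae g2(1) Lp_space_measurable[OF g(1)]])
  have "(\<lambda>n. Lp_norm 2 (\<lambda>x. v n x - g x)) = (\<lambda>n. Lp_norm 2 (\<lambda>x. v n x - g2 x))"
  proof
    fix n
    have "(\<lambda>x. v n x - g x) \<in> Lp_space 2" "(\<lambda>x. v n x - g2 x) \<in> Lp_space 2"
      using vL[of 2 n] gg g2 by (auto intro: Lp_space_diff)
    then show "Lp_norm 2 (\<lambda>x. v n x - g x) = Lp_norm 2 (\<lambda>x. v n x - g2 x)"
      using ae by (intro Lp_norm_cong_AE Lp_space_measurable) auto
  qed
  with g2(2) have vl: "(\<lambda>n. Lp_norm 2 (\<lambda>x. v n x - g x)) \<longlonglongrightarrow> 0" by simp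
  show ?thesis
  proof (rule that[OF g(3) gg])
    fix e :: real assume e: "e > 0"
    have "eventually (\<lambda>n. Lp_norm 2 (\<lambda>x. v n x - g x) < e / 3 \<and> Lp_norm 2 (\<lambda>x. u n x - f x) < e / 3) sequentially"
      by (intro eventually_conj order_tendstoD(2)[OF vl] order_tendstoD(2)[OF ul[of 2]]) (use e in auto)
    then obtain n where n: "Lp_norm 2 (\<lambda>x. v n x - g x) < e / 3" "Lp_norm 2 (\<lambda>x. u n x - f x) < e / 3"
      by (auto simp: eventually_sequentially)
    have "Lp_norm 2 (\<lambda>x. haar_sum (\<lambda>i. s i * coeff f i) Y x - g x) < e"
      if Y: "finite Y" "F n \<subseteq> Y" "Y \<subseteq> nodes" for Y
    proof -
      define u' v' where "u' = haar_sum (coeff f) Y" and "v' = haar_sum (\<lambda>i. s i * coeff f i) Y"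
      have uv': "(u', v') \<in> transform_pairs s" unfolding u'_def v'_def by (intro transform_pairsI Y)
      have L: "u' \<in> Lp_space 2" "v' \<in> Lp_space 2" "u n \<in> Lp_space 2"
        using transform_pairs_Lp[OF uv'] transform_pairs_Lp[OF uv] by auto
      \<comment> \<open>For exponent 2 the constant is 1, so passing from \<open>F n\<close> to a
        larger set changes the image no more, in norm, than it changes the sum itself.\<close>
      have "Lp_norm 2 (\<lambda>x. v' x - v n x) \<le> (max 2 2 - 1) * Lp_norm 2 (\<lambda>x. u' x - u n x)"
        by (rule transform_pairs_bound[OF _ _ s transform_pairs_diff[OF uv' uv]]) auto
      also have "\<dots> \<le> Lp_norm 2 (\<lambda>x. u' x - f x) + Lp_norm 2 (\<lambda>x. u n x - f x)"
        using Lp_norm_triangle_diff[of 2 u' f "u n"] L fL[of 2] by (simp add: Lp_norm_minus_commute[of 2 f])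
      also have "Lp_norm 2 (\<lambda>x. u' x - f x) \<le> Lp_norm 2 (\<lambda>x. u n x - f x)"
        unfolding u'_def u_def by (rule projection_mono[OF f Y(1,3,2)])
      finally have "Lp_norm 2 (\<lambda>x. v' x - v n x) < 2 * (e / 3)" using n by linarith
      moreover have "Lp_norm 2 (\<lambda>x. v' x - g x) \<le> Lp_norm 2 (\<lambda>x. v' x - v n x) + Lp_norm 2 (\<lambda>x. v n x - g x)"
        using L vL[of 2] gg by (intro Lp_norm_triangle_diff) auto
      ultimately show ?thesis using n unfolding v'_def by linarith
    qed
    then show "\<exists>F. finite F \<and> F \<subseteq> nodes \<and> (\<forall>Y. finite Y \<and> F \<subseteq> Y \<and> Y \<subseteq> nodes \<longrightarrow>
        Lp_norm 2 (\<lambda>x. haar_sum (\<lambda>i. s i * coeff f i) Y x - g x) < e)"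
      using F by (intro exI[of _ "F n"]) auto
  qed
qed

end

text \<open>Agreement almost everywhere is all that can be asked for: the closed triangles of the lattice
  overlap in their sides, whereas the cells of a filtration are disjoint.\<close>

locale haar_system = binary_filtration B bit \<kappa>
  for B :: "int \<Rightarrow> 'a::euclidean_space \<Rightarrow> 'm" and bit \<kappa> +
  fixes hh :: "int \<times> 'm \<Rightarrow> 'a \<Rightarrow> real"
  assumes hh_measurable: "i \<in> nodes \<Longrightarrow> hh i \<in> borel_measurable borel"
    and hh_AE: "i \<in> nodes \<Longrightarrow> AE x in lborel. hh i x = haar i x"
begin

section \<open>From nodes to the given functions\<close>

text \<open>Two nodes with the same function would have inner product both 0 and 1. Injectivity
  matters because the coefficients are indexed by functions but are handled through nodes.\<close>

lemma hh_inj: "inj_on hh nodes"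
proof (rule inj_onI, rule ccontr)
  fix i j assume ij: "i \<in> nodes" "j \<in> nodes" "hh i = hh j" "i \<noteq> j"
  have "AE x in lborel. haar i x = haar j x"
    using hh_AE[OF ij(1)] hh_AE[OF ij(2)] by eventually_elim (simp add: ij(3))
  then have "(\<integral>x. haar i x * haar j x \<partial>lborel) = (\<integral>x. haar i x * haar i x \<partial>lborel)"
    by (intro integral_cong_AE) auto
  then show False using haar_orthonormal(2)[OF ij(1) ij(2)] haar_orthonormal(2)[OF ij(1) ij(1)] ij(4) by simp
qed

lemma hh_Lp: "i \<in> nodes \<Longrightarrow> p > 0 \<Longrightarrow> (\<lambda>x. complex_of_real (hh i x)) \<in> Lp_space p"
proof (rule Lp_space_cong_AE[OF _ haar_Lp[of p i]])
  assume i: "i \<in> nodes"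
  show "AE x in lborel. complex_of_real (haar i x) = complex_of_real (hh i x)"
    using hh_AE[OF i] by eventually_elim simp
  show "(\<lambda>x. complex_of_real (hh i x)) \<in> borel_measurable borel" using hh_measurable[OF i] by simp
qed

lemma coeff_hh:
  assumes "i \<in> nodes" "f \<in> borel_measurable borel"
  shows "(\<integral>y. f y * complex_of_real (hh i y) \<partial>lborel) = coeff f i"
  unfolding coeff_def
proof (rule integral_cong_AE)
  show "AE x in lborel. f x * complex_of_real (hh i x) = f x * complex_of_real (haar i x)"
    using hh_AE[OF assms(1)] by eventually_elim simp
qed (use assms hh_measurable[OF assms(1)] in auto)

text \<open>By injectivity finite sets of functions correspond to finite sets of nodes, and changing
  functions on null sets alters neither coefficients nor norms.\<close>

lemma transform_graph_has_transform_sum: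
  assumes f: "f \<in> test_functions"
    and g: "g \<in> Lp_space 2" "\<And>e. e > 0 \<Longrightarrow> \<exists>F. finite F \<and> F \<subseteq> nodes \<and> (\<forall>Y. finite Y \<and> F \<subseteq> Y \<and> Y \<subseteq> nodes \<longrightarrow>
        Lp_norm 2 (\<lambda>x. haar_sum (\<lambda>i. \<sigma> (hh i) * coeff f i) Y x - g x) < e)"
    and g': "AE x in lborel. g x = g' x" "g' \<in> borel_measurable borel"
  shows "has_transform_sum (hh ` nodes) \<sigma> f g'"
  unfolding has_transform_sum_def
proof (intro conjI tendstoI)
  show g'L: "g' \<in> Lp_space 2" by (rule Lp_space_cong_AE[OF g'(1) g(1) g'(2)])
  have fm: "f \<in> borel_measurable borel" by (rule test_function_measurable[OF f])
  fix e :: real assume "e > 0"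
  from g(2)[OF this] obtain F where F: "finite F" "F \<subseteq> nodes"
    "\<And>Y. finite Y \<Longrightarrow> F \<subseteq> Y \<Longrightarrow> Y \<subseteq> nodes \<Longrightarrow> Lp_norm 2 (\<lambda>x. haar_sum (\<lambda>i. \<sigma> (hh i) * coeff f i) Y x - g x) < e"
    by auto
  show "\<forall>\<^sub>F Z in finite_subsets_at_top (hh ` nodes). dist (Lp_norm 2 (\<lambda>x. (\<Sum>h\<in>Z. \<sigma> h * (\<integral>y. f y * complex_of_real (h y) \<partial>lborel) * complex_of_real (h x)) - g' x)) 0 < e"
    unfolding eventually_finite_subsets_at_top
  proof (intro exI[of _ "hh ` F"] conjI allI impI)
    fix Z assume Z: "finite Z \<and> hh ` F \<subseteq> Z \<and> Z \<subseteq> hh ` nodes"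
    define Y where "Y = {i \<in> nodes. hh i \<in> Z}"
    have Y: "Z = hh ` Y" "F \<subseteq> Y" "Y \<subseteq> nodes" using Z F(2) by (auto simp: Y_def)
    have inj: "inj_on hh Y" using hh_inj Y(3) by (rule inj_on_subset)
    then have finY: "finite Y" using Z Y(1) by (simp add: finite_image_iff)
    define S where "S x = (\<Sum>h\<in>Z. \<sigma> h * (\<integral>y. f y * complex_of_real (h y) \<partial>lborel) * complex_of_real (h x))" for x
    have S: "S x = (\<Sum>i\<in>Y. \<sigma> (hh i) * coeff f i * complex_of_real (hh i x))" for x
      unfolding S_def Y(1) sum.reindex[OF inj] o_def
      by (rule sum.cong) (use Y(3) coeff_hh[OF _ fm] in auto)
    have "AE x in lborel. \<forall>i\<in>Y. hh i x = haar i x"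
      using finY Y(3) hh_AE by (subst AE_finite_all) auto
    then have ae: "AE x in lborel. S x - g' x = haar_sum (\<lambda>i. \<sigma> (hh i) * coeff f i) Y x - g x"
      using g'(1) by eventually_elim (simp add: S haar_sum_def)
    have [measurable]: "S \<in> borel_measurable borel"
      unfolding S[abs_def] using hh_measurable Y(3) by (intro borel_measurable_sum borel_measurable_times) auto
    have [measurable]: "g' \<in> borel_measurable borel" "g \<in> borel_measurable borel" 
      "haar_sum (\<lambda>i. \<sigma> (hh i) * coeff f i) Y \<in> borel_measurable borel"
      using g'(2) Lp_space_measurable[OF g(1)] Lp_space_measurable[OF haar_sum_in_Lp[of 1]] by auto
    have "Lp_norm 2 (\<lambda>x. S x - g' x) = Lp_norm 2 (\<lambda>x. haar_sum (\<lambda>i. \<sigma> (hh i) * coeff f i) Y x - g x)"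
      by (rule Lp_norm_cong_AE[OF ae]) auto
    also have "\<dots> < e" by (rule F(3)[OF finY Y(2,3)])
    finally show "dist (Lp_norm 2 (\<lambda>x. (\<Sum>h\<in>Z. \<sigma> h * (\<integral>y. f y * complex_of_real (h y) \<partial>lborel) * complex_of_real (h x)) - g' x)) 0 < e"
      by (simp add: S_def Lp_norm_nonneg)
  qed (use F in auto)
qed

lemma transform_exists:
  assumes p: "1 < p" "1 / p + 1 / q = 1" and \<sigma>: "\<forall>h\<in>hh ` nodes. norm (\<sigma> h) = 1"
  obtains T where "martingale_transform p (hh ` nodes) \<sigma> T"
    "\<And>f. f \<in> Lp_space p \<Longrightarrow> transform_graph p (\<lambda>i. \<sigma> (hh i)) f (T f)"
proof -
  define s where "s i = \<sigma> (hh i)" for i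
  have s: "cmod (s i) = 1" if "i \<in> nodes" for i using \<sigma> that by (simp add: s_def)
  have p0: "p > 0" using p by simp
  \<comment> \<open>Any choice from the graph will do: linearity is required only almost everywhere,
    and the values are unique almost everywhere.\<close>
  define T where "T f = (SOME g. transform_graph p s f g)" for f
  have T: "transform_graph p s f (T f)" if f: "f \<in> Lp_space p" for f
  proof -
    obtain g where "transform_graph p s f g" by (rule transform_graph_exists[OF p(1) s f])
    then show ?thesis unfolding T_def by (rule someI[of "transform_graph p s f"])
  qed
  have TL: "T f \<in> Lp_space p" if "f \<in> Lp_space p" for f using T[OF that] by (simp add: transform_graph_def)
  have zero: "transform_graph p s (\<lambda>x. 0) (\<lambda>x. 0)"
    using transform_graph_finite[OF p0, of "{}" s] by (simp add: haar_sum_def[abs_def])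
  show ?thesis
  proof (rule that)
    show "martingale_transform p (hh ` nodes) \<sigma> T"
      unfolding martingale_transform_def bounded_Lp_operator_def
    proof (intro conjI ballI allI)
      fix f :: "'a \<Rightarrow> complex" assume f: "f \<in> Lp_space p"
      show "T f \<in> Lp_space p" by (rule TL[OF f])
      fix c
      have "transform_graph p s (\<lambda>x. c * f x) (\<lambda>x. c * T f x)"
        using transform_graph_lin[OF p(1) zero T[OF f], of c] by simp
      then show "AE x in lborel. T (\<lambda>y. c * f y) x = c * T f x"
        using Lp_space_cmult[OF p0 f] by (intro transform_graph_unique[OF p(1) s T])
    next
      fix f g :: "'a \<Rightarrow> complex" assume fg: "f \<in> Lp_space p" "g \<in> Lp_space p"
      have "transform_graph p s (\<lambda>x. f x + g x) (\<lambda>x. T f x + T g x)"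
        using transform_graph_lin[OF p(1) T[OF fg(1)] T[OF fg(2)], of 1] by simp
      then show "AE x in lborel. T (\<lambda>y. f y + g y) x = T f x + T g x"
        using Lp_space_add[OF p0 fg] by (intro transform_graph_unique[OF p(1) s T])
    next
      show "\<exists>C. \<forall>f\<in>Lp_space p. Lp_norm p (T f) \<le> C * Lp_norm p f"
        using transform_graph_bound[OF p s T] by blast
    next
      fix f :: "'a \<Rightarrow> complex" assume f: "f \<in> test_functions"
      have fL: "f \<in> Lp_space p" by (rule test_function_Lp[OF f p0])
      obtain g where g: "transform_graph p s f g" "g \<in> Lp_space 2"
        "\<And>e. e > 0 \<Longrightarrow> \<exists>F. finite F \<and> F \<subseteq> nodes \<and> (\<forall>Y. finite Y \<and> F \<subseteq> Y \<and> Y \<subseteq> nodes \<longrightarrow>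
          Lp_norm 2 (\<lambda>x. haar_sum (\<lambda>i. s i * coeff f i) Y x - g x) < e)"
        by (rule transform_of_test_function[where s = s, OF p(1) _ f])
          (erule s, rule that, assumption, assumption, simp)
      have ae: "AE x in lborel. g x = T f x" by (rule transform_graph_unique[OF p(1) s g(1) T[OF fL]])
      show "has_transform_sum (hh ` nodes) \<sigma> f (T f)"
        by (rule transform_graph_has_transform_sum[OF f g(2) _ ae Lp_space_measurable[OF TL[OF fL]]])
          (rule g(3)[unfolded s_def])
    qed
  qed (use T in \<open>simp add: s_def[abs_def]\<close>)
qed

lemma transform_test_bound:
  assumes p: "1 < p" "1 / p + 1 / q = 1" and \<sigma>: "\<forall>h\<in>hh ` nodes. norm (\<sigma> h) = 1"
    and T: "martingale_transform p (hh ` nodes) \<sigma> T" and f: "f \<in> test_functions"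
  shows "Lp_norm p (T f) \<le> (max p q - 1) * Lp_norm p f"
proof -
  have p0: "p > 0" using p by simp
  obtain T' where T': "martingale_transform p (hh ` nodes) \<sigma> T'"
    "\<And>f. f \<in> Lp_space p \<Longrightarrow> transform_graph p (\<lambda>i. \<sigma> (hh i)) f (T' f)"
    by (rule transform_exists[OF p \<sigma>]) (rule that, assumption, simp)
  have fL: "f \<in> Lp_space p" by (rule test_function_Lp[OF f p0])
  have "has_transform_sum (hh ` nodes) \<sigma> f (T f)" "has_transform_sum (hh ` nodes) \<sigma> f (T' f)"
    using T T'(1) f by (auto simp: martingale_transform_def)
  then have "AE x in lborel. T f x = T' f x"
    by (rule has_transform_sum_unique) (auto intro: hh_Lp)
  moreover have "T f \<in> Lp_space p" "T' f \<in> Lp_space p"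
    using T T'(1) fL by (auto simp: martingale_transform_def bounded_Lp_operator_def)
  ultimately have "Lp_norm p (T f) = Lp_norm p (T' f)"
    by (intro Lp_norm_cong_AE Lp_space_measurable)
  also have "\<dots> \<le> (max p q - 1) * Lp_norm p f"
    by (rule transform_graph_bound[OF p _ T'(2)[OF fL]]) (use \<sigma> in auto)
  finally show ?thesis .
qed

text \<open>\<open>T\<close> is an arbitrary version: the sharp bound is known for it on test
  functions, and elsewhere only some constant \<open>K\<close>. Splitting \<open>f\<close> into a
  nearby test function and a small rest costs \<open>(C + |K|) * e\<close>, which vanishes with
  \<open>e\<close>.\<close>

lemma transform_bound:
  assumes p: "1 < p" "1 / p + 1 / q = 1" and \<sigma>: "\<forall>h\<in>hh ` nodes. norm (\<sigma> h) = 1"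
    and T: "martingale_transform p (hh ` nodes) \<sigma> T" and f: "f \<in> Lp_space p"
  shows "Lp_norm p (T f) \<le> (max p q - 1) * Lp_norm p f"
proof -
  define C where "C = max p q - 1"
  have C: "C > 0" using p by (auto simp: C_def)
  have p1: "p > 0" "p \<ge> 1" using p by auto
  have b: "bounded_Lp_operator p T" using T by (simp add: martingale_transform_def)
  then obtain K where "\<forall>f\<in>Lp_space p. Lp_norm p (T f) \<le> K * Lp_norm p f"
    unfolding bounded_Lp_operator_def by (elim conjE exE)
  then have K: "\<And>f. f \<in> Lp_space p \<Longrightarrow> Lp_norm p (T f) \<le> K * Lp_norm p f" by simp
  have TL: "\<And>f. f \<in> Lp_space p \<Longrightarrow> T f \<in> Lp_space p" using b by (auto simp: bounded_Lp_operator_def)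
  have "Lp_norm p (T f) \<le> C * Lp_norm p f + (C + \<bar>K\<bar>) * e" if e: "e > 0" for e
  proof -
    obtain g where g: "g \<in> test_functions" "Lp_norm p (\<lambda>x. g x - f x) < e"
      by (rule test_functions_dense[OF p(1) f e])
    have gL: "g \<in> Lp_space p" by (rule test_function_Lp[OF g(1) p1(1)])
    have dL: "(\<lambda>x. f x - g x) \<in> Lp_space p" by (rule Lp_space_diff[OF p1(1) f gL])
    have "AE x in lborel. T (\<lambda>y. g y + (f y - g y)) x = T g x + T (\<lambda>y. f y - g y) x"
    proof -
      have "\<forall>f\<in>Lp_space p. \<forall>g\<in>Lp_space p. AE x in lborel. T (\<lambda>y. f y + g y) x = T f x + T g x"
        using b unfolding bounded_Lp_operator_def by (elim conjE)
      from bspec[OF bspec[OF this gL] dL] show ?thesis .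
    qed
    then have "Lp_norm p (T f) = Lp_norm p (\<lambda>x. T g x + T (\<lambda>y. f y - g y) x)"
      using TL[OF f] TL[OF gL] TL[OF dL] p1
      by (intro Lp_norm_cong_AE Lp_space_measurable Lp_space_add) auto
    also have "\<dots> \<le> Lp_norm p (T g) + Lp_norm p (T (\<lambda>y. f y - g y))"
      by (rule Lp_norm_triangle[OF p1(2) TL[OF gL] TL[OF dL]])
    also have "Lp_norm p (T g) \<le> C * Lp_norm p g"
      unfolding C_def by (rule transform_test_bound[OF p \<sigma> T g(1)])
    also have "Lp_norm p g \<le> Lp_norm p f + Lp_norm p (\<lambda>x. g x - f x)"
      by (rule Lp_norm_le_add_diff[OF p1(2) gL f])
    also have "Lp_norm p (T (\<lambda>y. f y - g y)) \<le> K * Lp_norm p (\<lambda>x. g x - f x)"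
      using K[OF dL] by (simp add: Lp_norm_minus_commute[of p f g])
    also have "K * Lp_norm p (\<lambda>x. g x - f x) \<le> \<bar>K\<bar> * e"
      using g(2) by (intro mult_mono) (auto simp: Lp_norm_nonneg)
    finally have "Lp_norm p (T f) \<le> C * (Lp_norm p f + Lp_norm p (\<lambda>x. g x - f x)) + \<bar>K\<bar> * e"
      using C by simp
    also have "C * (Lp_norm p f + Lp_norm p (\<lambda>x. g x - f x)) \<le> C * (Lp_norm p f + e)"
      using C g(2) by (intro mult_left_mono) auto
    finally show ?thesis by (simp add: algebra_simps)
  qed
  note * = this
  have "Lp_norm p (T f) \<le> C * Lp_norm p f + d" if d: "d > 0" for d
  proof -
    have "C + \<bar>K\<bar> > 0" using C by linarith
    then show ?thesis using *[of "d / (C + \<bar>K\<bar>)"] d by simp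
  qed
  then show ?thesis unfolding C_def by (rule field_le_epsilon)
qed

theorem sharp_transform_bound_haar:
  assumes p: "1 < p" "1 / p + 1 / q = 1"
  shows "sharp_transform_bound p (hh ` nodes) (max p q - 1)"
proof -
  define C where "C = max p q - 1"
  have C: "C > 0" using p by (auto simp: C_def)
  have p1: "p > 0" "p \<ge> 1" using p by auto
  define A where "A = {Lp_opnorm p T | \<sigma> T. (\<forall>h\<in>hh ` nodes. norm (\<sigma> h) = 1) \<and> martingale_transform p (hh ` nodes) \<sigma> T}"
  have ne: "{f :: 'a \<Rightarrow> complex. f \<in> Lp_space p \<and> Lp_norm p f \<le> 1} \<noteq> {}"
    using Lp_space_0 by force
  have le: "Lp_norm p (T f) \<le> C" if "\<forall>h\<in>hh ` nodes. norm (\<sigma> h) = 1" "martingale_transform p (hh ` nodes) \<sigma> T"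
    "f \<in> Lp_space p" "Lp_norm p f \<le> 1" for \<sigma> T f
  proof -
    have "Lp_norm p (T f) \<le> C * Lp_norm p f" unfolding C_def by (rule transform_bound[OF p that(1-3)])
    also have "\<dots> \<le> C * 1" using C that(4) by (intro mult_left_mono) auto
    finally show ?thesis by simp
  qed
  have upper: "Lp_opnorm p T \<le> C" if "\<forall>h\<in>hh ` nodes. norm (\<sigma> h) = 1" "martingale_transform p (hh ` nodes) \<sigma> T" for \<sigma> T
    unfolding Lp_opnorm_def by (rule cSUP_least[OF ne]) (use le[OF that] in auto)
  have opnorm: "Lp_norm p (T f) \<le> Lp_opnorm p T" if "\<forall>h\<in>hh ` nodes. norm (\<sigma> h) = 1" "martingale_transform p (hh ` nodes) \<sigma> T"
    "f \<in> Lp_space p" "Lp_norm p f \<le> 1" for \<sigma> T f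
    unfolding Lp_opnorm_def by (rule cSUP_upper) (use that le[OF that(1,2)] in \<open>auto simp: bdd_above_def\<close>)
  have bdd: "bdd_above A" using upper by (auto simp: A_def bdd_above_def)
  have ex: "\<exists>T. martingale_transform p (hh ` nodes) \<sigma> T" if "\<forall>h\<in>hh ` nodes. norm (\<sigma> h) = 1" for \<sigma>
    by (rule transform_exists[OF p that]) blast
  have Ane: "A \<noteq> {}"
  proof -
    obtain T where "martingale_transform p (hh ` nodes) (\<lambda>_. 1) T" using ex[of "\<lambda>_. 1"] by auto
    then have "Lp_opnorm p T \<in> A"
      unfolding A_def by (intro CollectI exI[of _ "\<lambda>_. 1"] exI[of _ T]) simp
    then show ?thesis by blast
  qed
  have "Sup A = C"
  proof (rule antisym)
    show "Sup A \<le> C" by (rule cSup_least[OF Ane]) (use upper in \<open>auto simp: A_def\<close>)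
    show "C \<le> Sup A"
    proof (rule ccontr)
      assume less: "\<not> C \<le> Sup A"
      have S0: "Sup A \<ge> 0"
      proof -
        obtain T where T: "martingale_transform p (hh ` nodes) (\<lambda>_. 1) T" using ex[of "\<lambda>_. 1"] by auto
        have "0 \<le> Lp_norm p (T (\<lambda>x. 0))" by (rule Lp_norm_nonneg)
        also have "\<dots> \<le> Lp_opnorm p T" by (rule opnorm[OF _ T]) (auto simp: Lp_space_0)
        also have "\<dots> \<le> Sup A" by (rule cSup_upper[OF _ bdd]) (unfold A_def, intro CollectI exI[of _ "\<lambda>_. 1"] exI[of _ T], simp add: T)
        finally show ?thesis .
      qed
      obtain F c s where F: "finite F" "F \<subseteq> nodes" "\<And>i. cmod (s i) = 1"
        "Sup A * Lp_norm p (haar_sum c F) < Lp_norm p (haar_sum (\<lambda>i. s i * c i) F)"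
        by (rule finite_transform_sharp[OF p S0]) (use less in \<open>auto simp: C_def\<close>)
      \<comment> \<open>The coefficients found for nodes are carried over to functions through the
        inverse of \<open>hh\<close>.\<close>
      define \<sigma> where "\<sigma> h = s (the_inv_into nodes hh h)" for h
      have \<sigma>1: "\<forall>h\<in>hh ` nodes. norm (\<sigma> h) = 1" by (simp add: \<sigma>_def F(3))
      have \<sigma>hh: "\<sigma> (hh i) = s i" if "i \<in> nodes" for i
        using the_inv_into_f_f[OF hh_inj that] by (simp add: \<sigma>_def)
      obtain T where T: "martingale_transform p (hh ` nodes) \<sigma> T"
        "\<And>f. f \<in> Lp_space p \<Longrightarrow> transform_graph p (\<lambda>i. \<sigma> (hh i)) f (T f)"
        by (rule transform_exists[OF p \<sigma>1]) (rule that, assumption, simp)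
      define f g where "f = haar_sum c F" and "g = haar_sum (\<lambda>i. s i * c i) F"
      have fL: "f \<in> Lp_space p" and gL: "g \<in> Lp_space p"
        unfolding f_def g_def by (rule haar_sum_in_Lp[OF p1(1)])+
      have "g = haar_sum (\<lambda>i. \<sigma> (hh i) * c i) F"
        unfolding g_def haar_sum_def using F(2) \<sigma>hh by (intro ext sum.cong) auto
      then have Gfg: "transform_graph p (\<lambda>i. \<sigma> (hh i)) f g"
        using transform_graph_finite[OF p1(1) F(1,2), of "\<lambda>i. \<sigma> (hh i)" c] by (simp add: f_def)
      define a where "a = Lp_norm p f"
      \<comment> \<open>If \<open>f\<close> had norm 0, the upper bound would give \<open>g\<close>
        norm 0 as well, against the strict inequality.\<close>
      have a0: "a > 0"
      proof (rule ccontr)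
        assume "\<not> a > 0"
        then have "a = 0" using Lp_norm_nonneg[of p f] by (simp add: a_def)
        moreover have "Lp_norm p g \<le> (max p q - 1) * Lp_norm p f"
          by (rule transform_graph_bound[OF p _ Gfg]) (use \<sigma>1 in auto)
        ultimately show False using F(4) Lp_norm_nonneg[of p g] by (simp add: a_def f_def g_def)
      qed
      define f' g' where "f' x = complex_of_real (1 / a) * f x" and "g' x = complex_of_real (1 / a) * g x" for x
      have f'L: "f' \<in> Lp_space p" unfolding f'_def by (rule Lp_space_cmult[OF p1(1) fL])
      have n: "Lp_norm p f' = 1" "Lp_norm p g' = Lp_norm p g / a"
        unfolding f'_def g'_def Lp_norm_cmult[OF p1(1)] using a0 by (simp_all add: a_def norm_divide)
      have "transform_graph p (\<lambda>i. \<sigma> (hh i)) (\<lambda>x. 0) (\<lambda>x. 0)"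
        using transform_graph_finite[OF p1(1), of "{}" "\<lambda>i. \<sigma> (hh i)"] by (simp add: haar_sum_def[abs_def])
      from transform_graph_lin[OF p(1) this Gfg, of "complex_of_real (1 / a)"]
      have G': "transform_graph p (\<lambda>i. \<sigma> (hh i)) f' g'" by (simp add: f'_def[abs_def] g'_def[abs_def])
      have "AE x in lborel. T f' x = g' x"
        by (rule transform_graph_unique[OF p(1) _ T(2)[OF f'L] G']) (use \<sigma>1 in auto)
      moreover have "T f' \<in> Lp_space p" "g' \<in> Lp_space p"
        using T(2)[OF f'L] G' by (simp_all add: transform_graph_def)
      ultimately have "Lp_norm p (T f') = Lp_norm p g / a"
        unfolding n(2)[symmetric] by (intro Lp_norm_cong_AE Lp_space_measurable)
      then have "Lp_norm p g / a \<le> Lp_opnorm p T" using opnorm[OF \<sigma>1 T(1) f'L] n(1) by simp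
      also have "\<dots> \<le> Sup A" by (rule cSup_upper[OF _ bdd]) (use T(1) \<sigma>1 in \<open>auto simp: A_def\<close>)
      finally show False using F(4) a0 by (simp add: a_def f_def g_def pos_divide_le_eq)
    qed
  qed
  then show ?thesis
    unfolding sharp_transform_bound_def using ex upper by (auto simp: A_def C_def)
qed

end


section \<open>Cells with many children\<close>

text \<open>Only one \<open>l\<close> can contribute, namely \<open>P mod s\<close>.\<close>

lemma sum_block_of_bool:
  fixes P s i :: nat
  assumes s: "s > 0"
  shows "(\<Sum>l<s. of_bool (i * s + l = P)) = (of_bool (P div s = i) :: real)"
proof -
  have "(\<Sum>l<s. of_bool (i * s + l = P)) = (\<Sum>l<s. if P mod s = l then of_bool (P div s = i) else (0::real))"
  proof (rule sum.cong[OF refl])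
    fix l assume l: "l \<in> {..<s}"
    have "i * s + l = P \<longleftrightarrow> P mod s = l \<and> P div s = i"
    proof
      assume "i * s + l = P"
      then show "P mod s = l \<and> P div s = i" using l s by auto
    next
      assume "P mod s = l \<and> P div s = i"
      then show "i * s + l = P" using div_mult_mod_eq[of P s] by simp
    qed
    then show "of_bool (i * s + l = P) = (if P mod s = l then of_bool (P div s = i) else (0::real))" by auto
  qed
  also have "\<dots> = of_bool (P div s = i)" using s by (subst sum.delta') auto
  finally show ?thesis .
qed

lemma div_eq_iff_block:
  fixes c P i :: nat
  assumes "c > 0"
  shows "P div c = i \<longleftrightarrow> i * c \<le> P \<and> P < Suc i * c"
proof
  assume "P div c = i"
  then show "i * c \<le> P \<and> P < Suc i * c"
    using dividend_less_div_times[OF assms, of P] div_times_less_eq_dividend[of P c] by simp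
next
  assume "i * c \<le> P \<and> P < Suc i * c"
  then show "P div c = i" by (intro div_nat_eqI) (simp_all add: mult.commute)
qed

text \<open>\<open>loc k x\<close> labels the cell of side \<open>2\<^sup>k\<close> that contains \<open>x\<close>, and \<open>q k m\<close> enumerates the labels
  of the \<open>2\<^sup>d\<close> children, of side \<open>2\<^sup>k\<^sup>-\<^sup>1\<close>, of the cell \<open>m\<close> of side \<open>2\<^sup>k\<close>.\<close>

locale cell_structure =
  fixes loc :: "int \<Rightarrow> 'a::euclidean_space \<Rightarrow> 'm" and par :: "'m \<Rightarrow> 'm" and d :: nat
    and q :: "int \<Rightarrow> 'm \<Rightarrow> nat \<Rightarrow> 'm" and \<kappa> :: real
  assumes d_pos: "d > 0" and \<kappa>_pos: "\<kappa> > 0"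
    and loc_par: "par (loc k x) = loc (k + 1) x"
    and children: "bij_betw (q k m) {..<2 ^ d} {m'. par m' = m}"
    and loc_measurable: "{y. loc k y = m} \<in> sets borel"
    and loc_measure: "emeasure lborel {y. loc k y = m} = ennreal (\<kappa> * 2 powi (int d * k))"
    and loc_diam: "\<exists>D. \<forall>k x y. loc k x = loc k y \<longrightarrow> dist x y \<le> D * 2 powi k"
begin

definition pos :: "int \<Rightarrow> 'a \<Rightarrow> nat" where
  "pos k x = inv_into {..<2 ^ d} (q k (loc k x)) (loc (k - 1) x)"

text \<open>Division with remainder writes a generation as \<open>T = d * (k - 1) + r + 1\<close>
  with \<open>r < d\<close>. Its atoms are blocks of \<open>2 ^ (r + 1)\<close> consecutive children
  of the cells of side \<open>2 powi k\<close>; the shift by 1 makes \<open>T = d * k\<close> the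
  generation of the whole cells.\<close>

definition tree_level :: "int \<Rightarrow> int" where "tree_level T = (T - 1) div int d + 1"

definition tree_depth :: "int \<Rightarrow> nat" where "tree_depth T = nat ((T - 1) mod int d)"

definition tree_label :: "int \<Rightarrow> 'a \<Rightarrow> 'm \<times> nat" where
  "tree_label T x = (loc (tree_level T) x, pos (tree_level T) x div 2 ^ Suc (tree_depth T))"

text \<open>Even means the first half of the block, the one that carries the positive sign in the
  Haar functions.\<close>

definition tree_bit :: "int \<Rightarrow> 'a \<Rightarrow> bool" where
  "tree_bit T x = even (pos (tree_level T) x div 2 ^ tree_depth T)"

section \<open>The position of a point among the children, and the binary tree of blocks\<close>

lemma child_par: "l < 2 ^ d \<Longrightarrow> par (q k m l) = m"
  using children[of k m] by (auto simp: bij_betw_def)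

lemma child_inj: "l < 2 ^ d \<Longrightarrow> l' < 2 ^ d \<Longrightarrow> q k m l = q k m l' \<longleftrightarrow> l = l'"
  using children[of k m] by (auto simp: bij_betw_def inj_on_def)

lemma pos_less: "pos k x < 2 ^ d" and q_pos: "q k (loc k x) (pos k x) = loc (k - 1) x"
proof -
  have "loc (k - 1) x \<in> q k (loc k x) ` {..<2 ^ d}"
    using children[of k "loc k x"] loc_par[of "k - 1" x] by (auto simp: bij_betw_def)
  then show "pos k x < 2 ^ d" "q k (loc k x) (pos k x) = loc (k - 1) x"
    using inv_into_into[of "loc (k - 1) x" "q k (loc k x)" "{..<2 ^ d}"]
      f_inv_into_f[of "loc (k - 1) x" "q k (loc k x)" "{..<2 ^ d}"] by (auto simp: pos_def)
qed

lemma child_iff: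
  assumes "l < 2 ^ d"
  shows "loc (k - 1) x = q k m l \<longleftrightarrow> loc k x = m \<and> pos k x = l"
proof
  assume e: "loc (k - 1) x = q k m l"
  then have m: "loc k x = m" using child_par[OF assms] loc_par[of "k - 1" x] by simp
  have "q k m (pos k x) = q k m l" using q_pos[of k x] e m by simp
  then show "loc k x = m \<and> pos k x = l" using m child_inj[OF pos_less assms] by simp
next
  assume "loc k x = m \<and> pos k x = l"
  then show "loc (k - 1) x = q k m l" using q_pos[of k x] by simp
qed

lemma loc_pos_eq_iff: "loc k x = loc k y \<and> pos k x = pos k y \<longleftrightarrow> loc (k - 1) x = loc (k - 1) y"
proof
  assume "loc k x = loc k y \<and> pos k x = pos k y"
  then show "loc (k - 1) x = loc (k - 1) y" using q_pos[of k x] q_pos[of k y] by simp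
next
  assume "loc (k - 1) x = loc (k - 1) y"
  then have "loc (k - 1) x = q k (loc k y) (pos k y)" using q_pos[of k y] by simp
  then show "loc k x = loc k y \<and> pos k x = pos k y" by (simp only: child_iff[OF pos_less])
qed

lemma tree_decomp: "T = int d * (tree_level T - 1) + int (tree_depth T) + 1" "tree_depth T < d"
proof -
  have "0 \<le> (T - 1) mod int d" "(T - 1) mod int d < int d" using d_pos by auto
  then show "T = int d * (tree_level T - 1) + int (tree_depth T) + 1" "tree_depth T < d"
    using mult_div_mod_eq[of "int d" "T - 1"] by (auto simp: tree_level_def tree_depth_def)
qed

lemma tree_unique:
  assumes "T = int d * (k - 1) + int r + 1" "r < d"
  shows "tree_level T = k" "tree_depth T = r"
proof -
  have "T - 1 = int r + (k - 1) * int d" using assms by (simp add: algebra_simps)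
  then have "(T - 1) div int d = k - 1" "(T - 1) mod int d = int r" using assms d_pos by simp_all
  then show "tree_level T = k" "tree_depth T = r" by (simp_all add: tree_level_def tree_depth_def)
qed

lemma power_split: "r < d \<Longrightarrow> (2::nat) ^ d = 2 ^ (d - Suc r) * 2 ^ Suc r"
  by (subst power_add[symmetric]) simp

lemma block_eq:
  assumes r: "r < d" and i: "i < 2 ^ (d - Suc r)"
  shows "{y. loc k y = m \<and> pos k y div 2 ^ Suc r = i}
    = (\<Union>l\<in>{i * 2 ^ Suc r..<Suc i * 2 ^ Suc r}. {y. loc (k - 1) y = q k m l})" (is "?L = ?R")
    and "l \<in> {i * 2 ^ Suc r..<Suc i * 2 ^ Suc r} \<Longrightarrow> l < 2 ^ d"
proof -
  have two: "(2::nat) ^ d = 2 ^ (d - Suc r) * 2 ^ Suc r" using power_split[OF r] .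
  have "Suc i * 2 ^ Suc r \<le> 2 ^ d" unfolding two using i by (intro mult_right_mono) auto
  then show l: "l \<in> {i * 2 ^ Suc r..<Suc i * 2 ^ Suc r} \<Longrightarrow> l < 2 ^ d" for l by auto
  have dv: "P div 2 ^ Suc r = i \<longleftrightarrow> P \<in> {i * 2 ^ Suc r..<Suc i * 2 ^ Suc r}" for P :: nat
    using div_eq_iff_block[of "2 ^ Suc r" P i] by simp
  show "?L = ?R"
  proof (intro set_eqI iffI)
    fix y assume "y \<in> ?L"
    then have y: "loc k y = m" "pos k y \<in> {i * 2 ^ Suc r..<Suc i * 2 ^ Suc r}" using dv by auto
    then have "loc (k - 1) y = q k m (pos k y)" using child_iff[OF pos_less] by blast
    then show "y \<in> ?R" using y(2) by blast
  next
    fix y assume "y \<in> ?R"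
    then obtain l' where l': "l' \<in> {i * 2 ^ Suc r..<Suc i * 2 ^ Suc r}" "loc (k - 1) y = q k m l'" by blast
    then have "loc k y = m" "pos k y = l'" using child_iff[OF l[OF l'(1)]] by auto
    then show "y \<in> ?L" using dv l'(1) by simp
  qed
qed

lemma block_measurable:
  assumes r: "r < d" and i: "i < 2 ^ (d - Suc r)"
  shows "{y. loc k y = m \<and> pos k y div 2 ^ Suc r = i} \<in> sets borel"
  unfolding block_eq(1)[OF r i] by (intro sets.finite_UN loc_measurable) auto

lemma block_measure:
  assumes r: "r < d" and i: "i < 2 ^ (d - Suc r)"
  shows "emeasure lborel {y. loc k y = m \<and> pos k y div 2 ^ Suc r = i}
     = ennreal (\<kappa> * 2 powi (int d * (k - 1) + int r + 1))"
proof -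
  let ?I = "{i * 2 ^ Suc r..<Suc i * 2 ^ Suc r}"
  have "emeasure lborel {y. loc k y = m \<and> pos k y div 2 ^ Suc r = i}
    = (\<Sum>l\<in>?I. emeasure lborel {y. loc (k - 1) y = q k m l})"
    unfolding block_eq(1)[OF r i]
  proof (rule sum_emeasure[symmetric])
    show "disjoint_family_on (\<lambda>l. {y. loc (k - 1) y = q k m l}) ?I"
      using child_inj[OF block_eq(2)[OF r i] block_eq(2)[OF r i]] by (auto simp: disjoint_family_on_def)
  qed (auto simp: loc_measurable)
  also have "\<dots> = ennreal (real (2 ^ Suc r) * (\<kappa> * 2 powi (int d * (k - 1))))"
  proof -
    have "card ?I = 2 ^ Suc r" by simp
    then have "(\<Sum>l\<in>?I. emeasure lborel {y. loc (k - 1) y = q k m l})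
        = of_nat (2 ^ Suc r) * ennreal (\<kappa> * 2 powi (int d * (k - 1)))"
      unfolding loc_measure sum_constant by simp
    then show ?thesis
      using \<kappa>_pos by (simp only: ennreal_of_nat_eq_real_of_nat) (subst ennreal_mult, simp_all)
  qed
  also have "real (2 ^ Suc r) * (\<kappa> * 2 powi (int d * (k - 1))) = \<kappa> * 2 powi (int d * (k - 1) + int r + 1)"
    by (simp add: power_int_add)
  finally show ?thesis .
qed

lemma pos_block_less: "r < d \<Longrightarrow> pos k x div 2 ^ Suc r < 2 ^ (d - Suc r)"
proof -
  assume r: "r < d"
  have "pos k x < 2 ^ (d - Suc r) * 2 ^ Suc r" using pos_less[of k x] unfolding power_split[OF r] .
  then show ?thesis by (rule less_mult_imp_div_less)
qed

lemma label_div: "P div 2 ^ Suc r = P div 2 ^ r div (2::nat)"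
  by (simp add: div_mult2_eq[symmetric] mult.commute)

lemma div_eq_iff_parity:
  "P div 2 ^ r = P' div (2::nat) ^ r \<longleftrightarrow> P div 2 ^ Suc r = P' div 2 ^ Suc r \<and> (even (P div 2 ^ r) \<longleftrightarrow> even (P' div 2 ^ r))"
  unfolding label_div by (metis dvd_mult_div_cancel odd_two_times_div_two_succ)

sublocale tree: binary_filtration tree_label tree_bit \<kappa>
proof
  fix T :: int and x y :: 'a
  let ?k = "tree_level T" and ?r = "tree_depth T"
  have bit: "tree_label T x = tree_label T y \<and> tree_bit T x = tree_bit T y
      \<longleftrightarrow> loc ?k x = loc ?k y \<and> pos ?k x div 2 ^ ?r = pos ?k y div 2 ^ ?r"
    using div_eq_iff_parity[of "pos ?k x" ?r "pos ?k y"] by (auto simp: tree_label_def tree_bit_def)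
  show "tree_label (T - 1) x = tree_label (T - 1) y \<longleftrightarrow> tree_label T x = tree_label T y \<and> tree_bit T x = tree_bit T y"
  proof (cases "?r = 0")
    case True
    \<comment> \<open>Going below depth 0 enters the next finer scale at depth \<open>d - 1\<close>,
      where a block is a whole cell and the block index is 0.\<close>
    have "T - 1 = int d * (?k - 1 - 1) + int (d - 1) + 1"
      using tree_decomp(1)[of T] True d_pos by (simp add: algebra_simps of_nat_diff)
    from tree_unique[OF this] have l: "tree_level (T - 1) = ?k - 1" "Suc (tree_depth (T - 1)) = d" using d_pos by auto
    have "tree_label (T - 1) x = tree_label (T - 1) y \<longleftrightarrow> loc (?k - 1) x = loc (?k - 1) y"
      unfolding tree_label_def l using pos_less[of "?k - 1" x] pos_less[of "?k - 1" y] by simp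
    then show ?thesis unfolding bit using loc_pos_eq_iff[of ?k x y] True by simp
  next
    case False
    have "T - 1 = int d * (?k - 1) + int (?r - 1) + 1" "?r - 1 < d"
      using tree_decomp[of T] False by (auto simp: of_nat_diff)
    from tree_unique[OF this] have l: "tree_level (T - 1) = ?k" "Suc (tree_depth (T - 1)) = ?r" using False by auto
    show ?thesis unfolding bit unfolding tree_label_def l by simp
  qed
next
  fix T :: int and x :: 'a
  let ?k = "tree_level T" and ?r = "tree_depth T"
  have e: "{y. tree_label T y = tree_label T x} = {y. loc ?k y = loc ?k x \<and> pos ?k y div 2 ^ Suc ?r = pos ?k x div 2 ^ Suc ?r}"
    by (auto simp: tree_label_def)
  note r = tree_decomp(2)[of T]
  show "{y. tree_label T y = tree_label T x} \<in> sets borel"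
    unfolding e by (rule block_measurable[OF r pos_block_less[OF r]])
  show "emeasure lborel {y. tree_label T y = tree_label T x} = ennreal (\<kappa> * 2 powi T)"
    unfolding e block_measure[OF r pos_block_less[OF r]] using tree_decomp(1)[of T] by simp
next
  obtain D where D: "\<And>k x y. loc k x = loc k y \<Longrightarrow> dist x y \<le> D * 2 powi k" using loc_diam by auto
  have D0: "D \<ge> 0" using D[of 0 0 0] by simp
  have DT: "dist x y \<le> D * 2 powi (tree_level T)" if "tree_label T x = tree_label T y" for T x y
    using that D by (simp add: tree_label_def)
  then show "\<exists>C. \<forall>x y. tree_label T x = tree_label T y \<longrightarrow> dist x y \<le> C" for T by blast
  fix e :: real assume e: "e > 0"
  then have "e / (D + 1) > 0" using D0 by simp
  then obtain n where n: "(1/2::real) ^ n < e / (D + 1)" using real_arch_pow_inv[of "e / (D + 1)" "1/2"] by auto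
  show "\<exists>t0. \<forall>t\<le>t0. \<forall>x y. tree_label t x = tree_label t y \<longrightarrow> dist x y < e"
  proof (intro exI allI impI)
    fix t x y assume t: "t \<le> int d * (- int n)" and xy: "tree_label t x = tree_label t y"
    have "tree_level t \<le> - int n"
    proof (rule ccontr)
      assume "\<not> tree_level t \<le> - int n"
      then have "int d * (- int n) \<le> int d * (tree_level t - 1)" by (intro mult_left_mono) simp_all
      with tree_decomp(1)[of t] t show False by linarith
    qed
    then have "(2::real) powi (tree_level t) \<le> 2 powi (- int n)" by (rule power_int_increasing) simp
    also have "\<dots> = (1/2) ^ n" by (simp add: power_int_minus power_divide inverse_eq_divide)
    finally have "D * 2 powi (tree_level t) \<le> D * (1/2) ^ n" using D0 by (intro mult_left_mono)
    also have "\<dots> \<le> (D + 1) * (1/2) ^ n" by (intro mult_right_mono) auto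
    also have "\<dots> < e" using n D0 by (simp add: pos_less_divide_eq mult.commute)
    finally show "dist x y < e" using DT[OF xy] by linarith
  qed
qed (rule \<kappa>_pos)

section \<open>Haar functions of cells with many children\<close>

text \<open>A block of \<open>2 ^ (d - j)\<close> children is compared half against half, with
  positions counted from 0. Its measure is \<open>\<kappa> * 2 powi (d * k - j)\<close>, that of an
  atom of generation \<open>d * k - j\<close>, so the normalization agrees with the one in the
  binary tree.\<close>

definition cell_haar :: "int \<Rightarrow> 'm \<Rightarrow> nat \<Rightarrow> nat \<Rightarrow> 'a \<Rightarrow> real" where
  "cell_haar k m j i x =
     ((\<Sum>l<2 ^ (d - j - 1). of_bool (loc (k - 1) x = q k m (i * 2 ^ (d - j) + l)))
      - (\<Sum>l<2 ^ (d - j - 1). of_bool (loc (k - 1) x = q k m (i * 2 ^ (d - j) + 2 ^ (d - j - 1) + l))))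
     / sqrt (\<kappa> * 2 powi (int d * k - int j))"

lemma tree_node:
  assumes "j < d"
  shows "tree_level (int d * k - int j) = k" "tree_depth (int d * k - int j) = d - j - 1"
proof -
  have "int d * k - int j = int d * (k - 1) + int (d - j - 1) + 1" "d - j - 1 < d"
    using assms by (auto simp: algebra_simps of_nat_diff)
  from tree_unique[OF this] show "tree_level (int d * k - int j) = k" "tree_depth (int d * k - int j) = d - j - 1" .
qed

lemma nodes_eq: "tree.nodes = {(int d * k - int j, (m :: 'm, i :: nat)) | k m j i. j < d \<and> i < 2 ^ j}"
proof (intro set_eqI iffI)
  fix z assume "z \<in> tree.nodes"
  then obtain T x where z: "z = (T, tree_label T x)" by (auto simp: tree.nodes_def)
  define j where "j = d - 1 - tree_depth T"
  have j: "j < d" "T = int d * tree_level T - int j" "j = d - Suc (tree_depth T)"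
    using tree_decomp[of T] d_pos by (auto simp: j_def algebra_simps of_nat_diff)
  have "pos (tree_level T) x div 2 ^ Suc (tree_depth T) < 2 ^ j"
    unfolding j(3) by (rule pos_block_less[OF tree_decomp(2)])
  then show "z \<in> {(int d * k - int j, (m :: 'm, i :: nat)) | k m j i. j < d \<and> i < 2 ^ j}"
    using j(1,2) unfolding z tree_label_def by blast
next
  fix z assume "z \<in> {(int d * k - int j, (m :: 'm, i :: nat)) | k m j i. j < d \<and> i < 2 ^ j}"
  then obtain k m j i where z: "z = (int d * k - int j, (m, i))" and j: "j < d" and i: "i < 2 ^ j" by auto
  let ?T = "int d * k - int j"
  have r: "d - j - 1 < d" "d - Suc (d - j - 1) = j" using j by auto
  \<comment> \<open>Every pair of a cell and an admissible block index occurs as a label, because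
    the block has positive measure and hence contains a point.\<close>
  have "emeasure lborel {y. loc k y = m \<and> pos k y div 2 ^ Suc (d - j - 1) = i} > 0"
    using block_measure[OF r(1), of i k m] i \<kappa>_pos unfolding r(2) by simp
  then have "{y. loc k y = m \<and> pos k y div 2 ^ Suc (d - j - 1) = i} \<noteq> {}"
    by (intro notI) (simp only: emeasure_empty less_irrefl)
  then obtain x where "loc k x = m" "pos k x div 2 ^ Suc (d - j - 1) = i" by auto
  then have "(m, i) = tree_label ?T x" by (simp add: tree_label_def tree_node[OF j])
  then show "z \<in> tree.nodes" by (auto simp: z tree.nodes_def)
qed

lemma haar_eq_cell_haar:
  assumes j: "j < d" and i: "i < 2 ^ j"
  shows "tree.haar (int d * k - int j, (m, i)) x = cell_haar k m j i x"
proof -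
  define s :: nat where "s = 2 ^ (d - j - 1)"
  have s: "s > 0" "2 ^ (d - j) = 2 * s" "2 ^ Suc (d - j - 1) = 2 * s"
    using j by (simp_all add: s_def flip: power_Suc)
  have bound: "i * (2 * s) + l < 2 ^ d" if "l < 2 * s" for l
  proof -
    have "i * (2 * s) + l < Suc i * (2 * s)" using that by simp
    also have "\<dots> \<le> 2 ^ j * (2 * s)" using i by (intro mult_right_mono) auto
    also have "\<dots> = 2 ^ d" unfolding s(2)[symmetric] using j by (simp flip: power_add)
    finally show ?thesis .
  qed
  let ?P = "pos k x"
  have 1: "(\<Sum>l<s. of_bool (loc (k - 1) x = q k m (i * (2 * s) + l))) = (of_bool (loc k x = m \<and> ?P div s = 2 * i) :: real)"
  proof -
    have "(\<Sum>l<s. of_bool (loc (k - 1) x = q k m (i * (2 * s) + l))) = (\<Sum>l<s. of_bool (loc k x = m) * (of_bool (2 * i * s + l = ?P) :: real))"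
      by (rule sum.cong[OF refl], subst child_iff[OF bound]) (auto simp: algebra_simps)
    also have "\<dots> = of_bool (loc k x = m) * of_bool (?P div s = 2 * i)"
      by (simp only: sum_distrib_left[symmetric] sum_block_of_bool[OF s(1)])
    finally show ?thesis by simp
  qed
  have 2: "(\<Sum>l<s. of_bool (loc (k - 1) x = q k m (i * (2 * s) + s + l))) = (of_bool (loc k x = m \<and> ?P div s = Suc (2 * i)) :: real)"
  proof -
    have "(\<Sum>l<s. of_bool (loc (k - 1) x = q k m (i * (2 * s) + s + l))) = (\<Sum>l<s. of_bool (loc k x = m) * (of_bool (Suc (2 * i) * s + l = ?P) :: real))"
    proof (rule sum.cong[OF refl])
      fix l assume "l \<in> {..<s}"
      then have "i * (2 * s) + (s + l) < 2 ^ d" by (intro bound) simp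
      then show "of_bool (loc (k - 1) x = q k m (i * (2 * s) + s + l)) = of_bool (loc k x = m) * (of_bool (Suc (2 * i) * s + l = ?P) :: real)"
        by (subst child_iff) (auto simp: algebra_simps)
    qed
    also have "\<dots> = of_bool (loc k x = m) * of_bool (?P div s = Suc (2 * i))"
      by (simp only: sum_distrib_left[symmetric] sum_block_of_bool[OF s(1)])
    finally show ?thesis by simp
  qed
  have lab: "tree_label (int d * k - int j) x = (loc k x, ?P div s div 2)" "tree_bit (int d * k - int j) x = even (?P div s)"
    unfolding tree_label_def tree_bit_def tree_node[OF j] label_div by (simp_all add: s_def)
  have "tree.haar (int d * k - int j, (m, i)) x =
    (of_bool (loc k x = m \<and> ?P div s = 2 * i) - of_bool (loc k x = m \<and> ?P div s = Suc (2 * i))) / sqrt (tree.vol (int d * k - int j))"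
  proof (cases "loc k x = m \<and> ?P div s div 2 = i")
    case True
    then show ?thesis
      unfolding tree.haar_alt lab by (cases "even (?P div s)") (auto elim!: evenE oddE)
  next
    case False
    then have "\<not> (loc k x = m \<and> ?P div s = 2 * i)" "\<not> (loc k x = m \<and> ?P div s = Suc (2 * i))" by auto
    then show ?thesis using False unfolding tree.haar_alt lab by auto
  qed
  then show ?thesis
    unfolding cell_haar_def s(2) s_def[symmetric] 1 2 tree.vol_def .
qed

theorem sharp_transform_bound_cells:
  fixes G :: "int \<Rightarrow> 'm \<Rightarrow> nat \<Rightarrow> nat \<Rightarrow> 'a \<Rightarrow> real" and p p' :: real
  assumes p: "1 < p" "1 / p + 1 / p' = 1"
    and G: "\<And>k m j i. j < d \<Longrightarrow> i < 2 ^ j \<Longrightarrow> G k m j i \<in> borel_measurable borel"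
    and AE: "\<And>k m j i. j < d \<Longrightarrow> i < 2 ^ j \<Longrightarrow> AE x in lborel. G k m j i x = cell_haar k m j i x"
  shows "sharp_transform_bound p {G k m j i | k m j i. j < d \<and> i < 2 ^ j} (max p p' - 1)"
proof -
  \<comment> \<open>The generation \<open>d * k - j\<close> with \<open>j < d\<close> determines
    \<open>k\<close> and \<open>j\<close>: they are its level and \<open>d - 1\<close> minus its
    depth.\<close>
  define hh where "hh z = G (tree_level (fst z)) (fst (snd z)) (d - 1 - tree_depth (fst z)) (snd (snd z))" for z :: "int \<times> 'm \<times> nat"
  have hh: "hh (int d * k - int j, (m, i)) = G k m j i" if "j < d" for k m j i
    using that by (simp add: hh_def tree_node)
  have "haar_system tree_label tree_bit \<kappa> hh"
  proof
    fix z assume "z \<in> tree.nodes"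
    then obtain k m j i where z: "z = (int d * k - int j, (m, i))" "j < d" "i < 2 ^ j" unfolding nodes_eq by auto
    show "hh z \<in> borel_measurable borel" unfolding z(1) hh[OF z(2)] by (rule G[OF z(2,3)])
    show "AE x in lborel. hh z x = tree.haar z x"
      unfolding z(1) hh[OF z(2)] haar_eq_cell_haar[OF z(2,3)] by (rule AE[OF z(2,3)])
  qed
  from haar_system.sharp_transform_bound_haar[OF this p]
  have "sharp_transform_bound p (hh ` tree.nodes) (max p p' - 1)" .
  moreover have "hh ` tree.nodes = {G k m j i | k m j i. j < d \<and> i < 2 ^ j}"
    unfolding nodes_eq using hh by (auto simp: image_iff) (metis, metis)
  ultimately show ?thesis by simp
qed

end


section \<open>The concrete systems\<close>

text \<open>The set is squeezed between the open and the closed box with the same corners.\<close>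

lemma half_open_box:
  fixes l :: "'a::euclidean_space"
  assumes c: "c > 0"
  defines "S \<equiv> {x. \<forall>b\<in>Basis. l \<bullet> b \<le> x \<bullet> b \<and> x \<bullet> b < l \<bullet> b + c}"
  shows "S \<in> sets borel" "emeasure lborel S = ennreal (c ^ DIM('a))"
proof -
  define u where "u = l + c *\<^sub>R One"
  have u: "u \<bullet> b = l \<bullet> b + c" if "b \<in> Basis" for b using that by (simp add: u_def inner_add_left)
  have "S = (\<Inter>b\<in>Basis. {x. l \<bullet> b \<le> x \<bullet> b} \<inter> {x. x \<bullet> b < l \<bullet> b + c})" by (auto simp: S_def)
  also have "\<dots> \<in> sets borel"
    by (intro sets.finite_INT sets.Int) auto
  finally show S: "S \<in> sets borel" .
  have 1: "emeasure lborel (box l u) = ennreal (c ^ DIM('a))" "emeasure lborel (cbox l u) = ennreal (c ^ DIM('a))"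
    using c u by (simp_all add: emeasure_lborel_box emeasure_lborel_cbox inner_diff_left)
  have "emeasure lborel (box l u) \<le> emeasure lborel S"
    by (intro emeasure_mono) (use S u in \<open>auto simp: S_def box_def\<close>)
  moreover have "emeasure lborel S \<le> emeasure lborel (cbox l u)"
    by (intro emeasure_mono) (use u in \<open>auto simp: S_def cbox_def\<close>)
  ultimately show "emeasure lborel S = ennreal (c ^ DIM('a))" unfolding 1 by (rule antisym[rotated])
qed

lemma powi_double: "(2::real) powi (2 * k) = (2 powi k)\<^sup>2"
  unfolding mult_2 power2_eq_square by (rule power_int_add) simp

lemma floor_half:
  fixes s :: real
  shows "\<lfloor>s / 2 powi (k + 1)\<rfloor> = \<lfloor>s / 2 powi k\<rfloor> div 2"
  using floor_divide_real_eq_div[of 2 "s / 2 powi k"] by (simp add: power_int_add)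

lemma floor_div_eq_iff:
  fixes s :: real
  shows "\<lfloor>s / 2 powi k\<rfloor> = i \<longleftrightarrow> of_int i * 2 powi k \<le> s \<and> s < of_int i * 2 powi k + 2 powi k"
  unfolding floor_eq_iff by (simp add: pos_le_divide_eq pos_divide_less_eq algebra_simps)

subsection \<open>Linear images of planar systems\<close>

definition shear :: "real \<Rightarrow> real \<Rightarrow> real \<times> real \<Rightarrow> real \<times> real" where
  "shear c e z = (fst z + c * snd z, e * snd z)"

lemma shear_measurable [measurable]: "shear c e \<in> borel_measurable borel"
  unfolding shear_def by (intro borel_measurable_continuous_onI continuous_intros)

lemma emeasure_real_pair:
  assumes "A \<in> sets (borel :: (real \<times> real) measure)"
  shows "emeasure lborel A = (\<integral>\<^sup>+t. emeasure lborel ((\<lambda>s. (s, t)) -` A) \<partial>lborel)"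
  unfolding lborel_prod[symmetric]
  by (rule lborel_pair.emeasure_pair_measure_alt2) (unfold lborel_prod, simp add: assms)

text \<open>Fubini's theorem: on each horizontal line the shear acts as a translation, and heights
  are multiplied by \<open>e\<close>.\<close>

lemma emeasure_shear_vimage:
  assumes e: "e \<noteq> 0" and S [measurable]: "S \<in> sets borel"
  shows "emeasure lborel (shear c e -` S) = ennreal (1 / \<bar>e\<bar>) * emeasure lborel S"
proof -
  have meas: "shear c e -` S \<in> sets borel"
    using measurable_sets[OF shear_measurable S, of c e] by simp
  define \<phi> where "\<phi> t = emeasure lborel ((\<lambda>s. (s, t)) -` S)" for t
  have S': "S \<in> sets (lborel \<Otimes>\<^sub>M lborel)" unfolding lborel_prod using S by simp
  have [measurable]: "\<phi> \<in> borel_measurable borel"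
    unfolding \<phi>_def using lborel_pair.measurable_emeasure_Pair2[OF S'] by simp
  have sec: "emeasure lborel ((\<lambda>s. (s, t)) -` (shear c e -` S)) = \<phi> (e * t)" for t
  proof -
    have m: "(\<lambda>s. (s, e * t)) -` S \<in> sets borel"
      using sets_Pair2[OF S', of "e * t"] by simp
    have "(\<lambda>s. (s, t)) -` (shear c e -` S) = (\<lambda>s. c * t + s) -` ((\<lambda>s. (s, e * t)) -` S)"
      by (auto simp: shear_def add.commute)
    also have "emeasure lborel \<dots> = emeasure (distr lborel borel ((+) (c * t))) ((\<lambda>s. (s, e * t)) -` S)"
      using m by (subst emeasure_distr) auto
    also have "\<dots> = \<phi> (e * t)" by (simp add: lborel_distr_plus \<phi>_def)
    finally show ?thesis .
  qed
  have "emeasure lborel S = (\<integral>\<^sup>+t. \<phi> t \<partial>lborel)" unfolding \<phi>_def by (rule emeasure_real_pair[OF S])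
  also have "\<dots> = \<bar>e\<bar> * (\<integral>\<^sup>+t. \<phi> (e * t) \<partial>lborel)"
    using nn_integral_real_affine[of \<phi> e 0] e by simp
  also have "(\<integral>\<^sup>+t. \<phi> (e * t) \<partial>lborel) = emeasure lborel (shear c e -` S)"
    unfolding emeasure_real_pair[OF meas] sec ..
  finally have "ennreal (1 / \<bar>e\<bar>) * emeasure lborel S = (ennreal (1 / \<bar>e\<bar>) * ennreal \<bar>e\<bar>) * emeasure lborel (shear c e -` S)"
    by (simp add: mult.assoc)
  also have "ennreal (1 / \<bar>e\<bar>) * ennreal \<bar>e\<bar> = 1"
    using e by (simp flip: ennreal_mult)
  finally show ?thesis by simp
qed

lemma AE_shear:
  assumes e: "e \<noteq> 0" and ae: "AE z in lborel. P z"
  shows "AE z in lborel. P (shear c e z)"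
proof -
  obtain N where N: "N \<in> null_sets lborel" "{z. \<not> P z} \<subseteq> N"
    using ae by (auto simp: eventually_ae_filter)
  have "shear c e -` N \<in> sets borel"
    using measurable_sets[OF shear_measurable, of N c e] N by (simp add: null_sets_def)
  then have "shear c e -` N \<in> null_sets lborel"
    using emeasure_shear_vimage[OF e, of N c] N by (auto simp: null_sets_def)
  then show ?thesis by (rule AE_I') (use N(2) in auto)
qed

lemma shear_dist:
  assumes e: "e \<noteq> 0"
  shows "dist x y \<le> (1 + \<bar>c / e\<bar> + \<bar>1 / e\<bar>) * dist (shear c e x) (shear c e y)"
proof -
  define z where "z = shear c e x - shear c e y"
  have z: "fst x - fst y = fst z - c / e * snd z" "snd x - snd y = 1 / e * snd z"
    using e by (auto simp: z_def shear_def field_simps)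
  have "dist x y = norm (x - y)" by (rule dist_norm)
  also have "\<dots> \<le> norm (fst (x - y)) + norm (snd (x - y))" using norm_Pair_le[of "fst (x - y)" "snd (x - y)"] by (simp only: prod.collapse)
  also have "\<dots> \<le> (\<bar>fst z\<bar> + \<bar>c / e\<bar> * \<bar>snd z\<bar>) + \<bar>1 / e\<bar> * \<bar>snd z\<bar>"
    using z abs_triangle_ineq4[of "fst z" "c / e * snd z"] by (simp add: abs_mult)
  also have "\<dots> \<le> (norm z + \<bar>c / e\<bar> * norm z) + \<bar>1 / e\<bar> * norm z"
    using norm_fst_le[of "fst z" "snd z"] norm_snd_le[of "snd z" "fst z"]
    by (intro add_mono mult_left_mono) auto
  finally show ?thesis by (simp add: z_def dist_norm algebra_simps)
qed

text \<open>Pulling the cells back along a shear keeps parents and children; measures are divided by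
  \<open>|e|\<close>, and diameters grow at most by a constant factor.\<close>

lemma cell_structure_shear:
  assumes "cell_structure loc par d q \<kappa>" and e: "e \<noteq> 0"
  shows "cell_structure (\<lambda>k z. loc k (shear c e z)) par d q (\<kappa> / \<bar>e\<bar>)"
proof -
  interpret cell_structure loc par d q \<kappa> by fact
  show ?thesis
  proof
    show "d > 0" "\<kappa> / \<bar>e\<bar> > 0" using d_pos \<kappa>_pos e by auto
    show "par (loc k (shear c e x)) = loc (k + 1) (shear c e x)" for k x by (rule loc_par)
    show "bij_betw (q k m) {..<2 ^ d} {m'. par m' = m}" for k m by (rule children)
    have v: "{y. loc k (shear c e y) = m} = shear c e -` {y. loc k y = m}" for k m by auto
    show "{y. loc k (shear c e y) = m} \<in> sets borel" for k m
      unfolding v using measurable_sets[OF shear_measurable loc_measurable, of c e k m] by simp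
    show "emeasure lborel {y. loc k (shear c e y) = m} = ennreal (\<kappa> / \<bar>e\<bar> * 2 powi (int d * k))" for k m
      unfolding v emeasure_shear_vimage[OF e loc_measurable] loc_measure
      using \<kappa>_pos by (simp flip: ennreal_mult)
    obtain D where D: "\<And>k x y. loc k x = loc k y \<Longrightarrow> dist x y \<le> D * 2 powi k" using loc_diam by auto
    have "dist x y \<le> ((1 + \<bar>c / e\<bar> + \<bar>1 / e\<bar>) * D) * 2 powi k"
      if "loc k (shear c e x) = loc k (shear c e y)" for k x y
    proof -
      have "dist x y \<le> (1 + \<bar>c / e\<bar> + \<bar>1 / e\<bar>) * dist (shear c e x) (shear c e y)" by (rule shear_dist[OF e])
      also have "\<dots> \<le> (1 + \<bar>c / e\<bar> + \<bar>1 / e\<bar>) * (D * 2 powi k)" by (intro mult_left_mono D that) auto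
      finally show ?thesis by (simp add: mult.assoc)
    qed
    then show "\<exists>D. \<forall>k x y. loc k (shear c e x) = loc k (shear c e y) \<longrightarrow> dist x y \<le> D * 2 powi k" by blast
  qed
qed

lemma inv_planar_map:
  fixes \<alpha> \<beta> :: real
  assumes \<beta>: "\<beta> \<noteq> 0" and A: "\<And>s t. A (s, t) = (s + t * \<alpha>, t * \<beta>)"
  shows "inv A = shear (- (\<alpha> / \<beta>)) (1 / \<beta>)"
proof (rule inv_equality)
  show "shear (- (\<alpha> / \<beta>)) (1 / \<beta>) (A z) = z" for z using \<beta> by (cases z) (simp add: A shear_def)
  show "A (shear (- (\<alpha> / \<beta>)) (1 / \<beta>) z) = z" for z using \<beta> by (cases z) (simp add: A shear_def field_simps)
qed

text \<open>The inverse of \<open>A\<close> is a shear, so the image system lives on pulled-back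
  cells. Their volume constant is \<open>\<kappa> * |\<beta>|\<close>, with \<open>\<beta>\<close>
  the determinant of \<open>A\<close>, and the factor \<open>|\<beta>| powr (- 1 / 2)\<close> is
  exactly the resulting change of normalization.\<close>

proposition sharp_transform_bound_image:
  fixes A :: "real \<times> real \<Rightarrow> real \<times> real"
    and G :: "int \<Rightarrow> 'm \<Rightarrow> nat \<Rightarrow> nat \<Rightarrow> real \<times> real \<Rightarrow> real" and \<alpha> \<beta> p p' :: real
  assumes cs: "cell_structure loc par d q \<kappa>" and \<beta>: "\<beta> \<noteq> 0"
    and A: "\<And>s t. A (s, t) = (s + t * \<alpha>, t * \<beta>)"
    and p: "1 < p" "1 / p + 1 / p' = 1"
    and G: "\<And>k m j i. j < d \<Longrightarrow> i < 2 ^ j \<Longrightarrow> G k m j i \<in> borel_measurable borel"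
    and AE: "\<And>k m j i. j < d \<Longrightarrow> i < 2 ^ j \<Longrightarrow>
      AE x in lborel. G k m j i x = cell_structure.cell_haar loc d q \<kappa> k m j i x"
    and H: "H = {G k m j i | k m j i. j < d \<and> i < 2 ^ j}"
  shows "sharp_transform_bound p ((\<lambda>h z. \<bar>\<beta>\<bar> powr (- 1 / 2) * h (inv A z)) ` H) (max p p' - 1)"
proof -
  interpret cell_structure loc par d q \<kappa> by fact
  define c e where "c = - (\<alpha> / \<beta>)" and "e = 1 / \<beta>"
  have e: "e \<noteq> 0" "\<kappa> / \<bar>e\<bar> = \<kappa> * \<bar>\<beta>\<bar>" using \<beta> by (auto simp: e_def)
  have inv: "inv A = shear c e" unfolding c_def e_def by (rule inv_planar_map[OF \<beta> A])
  interpret I: cell_structure "\<lambda>k z. loc k (shear c e z)" par d q "\<kappa> / \<bar>e\<bar>"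
    by (rule cell_structure_shear[OF cs e(1)])
  define G' where "G' k m j i z = \<bar>\<beta>\<bar> powr (- 1 / 2) * G k m j i (shear c e z)" for k m j i z
  have haar: "I.cell_haar k m j i z = \<bar>\<beta>\<bar> powr (- 1 / 2) * cell_haar k m j i (shear c e z)" for k m j i z
  proof -
    have "\<bar>\<beta>\<bar> powr (- 1 / 2) = 1 / sqrt \<bar>\<beta>\<bar>"
      using \<beta> by (simp add: powr_minus_divide powr_half_sqrt)
    then show ?thesis
      unfolding I.cell_haar_def cell_haar_def
      unfolding e(2) mult.assoc mult.left_commute[of \<kappa>] real_sqrt_mult[of "\<bar>\<beta>\<bar>"]
      by (simp only: times_divide_times_eq mult_1_left)
  qed
  have "sharp_transform_bound p {G' k m j i | k m j i. j < d \<and> i < 2 ^ j} (max p p' - 1)"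
  proof (rule I.sharp_transform_bound_cells[OF p])
    fix k m j i assume ji: "j < d" "i < (2::nat) ^ j"
    have [measurable]: "G k m j i \<in> borel_measurable borel" by (rule G[OF ji])
    show "G' k m j i \<in> borel_measurable borel" unfolding G'_def by measurable
    show "AE x in lborel. G' k m j i x = I.cell_haar k m j i x"
      using AE_shear[OF e(1) AE[OF ji, of k m], of c] unfolding haar G'_def by eventually_elim simp
  qed
  moreover have "{G' k m j i | k m j i. j < d \<and> i < 2 ^ j} = (\<lambda>h z. \<bar>\<beta>\<bar> powr (- 1 / 2) * h (inv A z)) ` H"
    unfolding H inv G'_def[abs_def] by blast
  ultimately show ?thesis by simp
qed

text \<open>With four children the first function compares 0 and 1 with 2 and 3, and the other two
  split these pairs. To bring a planar system into this framework is to order the four children so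
  that its three functions take this form.\<close>

lemma (in cell_structure) cell_haar_quaternary:
  assumes "d = 2"
  defines "c \<equiv> \<lambda>k m l x. of_bool (loc (k - 1) x = q k m l) :: real"
  shows "cell_haar k m 0 0 x = (c k m 0 x + c k m 1 x - c k m 2 x - c k m 3 x) / sqrt (\<kappa> * 2 powi (2 * k))"
    and "cell_haar k m 1 0 x = (c k m 0 x - c k m 1 x) / sqrt (\<kappa> * 2 powi (2 * k - 1))"
    and "cell_haar k m 1 1 x = (c k m 2 x - c k m 3 x) / sqrt (\<kappa> * 2 powi (2 * k - 1))"
  unfolding cell_haar_def c_def unfolding assms(1)
  by (simp_all add: numeral_2_eq_2 numeral_3_eq_3 del: sum_of_bool_eq)

lemma binary_index_cases:
  assumes "j < 2" "i < (2::nat) ^ j"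
  obtains "j = 0" "i = 0" | "j = 1" "i = 0" | "j = 1" "i = 1"
  using assms by (auto simp: less_2_cases_iff)

subsection \<open>Squares\<close>

definition square_loc :: "int \<Rightarrow> real \<times> real \<Rightarrow> int \<times> int" where
  "square_loc k z = (\<lfloor>fst z / 2 powi k\<rfloor>, \<lfloor>snd z / 2 powi k\<rfloor>)"

definition square_child :: "(int \<times> int) list \<Rightarrow> int \<Rightarrow> int \<times> int \<Rightarrow> nat \<Rightarrow> int \<times> int" where
  "square_child xs k m l = (2 * fst m + fst (xs ! l), 2 * snd m + snd (xs ! l))"

lemma square_cell_structure:
  assumes xs: "distinct xs" "length xs = 4" "set xs = {0, 1} \<times> {0, 1}"
  shows "cell_structure square_loc (\<lambda>m. (fst m div 2, snd m div 2)) 2 (square_child xs) 1"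
proof
  show "(fst (square_loc k x) div 2, snd (square_loc k x) div 2) = square_loc (k + 1) x" for k x
    by (simp add: square_loc_def floor_half)
  fix k :: int and m :: "int \<times> int"
  obtain i j where m: "m = (i, j)" by (cases m)
  have "bij_betw ((!) xs) {..<2 ^ 2} ({0, 1} \<times> {0, 1})"
    using bij_betw_nth[of xs "{..<4}" "set xs"] xs by simp
  moreover have "bij_betw (\<lambda>z. (2 * i + fst z, 2 * j + snd z)) ({0, 1} \<times> {0, 1}) {m'. (fst m' div 2, snd m' div 2) = m}"
  proof (rule bij_betw_imageI)
    show "inj_on (\<lambda>z. (2 * i + fst z, 2 * j + snd z)) ({0, 1} \<times> {0, 1})" by (auto simp: inj_on_def)
    show "(\<lambda>z. (2 * i + fst z, 2 * j + snd z)) ` ({0, 1} \<times> {0, 1}) = {m'. (fst m' div 2, snd m' div 2) = m}"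
    proof (intro set_eqI iffI)
      fix m' assume "m' \<in> {m'. (fst m' div 2, snd m' div 2) = m}"
      then have h: "fst m' div 2 = i" "snd m' div 2 = j" by (auto simp: m)
      then have "m' = (2 * i + fst m' mod 2, 2 * j + snd m' mod 2)" unfolding h[symmetric] by (simp add: prod_eq_iff)
      moreover have "fst m' mod 2 \<in> {0, 1}" "snd m' mod 2 \<in> {0, 1}" by auto
      ultimately show "m' \<in> (\<lambda>z. (2 * i + fst z, 2 * j + snd z)) ` ({0, 1} \<times> {0, 1})"
        by (intro image_eqI[of _ _ "(fst m' mod 2, snd m' mod 2)"]) auto
    qed (auto simp: m)
  qed
  ultimately have "bij_betw ((\<lambda>z. (2 * i + fst z, 2 * j + snd z)) \<circ> (!) xs) {..<2 ^ 2} {m'. (fst m' div 2, snd m' div 2) = m}"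
    by (rule bij_betw_trans)
  then show "bij_betw (square_child xs k m) {..<2 ^ 2} {m'. (fst m' div 2, snd m' div 2) = m}"
    by (simp add: square_child_def[abs_def] m o_def)
  define l :: "real \<times> real" where "l = (of_int i * 2 powi k, of_int j * 2 powi k)"
  have e: "{y. square_loc k y = m} = {x. \<forall>b\<in>Basis. l \<bullet> b \<le> x \<bullet> b \<and> x \<bullet> b < l \<bullet> b + 2 powi k}"
    by (auto simp: square_loc_def m floor_div_eq_iff Basis_prod_def l_def)
  show "{y. square_loc k y = m} \<in> sets borel" unfolding e by (rule half_open_box) simp
  have "emeasure lborel {y. square_loc k y = m} = ennreal ((2 powi k) ^ DIM(real \<times> real))"
    unfolding e by (rule half_open_box) simp
  also have "(2 powi k) ^ DIM(real \<times> real) = (1 * 2 powi (int 2 * k) :: real)"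
    by (simp add: powi_double power2_eq_square)
  finally show "emeasure lborel {y. square_loc k y = m} = ennreal (1 * 2 powi (int 2 * k))" .
next
  have "dist x y \<le> 2 * 2 powi k" if "square_loc k x = square_loc k y" for k x y
  proof -
    obtain i j where ij: "square_loc k y = (i, j)" by (cases "square_loc k y")
    have "\<bar>fst x - fst y\<bar> \<le> 2 powi k" "\<bar>snd x - snd y\<bar> \<le> 2 powi k"
      using that[unfolded ij] ij by (auto simp: square_loc_def floor_div_eq_iff)
    moreover have "norm (x - y) \<le> norm (fst (x - y)) + norm (snd (x - y))" using norm_Pair_le[of "fst (x - y)" "snd (x - y)"] by (simp only: prod.collapse)
    ultimately show ?thesis by (simp add: dist_norm)
  qed
  then show "\<exists>D. \<forall>k x y. square_loc k x = square_loc k y \<longrightarrow> dist x y \<le> D * 2 powi k" by blast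
qed simp_all

text \<open>\<open>I\<close> and \<open>I'\<close> belong to the left and right half,
  \<open>J\<close> and \<open>J'\<close> to the lower and upper half; their products are the
  indicators of the four quarters.\<close>

lemma haar_square_eqs:
  fixes s t :: real
  defines "I \<equiv> \<lambda>k m. of_bool (\<lfloor>s / 2 powi (k - 1)\<rfloor> = 2 * m) :: real" and "I' \<equiv> \<lambda>k m. of_bool (\<lfloor>s / 2 powi (k - 1)\<rfloor> = 2 * m + 1)"
    and "J \<equiv> \<lambda>k m. of_bool (\<lfloor>t / 2 powi (k - 1)\<rfloor> = 2 * m) :: real" and "J' \<equiv> \<lambda>k m. of_bool (\<lfloor>t / 2 powi (k - 1)\<rfloor> = 2 * m + 1)"
  shows "haar_square1 k m n (s, t) = (I k m + I' k m) * (J' k n - J k n) / 2 powi k"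
    and "haar_square2 k m n (s, t) = (I' k m - I k m) * (J k n + J' k n) / 2 powi k"
    and "haar_square3 k m n (s, t) = (I' k m - I k m) * (J' k n - J k n) / 2 powi k"
proof -
  have ind: "indicator (dyadic_interval k m) x = (of_bool (\<lfloor>x / 2 powi k\<rfloor> = m) :: real)" for k m x
    by (auto simp: dyadic_interval_def indicator_def floor_div_eq_iff algebra_simps)
  have ind2: "indicator (dyadic_interval k m) x = (of_bool (\<lfloor>x / 2 powi (k - 1)\<rfloor> = 2 * m) + of_bool (\<lfloor>x / 2 powi (k - 1)\<rfloor> = 2 * m + 1) :: real)" for k m x
  proof -
    have "\<lfloor>x / 2 powi k\<rfloor> = \<lfloor>x / 2 powi (k - 1)\<rfloor> div 2" using floor_half[of x "k - 1"] by simp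
    then show ?thesis unfolding ind by auto
  qed
  have r: "(2 powi k) powr (- 1 / 2) * ((2 powi k) powr (- 1 / 2)) = (1 / 2 powi k :: real)" for k :: int
    by (simp add: powr_add[symmetric] powr_minus_divide)
  have alg: "(R * A) * (R * B) = A * B / w" "(R * (R * A)) * B = A * B / w" "R * A * (R * B) = A * B / w"
    if "R * R = 1 / w" for R A B w :: real
  proof -
    have "(R * A) * (R * B) = (R * R) * (A * B)" by simp
    then show "(R * A) * (R * B) = A * B / w" "(R * (R * A)) * B = A * B / w" "R * A * (R * B) = A * B / w"
      using that by (simp_all add: ac_simps)
  qed
  note defs = haar_square1_def haar_square2_def haar_square3_def haar_interval_def ind2[of k] ind[of "k - 1"]
  show "haar_square1 k m n (s, t) = (I k m + I' k m) * (J' k n - J k n) / 2 powi k"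
    "haar_square2 k m n (s, t) = (I' k m - I k m) * (J k n + J' k n) / 2 powi k"
    "haar_square3 k m n (s, t) = (I' k m - I k m) * (J' k n - J k n) / 2 powi k"
    unfolding defs I_def I'_def J_def J'_def prod.case by (rule alg[OF r])+
qed

lemma sqrt_powers:
  fixes k :: int
  shows "sqrt (2 powi (2 * k)) = 2 powi k" "sqrt (2 powi (2 * k - 1)) = 2 powi k / sqrt 2"
proof -
  show "sqrt (2 powi (2 * k)) = 2 powi k" unfolding powi_double by simp
  then show "sqrt (2 powi (2 * k - 1)) = 2 powi k / sqrt 2"
    by (simp add: power_int_diff real_sqrt_divide)
qed

lemma haar_square_measurable [measurable]:
  "haar_square1 k m n \<in> borel_measurable borel" "haar_square2 k m n \<in> borel_measurable borel"
  "haar_square3 k m n \<in> borel_measurable borel"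
proof -
  have [measurable]: "dyadic_interval k m \<in> sets borel" for k m by (simp add: dyadic_interval_def)
  have [measurable]: "haar_interval k m \<in> borel_measurable borel" for k m
    unfolding haar_interval_def[abs_def] by measurable
  show "haar_square1 k m n \<in> borel_measurable borel" "haar_square2 k m n \<in> borel_measurable borel"
    "haar_square3 k m n \<in> borel_measurable borel"
    unfolding haar_square1_def haar_square2_def haar_square3_def borel_prod[symmetric] by measurable
qed

definition square_function :: "bool \<Rightarrow> int \<Rightarrow> int \<times> int \<Rightarrow> nat \<Rightarrow> nat \<Rightarrow> real \<times> real \<Rightarrow> real" where
  "square_function dual k c j i =
     (let m = fst c; n = snd c; f = (if dual then haar_square3 k m n else haar_square1 k m n);
          g = (if dual then haar_square1 k m n else haar_square2 k m n);
          h = (if dual then haar_square2 k m n else haar_square3 k m n)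
      in if j = 0 then f else if i = 0 then (\<lambda>z. 1 / sqrt 2 * (g z + h z)) else (\<lambda>z. 1 / sqrt 2 * (g z - h z)))"

lemma quaternary_system:
  "{G k m j i | k m j i. j < 2 \<and> i < 2 ^ j} = (\<Union>k m. {G k m 0 0, G k m 1 0, G k m 1 (1::nat)})"
proof (intro set_eqI iffI)
  fix h assume "h \<in> {G k m j i | k m j i. j < 2 \<and> i < 2 ^ j}"
  then obtain k m j i where h: "h = G k m j i" "j < 2" "i < 2 ^ j" by auto
  show "h \<in> (\<Union>k m. {G k m 0 0, G k m 1 0, G k m 1 1})"
    by (rule binary_index_cases[OF h(2,3)]) (use h(1) in auto)
next
  fix h assume "h \<in> (\<Union>k m. {G k m 0 0, G k m 1 0, G k m 1 1})"
  then obtain k m where "h = G k m 0 0 \<or> h = G k m 1 0 \<or> h = G k m 1 1" by auto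
  moreover have "(0::nat) < 2" "(0::nat) < 2 ^ 0" "(1::nat) < 2" "(0::nat) < 2 ^ 1" "(1::nat) < 2 ^ 1" by auto
  ultimately show "h \<in> {G k m j i | k m j i. j < 2 \<and> i < 2 ^ j}" by blast
qed

text \<open>For the first system the order is top right, top left, bottom right, bottom left: top is
  compared with bottom, then right with left within each half. For the dual system it is top right,
  bottom left, top left, bottom right: one diagonal pair is compared with the other, and then each
  pair is split.\<close>

lemma square_function_eq:
  assumes "j < 2" "i < (2::nat) ^ j"
  shows "square_function False k m j i z =
      cell_structure.cell_haar square_loc 2 (square_child [(1, 1), (0, 1), (1, 0), (0, 0)]) 1 k m j i z"
    and "square_function True k m j i z =
      cell_structure.cell_haar square_loc 2 (square_child [(1, 1), (0, 0), (0, 1), (1, 0)]) 1 k m j i z"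
proof -
  interpret S: cell_structure square_loc "\<lambda>m. (fst m div 2, snd m div 2)" 2 "square_child [(1, 1), (0, 1), (1, 0), (0, 0)]" 1
    by (rule square_cell_structure) auto
  interpret D: cell_structure square_loc "\<lambda>m. (fst m div 2, snd m div 2)" 2 "square_child [(1, 1), (0, 0), (0, 1), (1, 0)]" 1
    by (rule square_cell_structure) auto
  obtain s t where z: "z = (s, t)" by (cases z)
  obtain a b where m: "m = (a, b)" by (cases m)
  define I where "I = (of_bool (\<lfloor>s / 2 powi (k - 1)\<rfloor> = 2 * a) :: real)"
  define I' where "I' = (of_bool (\<lfloor>s / 2 powi (k - 1)\<rfloor> = 2 * a + 1) :: real)"
  define J where "J = (of_bool (\<lfloor>t / 2 powi (k - 1)\<rfloor> = 2 * b) :: real)"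
  define J' where "J' = (of_bool (\<lfloor>t / 2 powi (k - 1)\<rfloor> = 2 * b + 1) :: real)"
  define w :: real where "w = 2 powi k"
  have w: "w > 0" by (simp add: w_def)
  have h: "haar_square1 k a b z = (I + I') * (J' - J) / w" "haar_square2 k a b z = (I' - I) * (J + J') / w"
    "haar_square3 k a b z = (I' - I) * (J' - J) / w"
    unfolding z I_def I'_def J_def J'_def w_def by (rule haar_square_eqs)+
  have c: "of_bool (square_loc (k - 1) z = (2 * a + 1, 2 * b + 1)) = I' * J'"
    "of_bool (square_loc (k - 1) z = (2 * a, 2 * b + 1)) = I * J'"
    "of_bool (square_loc (k - 1) z = (2 * a + 1, 2 * b)) = I' * J"
    "of_bool (square_loc (k - 1) z = (2 * a, 2 * b)) = I * J"
    by (simp_all add: square_loc_def z I_def I'_def J_def J'_def)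
  \<comment> \<open>The sum or difference of the two functions has twice the height on half of the
    square; with the factor \<open>1 / sqrt 2\<close> this is the normalization for half the
    volume.\<close>
  have s2: "1 / sqrt 2 * (X / w) = Y / (w / sqrt 2)" if "X = 2 * Y" for X Y
    using that w by (simp add: field_simps)
  have l: "square_child [(1, 1), (0, 1), (1, 0), (0, 0)] k m 0 = (2 * a + 1, 2 * b + 1)"
    "square_child [(1, 1), (0, 1), (1, 0), (0, 0)] k m 1 = (2 * a, 2 * b + 1)"
    "square_child [(1, 1), (0, 1), (1, 0), (0, 0)] k m 2 = (2 * a + 1, 2 * b)"
    "square_child [(1, 1), (0, 1), (1, 0), (0, 0)] k m 3 = (2 * a, 2 * b)"
    "square_child [(1, 1), (0, 0), (0, 1), (1, 0)] k m 0 = (2 * a + 1, 2 * b + 1)"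
    "square_child [(1, 1), (0, 0), (0, 1), (1, 0)] k m 1 = (2 * a, 2 * b)"
    "square_child [(1, 1), (0, 0), (0, 1), (1, 0)] k m 2 = (2 * a, 2 * b + 1)"
    "square_child [(1, 1), (0, 0), (0, 1), (1, 0)] k m 3 = (2 * a + 1, 2 * b)"
    by (simp_all add: square_child_def m)
  note eqs = S.cell_haar_quaternary[OF refl, of k m z] D.cell_haar_quaternary[OF refl, of k m z]
  show "square_function False k m j i z = S.cell_haar k m j i z"
    using assms
  proof (cases rule: binary_index_cases)
    case 1
    then show ?thesis unfolding 1 eqs l c mult_1_left sqrt_powers w_def[symmetric]
      by (simp add: square_function_def m h algebra_simps)
  next
    case 2
    have "1 / sqrt 2 * (((I' - I) * (J + J') + (I' - I) * (J' - J)) / w) = (I' * J' - I * J') / (w / sqrt 2)"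
      by (rule s2) (simp add: algebra_simps)
    then show ?thesis unfolding 2 eqs l c mult_1_left sqrt_powers w_def[symmetric]
      by (simp add: square_function_def m h add_divide_distrib)
  next
    case 3
    have "1 / sqrt 2 * (((I' - I) * (J + J') - (I' - I) * (J' - J)) / w) = (I' * J - I * J) / (w / sqrt 2)"
      by (rule s2) (simp add: algebra_simps)
    then show ?thesis unfolding 3 eqs l c mult_1_left sqrt_powers w_def[symmetric]
      by (simp add: square_function_def m h diff_divide_distrib)
  qed
  show "square_function True k m j i z = D.cell_haar k m j i z"
    using assms
  proof (cases rule: binary_index_cases)
    case 1
    then show ?thesis unfolding 1 eqs l c mult_1_left sqrt_powers w_def[symmetric]
      by (simp add: square_function_def m h algebra_simps)
  next
    case 2
    have "1 / sqrt 2 * (((I + I') * (J' - J) + (I' - I) * (J + J')) / w) = (I' * J' - I * J) / (w / sqrt 2)"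
      by (rule s2) (simp add: algebra_simps)
    then show ?thesis unfolding 2 eqs l c mult_1_left sqrt_powers w_def[symmetric]
      by (simp add: square_function_def m h add_divide_distrib)
  next
    case 3
    have "1 / sqrt 2 * (((I + I') * (J' - J) - (I' - I) * (J + J')) / w) = (I * J' - I' * J) / (w / sqrt 2)"
      by (rule s2) (simp add: algebra_simps)
    then show ?thesis unfolding 3 eqs l c mult_1_left sqrt_powers w_def[symmetric]
      by (simp add: square_function_def m h diff_divide_distrib)
  qed
qed

lemma square_function_measurable: "square_function dual k m j i \<in> borel_measurable borel"
  unfolding square_function_def Let_def by (auto intro!: borel_measurable_add borel_measurable_diff borel_measurable_times)

lemma square_system_eq:
  "square_system = {square_function False k m j i | k m j i. j < 2 \<and> i < 2 ^ j}"
  "square_system_d = {square_function True k m j i | k m j i. j < 2 \<and> i < 2 ^ j}"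
proof -
  have UN_pair: "(\<Union>c. F (fst c) (snd c)) = (\<Union>m n. F m n)" for F :: "int \<Rightarrow> int \<Rightarrow> (real \<times> real \<Rightarrow> real) set"
    by (auto simp: prod_eq_iff intro: UN_I[of "(x, y)" for x y])
  show "square_system = {square_function False k m j i | k m j i. j < 2 \<and> i < 2 ^ j}"
    "square_system_d = {square_function True k m j i | k m j i. j < 2 \<and> i < 2 ^ j}"
    unfolding quaternary_system square_system_def square_system_d_def square_function_def Let_def
    by (simp_all only: UN_pair[symmetric] if_True if_False refl One_nat_def nat.distinct simp_thms)
qed

theorem sharp_transform_bound_parallelogram:
  fixes p q b \<phi> :: real
  assumes p: "1 < p" "1 / p + 1 / q = 1" and b: "b * sin \<phi> \<noteq> 0"
  shows "sharp_transform_bound p (parallelogram_system b \<phi>) (max p q - 1)"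
    and "sharp_transform_bound p (parallelogram_system_d b \<phi>) (max p q - 1)"
proof -
  have A: "parallelogram_map b \<phi> (s, t) = (s + t * (b * cos \<phi>), t * (b * sin \<phi>))" for s t
    by (simp add: parallelogram_map_def)
  show "sharp_transform_bound p (parallelogram_system b \<phi>) (max p q - 1)"
    unfolding parallelogram_system_def
    by (rule sharp_transform_bound_image[OF square_cell_structure[of "[(1, 1), (0, 1), (1, 0), (0, 0)]"] b A p
          square_function_measurable AE_I2[OF square_function_eq(1)] square_system_eq(1)]) auto
  show "sharp_transform_bound p (parallelogram_system_d b \<phi>) (max p q - 1)"
    unfolding parallelogram_system_d_def
    by (rule sharp_transform_bound_image[OF square_cell_structure[of "[(1, 1), (0, 0), (0, 1), (1, 0)]"] b A p
          square_function_measurable AE_I2[OF square_function_eq(2)] square_system_eq(2)]) auto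
qed

subsection \<open>Cubes\<close>

definition cube_loc :: "int \<Rightarrow> real ^ 'n::finite \<Rightarrow> 'n \<Rightarrow> int" where
  "cube_loc k x = (\<lambda>i. \<lfloor>x $ i / 2 powi k\<rfloor>)"

definition cube_parent :: "('n::finite \<Rightarrow> int) \<Rightarrow> 'n \<Rightarrow> int" where
  "cube_parent m = (\<lambda>i. m i div 2)"

text \<open>The label of a subcube is recovered by inverting the injective map
  \<open>dyadic_cube\<close>; \<open>Suc l\<close> translates positions counted from 0 into an
  enumeration that starts at 1.\<close>

definition cube_child ::
  "(int \<Rightarrow> ('n::finite \<Rightarrow> int) \<Rightarrow> nat \<Rightarrow> (real ^ 'n) set) \<Rightarrow> int \<Rightarrow> ('n \<Rightarrow> int) \<Rightarrow> nat \<Rightarrow> 'n \<Rightarrow> int" where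
  "cube_child ord k m l = inv (dyadic_cube (k - 1)) (ord k m (Suc l))"

lemma dyadic_cube_eq: "dyadic_cube k m = {x. cube_loc k x = m}"
  by (auto simp: dyadic_cube_def cube_loc_def dyadic_interval_def fun_eq_iff floor_div_eq_iff algebra_simps)

lemma cube_loc_surj: "\<exists>x. cube_loc k x = m"
  by (rule exI[of _ "\<chi> i. of_int (m i) * 2 powi k"]) (simp add: cube_loc_def)

lemma dyadic_cube_inj: "inj (dyadic_cube k)"
proof (rule injI)
  fix m m' :: "'n::finite \<Rightarrow> int" assume e: "dyadic_cube k m = dyadic_cube k m'"
  obtain x where "cube_loc k x = m" using cube_loc_surj[of k m] by auto
  then show "m = m'" using e by (auto simp: dyadic_cube_eq)
qed

lemma cube_loc_parent: "cube_parent (cube_loc k x) = cube_loc (k + 1) x"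
  by (simp add: cube_loc_def cube_parent_def floor_half)

lemma subcubes_eq: "subcubes k m = dyadic_cube (k - 1) ` {m'. cube_parent m' = m}"
proof -
  have "dyadic_cube (k - 1) m' \<subseteq> dyadic_cube k m \<longleftrightarrow> cube_parent m' = m" for m'
  proof
    assume sub: "dyadic_cube (k - 1) m' \<subseteq> dyadic_cube k m"
    obtain x where x: "cube_loc (k - 1) x = m'" using cube_loc_surj[of "k - 1" m'] by auto
    then have "cube_loc k x = m" using sub by (auto simp: dyadic_cube_eq)
    then show "cube_parent m' = m" using cube_loc_parent[of "k - 1" x] x by simp
  next
    assume par: "cube_parent m' = m"
    show "dyadic_cube (k - 1) m' \<subseteq> dyadic_cube k m"
    proof
      fix x assume "x \<in> dyadic_cube (k - 1) m'"
      then have "cube_loc (k - 1) x = m'" by (simp add: dyadic_cube_eq)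
      then show "x \<in> dyadic_cube k m"
        using cube_loc_parent[of "k - 1" x] par by (simp add: dyadic_cube_eq)
    qed
  qed
  then show ?thesis unfolding subcubes_def by auto
qed

lemma cube_half_open_box:
  "{x. cube_loc k x = m} = {x. \<forall>b\<in>Basis. (\<chi> i. of_int (m i) * 2 powi k) \<bullet> b \<le> x \<bullet> b
     \<and> x \<bullet> b < (\<chi> i. of_int (m i) * 2 powi k) \<bullet> b + 2 powi k}"
  by (auto simp: cube_loc_def fun_eq_iff floor_div_eq_iff Basis_vec_def inner_axis)

context
  fixes ord :: "int \<Rightarrow> ('n::finite \<Rightarrow> int) \<Rightarrow> nat \<Rightarrow> (real ^ 'n) set"
  assumes ord: "subcube_ordering ord"
begin

lemma ord_eq: "l < 2 ^ CARD('n) \<Longrightarrow> ord k m (Suc l) = dyadic_cube (k - 1) (cube_child ord k m l)"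
proof -
  assume "l < 2 ^ CARD('n)"
  then have l: "Suc l \<in> {1..2 ^ CARD('n)}" by simp
  have "bij_betw (ord k m) {1..2 ^ CARD('n)} (subcubes k m)"
    using ord unfolding subcube_ordering_def by simp
  then have "ord k m (Suc l) \<in> subcubes k m" by (rule bij_betw_apply[OF _ l])
  then have "ord k m (Suc l) \<in> range (dyadic_cube (k - 1))" by (auto simp: subcubes_def)
  then show ?thesis unfolding cube_child_def by (simp add: f_inv_into_f)
qed

lemma cube_child_bij: "bij_betw (cube_child ord k m) {..<2 ^ CARD('n)} {m'. cube_parent m' = m}"
proof -
  let ?f = "dyadic_cube (k - 1) :: ('n \<Rightarrow> int) \<Rightarrow> (real ^ 'n) set"
  have 1: "bij_betw Suc {..<2 ^ CARD('n)} {1..2 ^ CARD('n)}"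
    by (rule bij_betw_imageI) (auto simp: image_Suc_lessThan)
  have 2: "bij_betw (ord k m) {1..2 ^ CARD('n)} (?f ` {m'. cube_parent m' = m})"
    using ord unfolding subcube_ordering_def subcubes_eq by blast
  have 3: "bij_betw (inv ?f) (?f ` {m'. cube_parent m' = m}) {m'. cube_parent m' = m}"
    by (rule bij_betw_imageI) (auto simp: image_image inv_f_f[OF dyadic_cube_inj] intro: inj_on_inv_into)
  have "bij_betw (inv ?f \<circ> (ord k m \<circ> Suc)) {..<2 ^ CARD('n)} {m'. cube_parent m' = m}"
    by (intro bij_betw_trans[OF _ 3] bij_betw_trans[OF 1 2])
  then show ?thesis by (simp add: cube_child_def[abs_def] o_def)
qed

interpretation C: cell_structure cube_loc cube_parent "CARD('n)" "cube_child ord" 1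
proof
  show "CARD('n) > 0" "(1::real) > 0" by auto
  show "cube_parent (cube_loc k x) = cube_loc (k + 1) x" for k and x :: "real ^ 'n" by (rule cube_loc_parent)
  show "bij_betw (cube_child ord k m) {..<2 ^ CARD('n)} {m'. cube_parent m' = m}" for k m by (rule cube_child_bij)
  fix k and m :: "'n \<Rightarrow> int"
  show "{y. cube_loc k y = m} \<in> sets borel" unfolding cube_half_open_box by (rule half_open_box) simp
  have "emeasure lborel {y. cube_loc k y = m} = ennreal ((2 powi k) ^ DIM(real ^ 'n))"
    unfolding cube_half_open_box by (rule half_open_box) simp
  also have "(2 powi k) ^ DIM(real ^ 'n) = (1 * 2 powi (int CARD('n) * k) :: real)"
    unfolding power_int_power' by (simp add: mult.commute)
  finally show "emeasure lborel {y. cube_loc k y = m} = ennreal (1 * 2 powi (int CARD('n) * k))" .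
next
  have "dist x y \<le> real CARD('n) * 2 powi k" if "cube_loc k x = cube_loc k y" for k and x y :: "real ^ 'n"
  proof -
    have "\<bar>(x - y) $ i\<bar> \<le> 2 powi k" for i
    proof -
      define a where "a = cube_loc k y i"
      have "\<lfloor>x $ i / 2 powi k\<rfloor> = a" "\<lfloor>y $ i / 2 powi k\<rfloor> = a"
        using fun_cong[OF that, of i] by (simp_all add: a_def cube_loc_def)
      then show ?thesis unfolding floor_div_eq_iff by auto
    qed
    then have "(\<Sum>i\<in>UNIV. \<bar>(x - y) $ i\<bar>) \<le> (\<Sum>i\<in>(UNIV::'n set). 2 powi k)" by (rule sum_mono)
    then show ?thesis using norm_le_l1_cart[of "x - y"] by (simp add: dist_norm)
  qed
  then show "\<exists>D. \<forall>k (x :: real ^ 'n) y. cube_loc k x = cube_loc k y \<longrightarrow> dist x y \<le> D * 2 powi k" by blast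
qed

lemma cube_difference_eq:
  assumes j: "j < CARD('n)" and i: "i < 2 ^ j"
  shows "cube_difference (ord k m) j i x
    = C.cell_haar k m j i x * sqrt (2 powi (int CARD('n) * k - int j))"
proof -
  define s :: nat where "s = 2 ^ (CARD('n) - j - 1)"
  have s: "2 ^ (CARD('n) - j) = s + s"
  proof -
    have "CARD('n) - j = Suc (CARD('n) - j - 1)" using j by simp
    then show ?thesis unfolding s_def by (metis mult_2 power_Suc)
  qed
  have bound: "i * (s + s) + l < 2 ^ CARD('n)" if "l < s + s" for l
  proof -
    have "i * (s + s) + l < Suc i * (s + s)" using that by simp
    also have "\<dots> \<le> 2 ^ j * (s + s)" using i by (intro mult_right_mono) auto
    also have "\<dots> = 2 ^ CARD('n)" unfolding s[symmetric] using j by (simp flip: power_add)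
    finally show ?thesis .
  qed
  have ind: "indicator (ord k m (i * (s + s) + Suc l)) x = (of_bool (cube_loc (k - 1) x = cube_child ord k m (i * (s + s) + l)) :: real)"
    if "l < s + s" for l
    using ord_eq[OF bound[OF that], of k m] by (simp add: dyadic_cube_eq indicator_def)
  have 1: "(\<Sum>l = 1..s. indicator (ord k m (i * (s + s) + l)) x)
     = (\<Sum>l<s. of_bool (cube_loc (k - 1) x = cube_child ord k m (i * (s + s) + l)) :: real)"
    unfolding One_nat_def sum.atLeast1_atMost_eq by (rule sum.cong[OF refl]) (use ind in auto)
  have 2: "(\<Sum>l = s + 1..s + s. indicator (ord k m (i * (s + s) + l)) x)
     = (\<Sum>l<s. of_bool (cube_loc (k - 1) x = cube_child ord k m (i * (s + s) + s + l)) :: real)"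
  proof -
    have "(\<Sum>l = s + 1..s + s. indicator (ord k m (i * (s + s) + l)) x)
       = (\<Sum>l = 1..s. indicator (ord k m (i * (s + s) + (l + s))) x :: real)"
      using sum.shift_bounds_cl_nat_ivl[of "\<lambda>l. indicator (ord k m (i * (s + s) + l)) x :: real" 1 s s]
      by (simp add: add.commute)
    also have "\<dots> = (\<Sum>l<s. of_bool (cube_loc (k - 1) x = cube_child ord k m (i * (s + s) + s + l)) :: real)"
      unfolding One_nat_def sum.atLeast1_atMost_eq
    proof (rule sum.cong[OF refl])
      fix l assume "l \<in> {..<s}"
      then show "indicator (ord k m (i * (s + s) + (Suc l + s))) x
          = (of_bool (cube_loc (k - 1) x = cube_child ord k m (i * (s + s) + s + l)) :: real)"
        using ind[of "s + l"] by (simp add: add.assoc add.commute add.left_commute)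
    qed
    finally show ?thesis .
  qed
  have "sqrt (2 powi (int CARD('n) * k - int j)) \<noteq> 0" by simp
  then show ?thesis
    unfolding cube_difference_def C.cell_haar_def s s_def[symmetric] 1 2 mult_1_left by simp
qed

text \<open>The norm is read off from orthonormality: \<open>C.cell_haar k m j i\<close> has norm 1,
  and the difference is the stated root times this function.\<close>

lemma Lp_norm_cube_difference:
  assumes j: "j < CARD('n)" and i: "i < 2 ^ j"
  shows "Lp_norm 2 (cube_difference (ord k m) j i) = sqrt (2 powi (int CARD('n) * k - int j))"
proof -
  define v :: real where "v = 2 powi (int CARD('n) * k - int j)"
  have v: "v > 0" by (simp add: v_def)
  have node: "(int CARD('n) * k - int j, (m, i)) \<in> C.tree.nodes"
    unfolding C.nodes_eq using j i by blast
  have "(\<integral>x. C.cell_haar k m j i x * C.cell_haar k m j i x \<partial>lborel) = 1"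
    using C.tree.haar_orthonormal(2)[OF node node] by (simp add: C.haar_eq_cell_haar[OF j i])
  moreover have "norm (cube_difference (ord k m) j i x) powr 2 = v * (C.cell_haar k m j i x * C.cell_haar k m j i x)" for x
    using v by (simp add: powr_2_eq cube_difference_eq[OF j i] power_mult_distrib v_def[symmetric] power2_eq_square[of "C.cell_haar k m j i x"])
  ultimately have "(\<integral>x. norm (cube_difference (ord k m) j i x) powr 2 \<partial>lborel) = v" by simp
  then show ?thesis using v by (simp add: Lp_norm_def powr_half_sqrt v_def[symmetric])
qed

theorem sharp_transform_bound_cubes:
  fixes p q :: real
  assumes p: "1 < p" "1 / p + 1 / q = 1"
  shows "sharp_transform_bound p (new_haar_system ord) (max p q - 1)"
proof -
  define G where "G k m j i x = cube_difference (ord k m) j i x / Lp_norm 2 (cube_difference (ord k m) j i)" for k m j i x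
  have eq: "G k m j i x = C.cell_haar k m j i x" if "j < CARD('n)" "i < 2 ^ j" for k m j i x
    unfolding G_def Lp_norm_cube_difference[OF that] cube_difference_eq[OF that] by simp
  have "sharp_transform_bound p {G k m j i | k m j i. j < CARD('n) \<and> i < 2 ^ j} (max p q - 1)"
  proof (rule C.sharp_transform_bound_cells[OF p])
    fix k m j i assume ji: "j < CARD('n)" "i < (2::nat) ^ j"
    have "G k m j i = C.tree.haar (int CARD('n) * k - int j, (m, i))"
      by (rule ext) (simp add: eq[OF ji] C.haar_eq_cell_haar[OF ji])
    then show "G k m j i \<in> borel_measurable borel" using C.tree.haar_measurable by simp
    show "AE x in lborel. G k m j i x = C.cell_haar k m j i x" by (simp add: eq[OF ji])
  qed
  moreover have "{G k m j i | k m j i. j < CARD('n) \<and> i < 2 ^ j} = new_haar_system ord"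
  proof -
    have "j < CARD('n) \<longleftrightarrow> j \<le> CARD('n) - 1" "i < 2 ^ j \<longleftrightarrow> i \<le> 2 ^ j - 1" for i j :: nat
    proof -
      have "CARD('n) \<ge> 1" "(2::nat) ^ j \<ge> 1" by (simp_all add: Suc_leI)
      then show "j < CARD('n) \<longleftrightarrow> j \<le> CARD('n) - 1" "i < 2 ^ j \<longleftrightarrow> i \<le> 2 ^ j - 1" by linarith+
    qed
    then show ?thesis unfolding new_haar_system_def G_def[abs_def] by simp
  qed
  ultimately show ?thesis by simp
qed

end

subsection \<open>Triangles\<close>

text \<open>Half-open versions of the triangles of the lattice: the cell \<open>(i, j, True)\<close> is the lower left
  half and \<open>(i, j, False)\<close> the upper right half of the dyadic square \<open>(i, j)\<close>.\<close>

definition triangle_loc :: "int \<Rightarrow> real \<times> real \<Rightarrow> int \<times> int \<times> bool" where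
  "triangle_loc k z = (\<lfloor>fst z / 2 powi k\<rfloor>, \<lfloor>snd z / 2 powi k\<rfloor>,
     fst z / 2 powi k - of_int \<lfloor>fst z / 2 powi k\<rfloor> + (snd z / 2 powi k - of_int \<lfloor>snd z / 2 powi k\<rfloor>) < 1)"

text \<open>A quarter with both coordinates even lies on the lower left side of the long diagonal,
  one with both odd on the upper right side. In the two mixed quarters the long diagonal is their
  own diagonal, so the orientation is inherited.\<close>

definition triangle_parent :: "int \<times> int \<times> bool \<Rightarrow> int \<times> int \<times> bool" where
  "triangle_parent = (\<lambda>(i, j, b). (i div 2, j div 2, if even i \<and> even j then True else if odd i \<and> odd j then False else b))"

text \<open>The child at the right angle and the central one come first, then the two at the ends of
  the hypotenuse, as the three Haar functions require. The list for the upper right half is the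
  other one after a half-turn of the square, in agreement with the scaling by
  \<open>- 1\<close>.\<close>

definition triangle_children :: "int \<times> int \<times> bool \<Rightarrow> (int \<times> int \<times> bool) list" where
  "triangle_children = (\<lambda>(i, j, b).
     if b then [(2 * i, 2 * j, True), (2 * i, 2 * j, False), (2 * i, 2 * j + 1, True), (2 * i + 1, 2 * j, True)]
     else [(2 * i + 1, 2 * j + 1, False), (2 * i + 1, 2 * j + 1, True), (2 * i + 1, 2 * j, False), (2 * i, 2 * j + 1, False)])"

lemma half_frac:
  fixes S :: real
  shows "S / 2 - of_int (\<lfloor>S\<rfloor> div 2) = (S - of_int \<lfloor>S\<rfloor>) / 2 + (if even \<lfloor>S\<rfloor> then 0 else 1 / 2)"
  by (cases "even \<lfloor>S\<rfloor>") (auto elim!: evenE oddE simp: field_simps)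

lemma triangle_loc_parent: "triangle_parent (triangle_loc k z) = triangle_loc (k + 1) z"
proof -
  define S T where "S = fst z / 2 powi k" and "T = snd z / 2 powi k"
  have half: "fst z / 2 powi (k + 1) = S / 2" "snd z / 2 powi (k + 1) = T / 2"
    by (simp_all add: S_def T_def power_int_add)
  have fl: "\<lfloor>S / 2\<rfloor> = \<lfloor>S\<rfloor> div 2" "\<lfloor>T / 2\<rfloor> = \<lfloor>T\<rfloor> div 2"
    using floor_divide_real_eq_div[of 2 S] floor_divide_real_eq_div[of 2 T] by simp_all
  define f g where "f = S - of_int \<lfloor>S\<rfloor>" and "g = T - of_int \<lfloor>T\<rfloor>"
  have fr: "0 \<le> S - of_int \<lfloor>S\<rfloor>" "S - of_int \<lfloor>S\<rfloor> < 1" "0 \<le> T - of_int \<lfloor>T\<rfloor>" "T - of_int \<lfloor>T\<rfloor> < 1"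
    by linarith+
  have "triangle_loc (k + 1) z = (\<lfloor>S\<rfloor> div 2, \<lfloor>T\<rfloor> div 2,
     (S - of_int \<lfloor>S\<rfloor>) / 2 + (if even \<lfloor>S\<rfloor> then 0 else 1 / 2) + ((T - of_int \<lfloor>T\<rfloor>) / 2 + (if even \<lfloor>T\<rfloor> then 0 else 1 / 2)) < 1)"
    unfolding triangle_loc_def half fl half_frac ..
  moreover have "triangle_parent (triangle_loc k z) = (\<lfloor>S\<rfloor> div 2, \<lfloor>T\<rfloor> div 2,
     if even \<lfloor>S\<rfloor> \<and> even \<lfloor>T\<rfloor> then True else if odd \<lfloor>S\<rfloor> \<and> odd \<lfloor>T\<rfloor> then False
     else S - of_int \<lfloor>S\<rfloor> + (T - of_int \<lfloor>T\<rfloor>) < 1)"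
    by (simp add: triangle_loc_def triangle_parent_def S_def T_def)
  \<comment> \<open>With \<open>f\<close> and \<open>g\<close> in \<open>[0, 1)\<close>, the sum of
    the fractional parts in the coarser square is \<open>(f + g) / 2\<close> plus 0, 1/2 or 1,
    depending on the number of odd coordinates. Comparison with 1 gives the three cases of
    \<open>triangle_parent\<close>.\<close>
  ultimately show ?thesis using fr unfolding f_def[symmetric] g_def[symmetric]
    by (cases "even \<lfloor>S\<rfloor>"; cases "even \<lfloor>T\<rfloor>") auto
qed

lemma triangle_children_set: "set (triangle_children m) = {m'. triangle_parent m' = m}"
proof -
  obtain i j b where m: "m = (i, j, b)" by (cases m)
  show ?thesis
  proof (intro set_eqI iffI)
    fix m' assume "m' \<in> set (triangle_children m)"
    then show "m' \<in> {m'. triangle_parent m' = m}"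
      by (auto simp: m triangle_children_def triangle_parent_def split: if_splits)
  next
    fix m' assume p: "m' \<in> {m'. triangle_parent m' = m}"
    obtain a c e where m': "m' = (a, c, e)" by (cases m')
    have ij: "a div 2 = i" "c div 2 = j" using p by (auto simp: m m' triangle_parent_def)
    have "a = 2 * i \<or> a = 2 * i + 1" "c = 2 * j \<or> c = 2 * j + 1" using ij by presburger+
    moreover have "triangle_parent (a, c, e) = (i, j, b)" using p by (simp add: m m')
    ultimately have "(a, c, e) \<in> set (triangle_children (i, j, b))"
      by (elim disjE; hypsubst; cases b; cases e; simp add: triangle_children_def triangle_parent_def)
    then show "m' \<in> set (triangle_children m)" by (simp add: m m')
  qed
qed

lemma triangle_loc_eq_iff:
  "triangle_loc k z = (i, j, b) \<longleftrightarrow> square_loc k z = (i, j) \<and>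
     (b \<longleftrightarrow> fst z / 2 powi k - of_int i + (snd z / 2 powi k - of_int j) < 1)"
  by (auto simp: triangle_loc_def square_loc_def)

lemma triangle_measure:
  shows "{z. triangle_loc k z = m} \<in> sets borel"
    and "emeasure lborel {z. triangle_loc k z = m} = ennreal (1 / 2 * 2 powi (int 2 * k))"
proof -
  interpret S: cell_structure square_loc "\<lambda>m. (fst m div 2, snd m div 2)" 2 "square_child [(1, 1), (0, 1), (1, 0), (0, 0)]" 1
    by (rule square_cell_structure) auto
  obtain i j b where m: "m = (i, j, b)" by (cases m)
  define c l d :: real where "c = 2 powi k" and "l = of_int i * 2 powi k" and "d = of_int j * 2 powi k"
  have c: "c > 0" by (simp add: c_def)
  define Q where "Q = {z. square_loc k z = (i, j)}"
  define L where "L = {z. triangle_loc k z = (i, j, True)}"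
  have Q: "Q \<in> sets borel" "emeasure lborel Q = ennreal (c * c)"
    using S.loc_measurable[of k "(i, j)"] S.loc_measure[of k "(i, j)"] by (simp_all add: Q_def powi_double c_def power2_eq_square)
  have L_eq: "L = {z. l \<le> fst z \<and> fst z < l + c \<and> d \<le> snd z \<and> snd z < d + c \<and> fst z - l + (snd z - d) < c}"
  proof -
    have "x / c - of_int i + (y / c - of_int j) < 1 \<longleftrightarrow> x - l + (y - d) < c" for x y
    proof -
      have "x / c - of_int i + (y / c - of_int j) = (x - l + (y - d)) / c"
        using c by (simp add: l_def d_def c_def[symmetric] field_simps)
      then show ?thesis using c by (simp add: pos_divide_less_eq)
    qed
    then show ?thesis unfolding L_def triangle_loc_eq_iff
      by (auto simp: square_loc_def floor_div_eq_iff l_def d_def c_def)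
  qed
  have L: "L \<in> sets borel"
  proof -
    have "L = {z. l \<le> fst z} \<inter> {z. fst z < l + c} \<inter> {z. d \<le> snd z} \<inter> {z. snd z < d + c} \<inter> {z. fst z - l + (snd z - d) < c}"
      unfolding L_eq by auto
    also have "\<dots> \<in> sets borel"
      by (intro sets.Int borel_closed borel_open closed_Collect_le open_Collect_less continuous_intros)
    finally show ?thesis .
  qed
  \<comment> \<open>Horizontal sections of the lower left triangle are intervals of length
    \<open>c - (t - d)\<close>; the upper right triangle is its complement in the square.\<close>
  have "emeasure lborel L = (\<integral>\<^sup>+t. ennreal (c - (t - d)) * indicator {d..d + c} t \<partial>lborel)"
    unfolding emeasure_real_pair[OF L]
  proof (rule nn_integral_cong)
    fix t
    have "(\<lambda>s. (s, t)) -` L = (if d \<le> t \<and> t \<le> d + c then {l..<l + (c - (t - d))} else {})"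
      unfolding L_eq by auto
    then show "emeasure lborel ((\<lambda>s. (s, t)) -` L) = ennreal (c - (t - d)) * indicator {d..d + c} t"
      by (simp add: indicator_def)
  qed
  also have "\<dots> = ennreal ((\<lambda>t. - ((c - (t - d))\<^sup>2 / 2)) (d + c) - (\<lambda>t. - ((c - (t - d))\<^sup>2 / 2)) d)"
  proof (rule nn_integral_FTC_Icc)
    show "d \<le> d + c" using c by simp
    fix t assume "t \<in> {d..d + c}"
    then show "0 \<le> c - (t - d)" by simp
    show "((\<lambda>t. - ((c - (t - d))\<^sup>2 / 2)) has_real_derivative c - (t - d)) (at t)"
      by (auto intro!: derivative_eq_intros simp: field_simps)
  qed auto
  also have "\<dots> = ennreal (1 / 2 * (c * c))" by (simp add: power2_eq_square)
  finally have mL: "emeasure lborel L = ennreal (1 / 2 * (c * c))" .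
  have "L \<subseteq> Q" unfolding L_def Q_def triangle_loc_eq_iff by auto
  then have "emeasure lborel (Q - L) = ennreal (c * c) - ennreal (1 / 2 * (c * c))"
    using L mL Q by (subst emeasure_Diff) auto
  also have "\<dots> = ennreal (1 / 2 * (c * c))" using c by (subst ennreal_minus) auto
  finally have mD: "emeasure lborel (Q - L) = ennreal (1 / 2 * (c * c))" .
  have e: "{z. triangle_loc k z = m} = (if b then L else Q - L)"
    unfolding m L_def Q_def by (auto simp: triangle_loc_eq_iff)
  show "{z. triangle_loc k z = m} \<in> sets borel" unfolding e using L Q by auto
  show "emeasure lborel {z. triangle_loc k z = m} = ennreal (1 / 2 * 2 powi (int 2 * k))"
    unfolding e using mL mD by (simp add: powi_double c_def power2_eq_square)
qed

lemma triangle_cell_structure: "cell_structure triangle_loc triangle_parent 2 (\<lambda>k m l. triangle_children m ! l) (1 / 2)"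
proof
  show "triangle_parent (triangle_loc k x) = triangle_loc (k + 1) x" for k x by (rule triangle_loc_parent)
  show "bij_betw ((!) (triangle_children m)) {..<2 ^ 2} {m'. triangle_parent m' = m}" for k :: int and m
  proof -
    have "distinct (triangle_children m)" "length (triangle_children m) = 4"
      by (auto simp: triangle_children_def split: prod.splits)
    then show ?thesis using bij_betw_nth[of "triangle_children m" "{..<4}" "{m'. triangle_parent m' = m}"]
      by (simp add: triangle_children_set)
  qed
  interpret S: cell_structure square_loc "\<lambda>m. (fst m div 2, snd m div 2)" 2 "square_child [(1, 1), (0, 1), (1, 0), (0, 0)]" 1
    by (rule square_cell_structure) auto
  have "square_loc k x = square_loc k y" if "triangle_loc k x = triangle_loc k y" for k x y
    using that by (simp add: triangle_loc_def square_loc_def)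
  then show "\<exists>D. \<forall>k x y. triangle_loc k x = triangle_loc k y \<longrightarrow> dist x y \<le> D * 2 powi k"
    using S.loc_diam by blast
qed (simp_all add: triangle_measure)

section \<open>Triangles of the lattice and their parametrization\<close>

lemma std_triangle_iff: "(x, y) \<in> std_triangle \<longleftrightarrow> 0 \<le> x \<and> 0 \<le> y \<and> x + y \<le> 1"
proof
  assume "(x, y) \<in> std_triangle"
  then show "0 \<le> x \<and> 0 \<le> y \<and> x + y \<le> 1" unfolding std_triangle_def convex_hull_3 by auto
next
  assume a: "0 \<le> x \<and> 0 \<le> y \<and> x + y \<le> 1"
  have "(x, y) = (1 - x - y) *\<^sub>R (0, 0) + x *\<^sub>R (1, 0) + y *\<^sub>R (0, 1)" by simp
  moreover have "0 \<le> 1 - x - y" "0 \<le> x" "0 \<le> y" "(1 - x - y) + x + y = 1" using a by auto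
  ultimately show "(x, y) \<in> std_triangle" unfolding std_triangle_def convex_hull_3 by blast
qed

definition triangle_sign :: "int \<times> int \<times> bool \<Rightarrow> real" where
  "triangle_sign m = (if snd (snd m) then 1 else - 1)"

definition triangle_corner :: "int \<Rightarrow> int \<times> int \<times> bool \<Rightarrow> real \<times> real" where
  "triangle_corner k m = (if snd (snd m) then (of_int (fst m) * 2 powi k, of_int (fst (snd m)) * 2 powi k)
     else ((of_int (fst m) + 1) * 2 powi k, (of_int (fst (snd m)) + 1) * 2 powi k))"

definition scaled_triangle :: "real \<times> real \<Rightarrow> real \<Rightarrow> (real \<times> real) set" where
  "scaled_triangle c r = (\<lambda>z. c + r *\<^sub>R z) ` std_triangle"

lemma scaled_triangle_eq: "scaled_triangle c r = convex hull {c, c + (r, 0), c + (0, r)}"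
  unfolding scaled_triangle_def std_triangle_def
  by (subst convex_hull_affinity[symmetric]) (simp add: zero_prod_def[symmetric])

lemma scaled_triangle_iff:
  assumes "r \<noteq> 0"
  shows "z \<in> scaled_triangle c r \<longleftrightarrow> 0 \<le> (fst z - fst c) / r \<and> 0 \<le> (snd z - snd c) / r
    \<and> (fst z - fst c) / r + (snd z - snd c) / r \<le> 1"
proof -
  have "z \<in> scaled_triangle c r \<longleftrightarrow> ((fst z - fst c) / r, (snd z - snd c) / r) \<in> std_triangle"
  proof
    assume "z \<in> scaled_triangle c r"
    then obtain w where "w \<in> std_triangle" "z = c + r *\<^sub>R w" by (auto simp: scaled_triangle_def)
    then show "((fst z - fst c) / r, (snd z - snd c) / r) \<in> std_triangle" using assms by simp
  next
    assume "((fst z - fst c) / r, (snd z - snd c) / r) \<in> std_triangle"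
    moreover have "z = c + r *\<^sub>R ((fst z - fst c) / r, (snd z - snd c) / r)" using assms by (simp add: prod_eq_iff)
    ultimately show "z \<in> scaled_triangle c r" unfolding scaled_triangle_def by blast
  qed
  then show ?thesis by (simp add: std_triangle_iff)
qed

text \<open>The triangular system quantifies over every sign and corner that describe some lattice
  triangle. These parameters have to be determined by the triangle, so that no further functions
  arise.\<close>

lemma scaled_triangle_inj:
  assumes e: "scaled_triangle c r = scaled_triangle c' r'" and r: "r \<noteq> 0" "r' = r \<or> r' = - r"
  shows "c = c' \<and> r = r'"
proof -
  have mem: "c \<in> scaled_triangle c r" "c + (r, 0) \<in> scaled_triangle c r" "c + (0, r) \<in> scaled_triangle c r" for c
    using r(1) by (simp_all add: scaled_triangle_iff)
  have r': "r' \<noteq> 0" using r by auto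
  show ?thesis
  proof (cases "r' = r")
    case True
    define X Y where "X = (fst c - fst c') / r" and "Y = (snd c - snd c') / r"
    \<comment> \<open>With equal orientation each right-angled corner lies in the other triangle,
      which makes both normalized coordinate differences nonnegative with either sign.\<close>
    have "c \<in> scaled_triangle c' r" "c' \<in> scaled_triangle c r" using mem(1)[of c] mem(1)[of c'] e True by simp_all
    note scaled_triangle_iff[OF r(1), THEN iffD1, OF this(1)] scaled_triangle_iff[OF r(1), THEN iffD1, OF this(2)]
    moreover have "(fst c' - fst c) / r = - X" "(snd c' - snd c) / r = - Y"
      unfolding X_def Y_def by (simp_all add: minus_divide_left)
    ultimately have "0 \<le> X" "0 \<le> Y" "0 \<le> - X" "0 \<le> - Y" unfolding X_def Y_def by simp_all
    then have "X = 0" "Y = 0" by linarith+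
    then show ?thesis using r(1) True by (simp add: X_def Y_def prod_eq_iff)
  next
    case False
    then have rr: "r' = - r" using r(2) by auto
    define X Y where "X = (fst c - fst c') / r'" and "Y = (snd c - snd c') / r'"
    have "(fst c + r - fst c') / r' = X - 1" "(snd c + r - snd c') / r' = Y - 1"
      using r(1) by (simp_all add: X_def Y_def rr field_simps)
    \<comment> \<open>With opposite orientation, testing the vertices of one triangle in the other
      gives \<open>X \<ge> 1\<close> and \<open>Y \<ge> 1\<close> together with
      \<open>X + Y \<le> 1\<close>.\<close>
    then have "0 \<le> X - 1" "0 \<le> Y - 1" "X + Y \<le> 1"
      using mem(1)[of c] mem(2)[of c] mem(3)[of c] unfolding e scaled_triangle_iff[OF r'] by (auto simp: X_def Y_def)
    then show ?thesis by linarith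
  qed
qed

lemma triangular_lattice_eq: "triangular_lattice k = range (\<lambda>m. scaled_triangle (triangle_corner k m) (triangle_sign m * 2 powi k))"
proof -
  have low: "convex hull {(of_int i * 2 powi k, of_int j * 2 powi k), ((of_int i + 1) * 2 powi k, of_int j * 2 powi k), (of_int i * 2 powi k, (of_int j + 1) * 2 powi k)}
     = scaled_triangle (triangle_corner k (i, j, True)) (triangle_sign (i, j, True) * 2 powi k)" for i j
    by (simp add: scaled_triangle_eq triangle_corner_def triangle_sign_def distrib_right)
  have up: "convex hull {((of_int i + 1) * 2 powi k, (of_int j + 1) * 2 powi k), (of_int i * 2 powi k, (of_int j + 1) * 2 powi k), ((of_int i + 1) * 2 powi k, of_int j * 2 powi k)}
     = scaled_triangle (triangle_corner k (i, j, False)) (triangle_sign (i, j, False) * 2 powi k)" for i j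
    by (simp add: scaled_triangle_eq triangle_corner_def triangle_sign_def distrib_right)
  show ?thesis
    unfolding triangular_lattice_def Let_def low up
  proof (intro set_eqI iffI)
    fix D assume "D \<in> range (\<lambda>m. scaled_triangle (triangle_corner k m) (triangle_sign m * 2 powi k))"
    then obtain i j b where "D = scaled_triangle (triangle_corner k (i, j, b)) (triangle_sign (i, j, b) * 2 powi k)" by auto
    then show "D \<in> (\<Union>i j. {scaled_triangle (triangle_corner k (i, j, True)) (triangle_sign (i, j, True) * 2 powi k),
        scaled_triangle (triangle_corner k (i, j, False)) (triangle_sign (i, j, False) * 2 powi k)})"
      by (cases b) auto
  qed auto
qed

lemma lattice_triangle_iff:
  assumes "\<epsilon> \<in> {1, - 1}"
  shows "(\<lambda>z. c + (\<epsilon> * 2 powi k) *\<^sub>R z) ` std_triangle \<in> triangular_lattice k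
    \<longleftrightarrow> (\<exists>m. \<epsilon> = triangle_sign m \<and> c = triangle_corner k m)"
  unfolding triangular_lattice_eq scaled_triangle_def[symmetric]
proof
  assume "scaled_triangle c (\<epsilon> * 2 powi k) \<in> range (\<lambda>m. scaled_triangle (triangle_corner k m) (triangle_sign m * 2 powi k))"
  then obtain m where m: "scaled_triangle c (\<epsilon> * 2 powi k) = scaled_triangle (triangle_corner k m) (triangle_sign m * 2 powi k)" by auto
  have "c = triangle_corner k m \<and> \<epsilon> * 2 powi k = triangle_sign m * 2 powi k"
    by (rule scaled_triangle_inj[OF m]) (use assms in \<open>auto simp: triangle_sign_def\<close>)
  then show "\<exists>m. \<epsilon> = triangle_sign m \<and> c = triangle_corner k m" by (intro exI[of _ m]) simp
qed auto

text \<open>\<open>haar_triangle_minus\<close> is placed at \<open>i = 0\<close> because it lives on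
  the first two children in the list.\<close>

definition triangle_shape :: "nat \<Rightarrow> nat \<Rightarrow> real \<times> real \<Rightarrow> real" where
  "triangle_shape j i = (if j = 0 then haar_triangle_0 else if i = 0 then haar_triangle_minus else haar_triangle_plus)"

definition triangle_function :: "int \<Rightarrow> int \<times> int \<times> bool \<Rightarrow> nat \<Rightarrow> nat \<Rightarrow> real \<times> real \<Rightarrow> real" where
  "triangle_function k m j i z =
     2 powi (- k) * triangle_shape j i ((triangle_sign m * 2 powi (- k)) *\<^sub>R (z - triangle_corner k m))"

lemma std_triangle_system_eq:
  "std_triangle_system = {triangle_function k m j i | k m j i. j < 2 \<and> i < 2 ^ j}"
  unfolding quaternary_system
proof (intro set_eqI iffI)
  fix f assume "f \<in> std_triangle_system"
  then obtain h k \<epsilon> c where f: "f = (\<lambda>z. 2 powi (- k) * h ((\<epsilon> * 2 powi (- k)) *\<^sub>R (z - c)))"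
    "h \<in> {haar_triangle_0, haar_triangle_plus, haar_triangle_minus}" "\<epsilon> \<in> {1, - 1}"
    "(\<lambda>z. c + (\<epsilon> * 2 powi k) *\<^sub>R z) ` std_triangle \<in> triangular_lattice k"
    unfolding std_triangle_system_def by blast
  obtain m where m: "\<epsilon> = triangle_sign m" "c = triangle_corner k m" using f(4) lattice_triangle_iff[OF f(3)] by blast
  have "f \<in> {triangle_function k m 0 0, triangle_function k m 1 0, triangle_function k m 1 1}"
    using f(2) unfolding f(1) m triangle_function_def[abs_def] triangle_shape_def by auto
  then show "f \<in> (\<Union>k m. {triangle_function k m 0 0, triangle_function k m 1 0, triangle_function k m 1 1})" by blast
next
  fix f assume "f \<in> (\<Union>k m. {triangle_function k m 0 0, triangle_function k m 1 0, triangle_function k m 1 1})"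
  then obtain k m where "f \<in> {triangle_function k m 0 0, triangle_function k m 1 0, triangle_function k m 1 1}" by blast
  then obtain h where h: "h \<in> {haar_triangle_0, haar_triangle_plus, haar_triangle_minus}"
    "f = (\<lambda>z. 2 powi (- k) * h ((triangle_sign m * 2 powi (- k)) *\<^sub>R (z - triangle_corner k m)))"
    unfolding triangle_function_def[abs_def] triangle_shape_def by auto
  have s: "triangle_sign m \<in> {1, - 1}" by (simp add: triangle_sign_def)
  then have "(\<lambda>z. triangle_corner k m + (triangle_sign m * 2 powi k) *\<^sub>R z) ` std_triangle \<in> triangular_lattice k"
    using lattice_triangle_iff[OF s, of "triangle_corner k m" k] by blast
  then show "f \<in> std_triangle_system" unfolding std_triangle_system_def using h s by blast
qed

lemma triangle_shape_measurable: "triangle_shape j i \<in> borel_measurable borel"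
proof -
  have "compact std_triangle" unfolding std_triangle_def by (intro finite_imp_compact_convex_hull) simp
  then have [measurable]: "std_triangle \<in> sets borel" by (intro borel_closed compact_imp_closed)
  have [measurable]: "{0..1 / 2} \<times> {0..1 / 2} \<in> sets (borel :: (real \<times> real) measure)"
    by (intro borel_closed closed_Times) auto
  have [measurable]: "fst \<in> borel_measurable (borel :: (real \<times> real) measure)" "snd \<in> borel_measurable (borel :: (real \<times> real) measure)"
    by (intro borel_measurable_continuous_onI continuous_intros)+
  have "haar_triangle_0 \<in> borel_measurable borel" unfolding haar_triangle_0_def[abs_def] by measurable
  moreover have "haar_triangle_plus \<in> borel_measurable borel"
    unfolding haar_triangle_plus_def case_prod_beta prod.collapse by measurable
  moreover have "haar_triangle_minus \<in> borel_measurable borel"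
    unfolding haar_triangle_minus_def case_prod_beta prod.collapse by measurable
  ultimately show ?thesis by (simp add: triangle_shape_def)
qed

lemma triangle_function_measurable: "triangle_function k m j i \<in> borel_measurable borel"
proof -
  note [measurable] = triangle_shape_measurable
  have [measurable]: "(\<lambda>z. (triangle_sign m * 2 powi (- k)) *\<^sub>R (z - triangle_corner k m)) \<in> borel_measurable borel"
    by (intro borel_measurable_continuous_onI continuous_intros)
  show ?thesis unfolding triangle_function_def[abs_def] by measurable
qed

section \<open>Comparison off the sides of the triangles\<close>

lemma AE_off_line:
  fixes a b v :: real
  assumes "a \<noteq> 0 \<or> b \<noteq> 0"
  shows "AE z in lborel. a * fst z + b * snd z \<noteq> v"
proof -
  have "negligible {z. (a, b) \<bullet> z = v}" using assms by (intro negligible_hyperplane) (auto simp: zero_prod_def)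
  then have "{z. (a, b) \<bullet> z = v} \<in> null_sets lebesgue" by (simp add: negligible_iff_null_sets)
  then have "AE z in lborel. z \<notin> {z. (a, b) \<bullet> z = v}"
    using AE_not_in[of "{z. (a, b) \<bullet> z = v}" lebesgue] by (simp add: AE_completion_iff)
  then show ?thesis by eventually_elim (simp add: inner_prod_def)
qed

lemma triangle_shape_values:
  fixes X Y :: real
  assumes "X \<noteq> 0" "X \<noteq> 1 / 2" "Y \<noteq> 0" "Y \<noteq> 1 / 2" "X + Y \<noteq> 1 / 2" "X + Y \<noteq> 1"
  defines "c0 \<equiv> of_bool (X > 0 \<and> Y > 0 \<and> X + Y < 1 / 2) :: real"
    and "c1 \<equiv> of_bool (X < 1 / 2 \<and> Y < 1 / 2 \<and> X + Y > 1 / 2) :: real"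
    and "c2 \<equiv> of_bool (Y > 1 / 2 \<and> X > 0 \<and> X + Y < 1) :: real"
    and "c3 \<equiv> of_bool (X > 1 / 2 \<and> Y > 0 \<and> X + Y < 1) :: real"
  shows "haar_triangle_0 (X, Y) = sqrt 2 * (c0 + c1 - c2 - c3)"
    and "haar_triangle_minus (X, Y) = 2 * (c0 - c1)"
    and "haar_triangle_plus (X, Y) = 2 * (c2 - c3)"
  using assms(1-6) unfolding haar_triangle_0_def haar_triangle_minus_def haar_triangle_plus_def prod.case std_triangle_iff
    c0_def c1_def c2_def c3_def
  by auto

text \<open>In the coordinates \<open>X\<close> and \<open>Y\<close> the lattice triangle becomes
  the standard one. For upper right triangles the half-turn reverses the half-open inequalities, so
  strict inequalities describe both orientations only away from the six lines that contain the sides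
  of the children.\<close>

lemma triangle_child_iff:
  fixes X Y :: real
  assumes g: "X \<noteq> 0" "X \<noteq> 1 / 2" "Y \<noteq> 0" "Y \<noteq> 1 / 2" "X + Y \<noteq> 1 / 2" "X + Y \<noteq> 1"
    and X: "X = triangle_sign m * 2 powi (- k) * (fst z - fst (triangle_corner k m))"
    and Y: "Y = triangle_sign m * 2 powi (- k) * (snd z - snd (triangle_corner k m))"
  shows "triangle_loc (k - 1) z = triangle_children m ! 0 \<longleftrightarrow> X > 0 \<and> Y > 0 \<and> X + Y < 1 / 2" (is ?c0)
    and "triangle_loc (k - 1) z = triangle_children m ! 1 \<longleftrightarrow> X < 1 / 2 \<and> Y < 1 / 2 \<and> X + Y > 1 / 2" (is ?c1)
    and "triangle_loc (k - 1) z = triangle_children m ! 2 \<longleftrightarrow> Y > 1 / 2 \<and> X > 0 \<and> X + Y < 1" (is ?c2)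
    and "triangle_loc (k - 1) z = triangle_children m ! 3 \<longleftrightarrow> X > 1 / 2 \<and> Y > 0 \<and> X + Y < 1" (is ?c3)
proof -
  obtain i j b where m: "m = (i, j, b)" by (cases m)
  define P Q where "P = fst z / 2 powi (k - 1)" and "Q = snd z / 2 powi (k - 1)"
  have w: "2 powi (k - 1) = (2 powi k / 2 :: real)" "2 powi (- k) = (1 / 2 powi k :: real)"
    by (simp_all add: power_int_diff power_int_minus inverse_eq_divide)
  have loc: "triangle_loc (k - 1) z = (a, c, e) \<longleftrightarrow> (of_int a \<le> P \<and> P < of_int a + 1) \<and> (of_int c \<le> Q \<and> Q < of_int c + 1)
     \<and> (e \<longleftrightarrow> P - of_int a + (Q - of_int c) < 1)" for a c e
    unfolding triangle_loc_eq_iff square_loc_def prod.inject P_def[symmetric] Q_def[symmetric] floor_eq_iff by auto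
  have ?c0 ?c1 ?c2 ?c3 if b: b
  proof -
    have PQ: "P = 2 * of_int i + 2 * X" "Q = 2 * of_int j + 2 * Y"
      unfolding X Y P_def Q_def w using b by (simp_all add: m triangle_sign_def triangle_corner_def field_simps)
    have "triangle_children m ! 0 = (2 * i, 2 * j, True)" "triangle_children m ! 1 = (2 * i, 2 * j, False)"
      "triangle_children m ! 2 = (2 * i, 2 * j + 1, True)" "triangle_children m ! 3 = (2 * i + 1, 2 * j, True)"
      using b by (simp_all add: m triangle_children_def)
    then show ?c0 ?c1 ?c2 ?c3
      using g by (simp_all only: loc PQ of_int_add of_int_mult of_int_numeral of_int_1 simp_thms)
        (rule iffI; elim conjE; intro conjI; linarith)+
  qed
  moreover have ?c0 ?c1 ?c2 ?c3 if b: "\<not> b"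
  proof -
    have PQ: "P = 2 * of_int i + 2 - 2 * X" "Q = 2 * of_int j + 2 - 2 * Y"
      unfolding X Y P_def Q_def w using b by (simp_all add: m triangle_sign_def triangle_corner_def field_simps)
    have "triangle_children m ! 0 = (2 * i + 1, 2 * j + 1, False)" "triangle_children m ! 1 = (2 * i + 1, 2 * j + 1, True)"
      "triangle_children m ! 2 = (2 * i + 1, 2 * j, False)" "triangle_children m ! 3 = (2 * i, 2 * j + 1, False)"
      using b by (simp_all add: m triangle_children_def)
    then show ?c0 ?c1 ?c2 ?c3
      using g by (simp_all only: loc PQ of_int_add of_int_mult of_int_numeral of_int_1 simp_thms)
        (rule iffI; elim conjE; intro conjI; linarith)+
  qed
  ultimately show ?c0 ?c1 ?c2 ?c3
    by blast+
qed

lemma triangle_function_AE: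
  assumes "j < 2" "i < (2::nat) ^ j"
  shows "AE z in lborel. triangle_function k m j i z
    = cell_structure.cell_haar triangle_loc 2 (\<lambda>k m l. triangle_children m ! l) (1 / 2) k m j i z"
proof -
  interpret cell_structure triangle_loc triangle_parent 2 "\<lambda>k m l. triangle_children m ! l" "1 / 2"
    by (rule triangle_cell_structure)
  define r where "r = triangle_sign m * 2 powi (- k)"
  define c where "c = triangle_corner k m"
  have r: "r \<noteq> 0" by (simp add: r_def triangle_sign_def)
  \<comment> \<open>Lines are null sets. Six of them are removed: those containing the sides of the
    triangle and of its central child.\<close>
  have lines: "AE z in lborel :: (real \<times> real) measure. r * (fst z - fst c) \<noteq> v" "AE z in lborel :: (real \<times> real) measure. r * (snd z - snd c) \<noteq> v"
    "AE z in lborel :: (real \<times> real) measure. r * (fst z - fst c) + r * (snd z - snd c) \<noteq> v" for v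
    using AE_off_line[of r 0 "v + r * fst c"] AE_off_line[of 0 r "v + r * snd c"]
      AE_off_line[of r r "v + r * fst c + r * snd c"] r
    by (auto elim!: eventually_mono simp: algebra_simps)
  have "AE z in lborel :: (real \<times> real) measure. (r * (fst z - fst c) \<noteq> 0 \<and> r * (fst z - fst c) \<noteq> 1 / 2) \<and> (r * (snd z - snd c) \<noteq> 0 \<and> r * (snd z - snd c) \<noteq> 1 / 2)
    \<and> (r * (fst z - fst c) + r * (snd z - snd c) \<noteq> 1 / 2 \<and> r * (fst z - fst c) + r * (snd z - snd c) \<noteq> 1)"
    by (intro AE_conjI lines)
  then show ?thesis
  proof eventually_elim
    case (elim z)
    define X Y where "X = r * (fst z - fst c)" and "Y = r * (snd z - snd c)"
    define C :: "nat \<Rightarrow> real" where "C l = of_bool (triangle_loc (k - 1) z = triangle_children m ! l)" for l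
    have g: "X \<noteq> 0" "X \<noteq> 1 / 2" "Y \<noteq> 0" "Y \<noteq> 1 / 2" "X + Y \<noteq> 1 / 2" "X + Y \<noteq> 1"
      using elim by (auto simp: X_def Y_def)
    have ch: "C 0 = of_bool (X > 0 \<and> Y > 0 \<and> X + Y < 1 / 2)" "C 1 = of_bool (X < 1 / 2 \<and> Y < 1 / 2 \<and> X + Y > 1 / 2)"
      "C 2 = of_bool (Y > 1 / 2 \<and> X > 0 \<and> X + Y < 1)" "C 3 = of_bool (X > 1 / 2 \<and> Y > 0 \<and> X + Y < 1)"
      unfolding C_def using triangle_child_iff[OF g X_def[unfolded r_def c_def] Y_def[unfolded r_def c_def]] by (simp_all only:)
    note sh = triangle_shape_values[OF g, folded ch]
    have arg: "(triangle_sign m * 2 powi (- k)) *\<^sub>R (z - triangle_corner k m) = (X, Y)"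
      by (simp add: X_def Y_def r_def c_def prod_eq_iff)
    \<comment> \<open>The volume constant \<open>1 / 2\<close> of a triangle changes the
      normalizations into \<open>2 powi k / sqrt 2\<close> and \<open>2 powi k / 2\<close>, which
      accounts for the heights \<open>sqrt 2\<close> and \<open>2\<close> of the triangular Haar
      functions.\<close>
    have n: "sqrt (1 / 2 * 2 powi (2 * k)) = 2 powi k / sqrt 2" "sqrt (1 / 2 * 2 powi (2 * k - 1)) = 2 powi k / 2"
    proof -
      show "sqrt (1 / 2 * 2 powi (2 * k)) = 2 powi k / sqrt 2"
        unfolding real_sqrt_mult sqrt_powers by (simp add: real_sqrt_divide)
      show "sqrt (1 / 2 * 2 powi (2 * k - 1)) = 2 powi k / 2"
        unfolding real_sqrt_mult sqrt_powers by (simp add: real_sqrt_divide)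
    qed
    have inv: "2 powi (- k) = (1 / 2 powi k :: real)" by (simp add: power_int_minus inverse_eq_divide)
    note eqs = cell_haar_quaternary[OF refl, of k m z, folded C_def, unfolded n]
    show ?case using assms
    proof (cases rule: binary_index_cases)
      case 1
      show ?thesis unfolding 1 eqs triangle_function_def arg unfolding inv
        by (simp add: triangle_shape_def sh)
    next
      case 2
      show ?thesis unfolding 2 eqs triangle_function_def arg unfolding inv
        by (simp add: triangle_shape_def sh)
    next
      case 3
      show ?thesis unfolding 3 eqs triangle_function_def arg unfolding inv
        by (simp add: triangle_shape_def sh)
    qed
  qed
qed

theorem sharp_transform_bound_triangle:
  fixes p q a b :: real
  assumes p: "1 < p" "1 / p + 1 / q = 1" and b: "b \<noteq> 0"
  shows "sharp_transform_bound p (triangle_system a b) (max p q - 1)"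
proof -
  have A: "triangle_map a b (s, t) = (s + t * a, t * b)" for s t by (simp add: triangle_map_def mult.commute)
  show ?thesis
    unfolding triangle_system_def
    by (rule sharp_transform_bound_image[OF triangle_cell_structure b A p triangle_function_measurable
          triangle_function_AE std_triangle_system_eq])
qed

theorem mainTheorem1:
  fixes p q :: real
  assumes "1 < p" and "1 / p + 1 / q = 1"
  shows "(\<forall>b \<phi>. 0 < b \<and> 0 < \<phi> \<and> \<phi> < pi \<longrightarrow>
            sharp_transform_bound p (parallelogram_system b \<phi>) (max p q - 1) \<and>
            sharp_transform_bound p (parallelogram_system_d b \<phi>) (max p q - 1)) \<and>
         (\<forall>a b. b \<noteq> 0 \<longrightarrow> sharp_transform_bound p (triangle_system a b) (max p q - 1)) \<and>
         (\<forall>ord :: int \<Rightarrow> ('n::finite \<Rightarrow> int) \<Rightarrow> nat \<Rightarrow> (real ^ 'n) set. subcube_ordering ord \<longrightarrow>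
            sharp_transform_bound p (new_haar_system ord) (max p q - 1))"
proof (intro conjI allI impI; (elim conjE)?)
  fix b \<phi> :: real
  assume "0 < b" "0 < \<phi>" "\<phi> < pi"
  then have b: "b * sin \<phi> \<noteq> 0" using sin_gt_zero[of \<phi>] by simp
  show "sharp_transform_bound p (parallelogram_system b \<phi>) (max p q - 1)"
    by (rule sharp_transform_bound_parallelogram(1)[OF assms b])
  show "sharp_transform_bound p (parallelogram_system_d b \<phi>) (max p q - 1)"
    by (rule sharp_transform_bound_parallelogram(2)[OF assms b])
next
  fix a b :: real
  assume "b \<noteq> 0"
  then show "sharp_transform_bound p (triangle_system a b) (max p q - 1)"
    by (rule sharp_transform_bound_triangle[OF assms])
next
  fix ord :: "int \<Rightarrow> ('n::finite \<Rightarrow> int) \<Rightarrow> nat \<Rightarrow> (real ^ 'n) set"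
  assume "subcube_ordering ord"
  then show "sharp_transform_bound p (new_haar_system ord) (max p q - 1)"
    by (rule sharp_transform_bound_cubes[OF _ assms])
qed

end
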